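(* Let $m>n$ be positive integers. The minimal number of Plücker relations in the partial flag variety $SL_m/Q_{n,m}$ is $\varsigma(\mathcal{P}_{n,m})$. Hence, the minimal number of Plücker--Grassmann relations in $Gr(i,m)$ is $$\sum_{k=\max\{0,\,2i-m\}}^{i-1}\left(\frac12\right)\frac{i-k-1}{i-k+1}\binom{m}{k}\binom{m-k}{2i-2k}\binom{2i-2k}{i-k}$$ for each $1\le i<m$, and the minimal number of incidence relations in $SL_m/Q_{n,m}$ is $$\sum_{i=1}^{n}\ \sum_{k=\max\{0,\,2i-m\}}^{i-1}\ \sum_{j=1}^{\min\{n-i,\,m-2i+k\}}\frac{i-k}{i+j-k+1}\binom{m}{k}\binom{m-k}{2i+j-2k}\binom{2i+j-2k}{i-k}.$$
   Context: Let $\mathbb{K}$ be an algebraically closed field of characteristic zero. A semistandard Young tableau of partition shape $\lambda$ is a filling of the Ferrers diagram of $\lambda$ (English notation) with positive integers, strictly increasing down columns and weakly increasing from left to right along rows. $\mathrm{SSYT}_m^n$ denotes the set of all semistandard Young tableaux with at most $n$ rows and entries in $\{1,\dots,m\}$. For $T$ of shape $\lambda$ and $T'$ of shape $\mu$, $T\star T'$ is the semistandard Young tableau of shape $\lambda+\mu$ obtained by horizontally concatenating the rows of $T$ and $T'$ and sorting the entries in each row in weakly increasing order. $G_{n,m}$ is the set of tableaux in $\mathrm{SSYT}_m^n$ with exactly one column; $\mathcal{P}_{n,m}$ is the ideal of the polynomial ring $\mathbb{K}[G_{n,m}]$ generated by all $T_1T_2-T_3T_4$ with $T_1,T_2,T_3,T_4\in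 G_{n,m}$ distinct and $T_1\star T_2=T_3\star T_4$; $\varsigma(\mathcal{P}_{n,m})$ is the cardinality of a minimal generating set of $\mathcal{P}_{n,m}$ (minimal number of generators). $SL_m/Q_{n,m}$ is the partial flag variety $\{0\subsetneq V_1\subsetneq\cdots\subsetneq V_n\subsetneq\mathbb{K}^m\mid\dim V_i=i\}$, embedded in $\prod_{i=1}^nGr(i,m)\hookrightarrow\prod_{i=1}^n\mathbb{P}^{\binom mi-1}$ by the Plücker embeddings. The Plücker coordinates are variables $p_\sigma$ for $\sigma\subseteq\{1,\dots,m\}$, $1\le|\sigma|\le n$ (in bijection with $G_{n,m}$), and the ideal of Plücker relations is the multihomogeneous ideal of $\mathbb{K}[p_\sigma]$ of all polynomial relations among Plücker coordinates on $SL_m/Q_{n,m}$ ($p_\sigma$ having multidegree the basis vector $e_{|\sigma|}$). The minimal number of Plücker relations is the number of elements of a minimal homogeneous generating set of this ideal. The Plücker--Grassmann relations are those within a single Grassmannian: for $Gr(i,m)$ (the Grassmannian of $i$-dimensional subspaces of $\mathbb{K}^m$) their minimal number is the minimal number of generators of the homogeneous ideal of $Gr(i,m)$ in $\mathbb{P}^{\binom mi-1}$. The incidence relations are those between Grassmannians for distinct $i$: their minimal number is the number of elements of a minimal multihomogeneous generating set of the ideal of Plücker relations whose multidegree involves distinct indices. *)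

theory Defs
  imports
    "HOL-Library.Poly_Mapping"
    "HOL-Algebra.Ideal"
    "Jordan_Normal_Form.DL_Rank_Submatrix"
begin

section \<open>Polynomial rings and generating sets of ideals\<close>

text \<open>
  Monomials are finitely supported exponent functions. For a set of variables \<open>V\<close>, the ring
  \<open>K[V]\<close> is a record in the style of HOL-Algebra, so that ideals and generated ideals are those
  of the library, taken inside \<open>K[V]\<close> and not in the ring over all variables of the type.
\<close>

type_synonym ('v, 'k) mpoly = "('v \<Rightarrow>\<^sub>0 nat) \<Rightarrow>\<^sub>0 'k"

definition poly_ring :: "'v set \<Rightarrow> ('v, 'k::comm_ring_1) mpoly ring" where
  "poly_ring V = \<lparr>carrier = {f. \<forall>a\<in>Poly_Mapping.keys f. Poly_Mapping.keys a \<subseteq> V},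
     monoid.mult = (*), one = 1, zero = 0, add = (+)\<rparr>"

lemma poly_ring_simps [simp]:
  "f \<in> carrier (poly_ring V) \<longleftrightarrow> (\<forall>a\<in>Poly_Mapping.keys f. Poly_Mapping.keys a \<subseteq> V)"
  "monoid.mult (poly_ring V) = (*)" "one (poly_ring V) = 1"
  "zero (poly_ring V) = 0" "add (poly_ring V) = (+)"
  by (auto simp: poly_ring_def)

lemma cring_poly_ring: "cring (poly_ring V)"
proof (rule cringI)
  show "abelian_group (poly_ring V :: ('a, 'b) mpoly ring)"
  proof (rule abelian_groupI)
    fix f :: "('a, 'b) mpoly" assume "f \<in> carrier (poly_ring V)"
    then show "\<exists>g\<in>carrier (poly_ring V). g \<oplus>\<^bsub>poly_ring V\<^esub> f = \<zero>\<^bsub>poly_ring V\<^esub>"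
      by (intro bexI[of _ "- f"]) auto
  qed (use Poly_Mapping.keys_add in \<open>fastforce simp: add_ac\<close>)+
  show "Group.comm_monoid (poly_ring V :: ('a, 'b) mpoly ring)"
  proof (rule comm_monoidI)
    fix f g :: "('a, 'b) mpoly"
    assume fg: "f \<in> carrier (poly_ring V)" "g \<in> carrier (poly_ring V)"
    show "f \<otimes>\<^bsub>poly_ring V\<^esub> g \<in> carrier (poly_ring V)"
    proof (simp, intro ballI)
      fix c assume "c \<in> Poly_Mapping.keys (f * g)"
      then obtain a b where "c = a + b" "a \<in> Poly_Mapping.keys f" "b \<in> Poly_Mapping.keys g"
        using keys_mult[of f g] by blast
      then show "Poly_Mapping.keys c \<subseteq> V"
        using fg Poly_Mapping.keys_add[of a b] by (simp, blast)
    qed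
  qed (auto simp: mult_ac)
qed (auto simp: distrib_right)

definition poly_var :: "'v \<Rightarrow> ('v, 'k::comm_ring_1) mpoly" where
  "poly_var v = Poly_Mapping.single (Poly_Mapping.single v 1) 1"

definition poly_eval :: "('v, 'k::comm_ring_1) mpoly \<Rightarrow> ('v \<Rightarrow> 'k) \<Rightarrow> 'k" where
  "poly_eval f x = (\<Sum>a\<in>Poly_Mapping.keys f. Poly_Mapping.lookup f a *
     (\<Prod>v\<in>Poly_Mapping.keys a. x v ^ Poly_Mapping.lookup a v))"

definition total_degree :: "('v \<Rightarrow>\<^sub>0 nat) \<Rightarrow> nat" where
  "total_degree a = (\<Sum>v\<in>Poly_Mapping.keys a. Poly_Mapping.lookup a v)"

text \<open>Homogeneity with respect to a grading of the monomials; \<open>0\<close> counts as homogeneous.\<close>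

definition homogeneous_wrt ::
    "(('v \<Rightarrow>\<^sub>0 nat) \<Rightarrow> 'd) \<Rightarrow> ('v, 'k::comm_ring_1) mpoly \<Rightarrow> bool" where
  "homogeneous_wrt deg f \<longleftrightarrow> (\<exists>d. \<forall>a\<in>Poly_Mapping.keys f. deg a = d)"

definition min_num_generators :: "('a, 'b) ring_scheme \<Rightarrow> 'a set \<Rightarrow> nat" where
  "min_num_generators R I =
     (LEAST k. \<exists>S \<subseteq> carrier R. finite S \<and> card S = k \<and> genideal R S = I)"

text \<open>Minimality is with respect to inclusion; all generators are required to satisfy \<open>H\<close>.\<close>

definition minimal_generating_set ::
    "('a, 'b) ring_scheme \<Rightarrow> ('a \<Rightarrow> bool) \<Rightarrow> 'a set \<Rightarrow> 'a set \<Rightarrow> bool" where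
  "minimal_generating_set R H I S \<longleftrightarrow>
     S \<subseteq> carrier R \<and> (\<forall>f\<in>S. H f) \<and> genideal R S = I \<and> (\<forall>S'. S' \<subset> S \<longrightarrow> genideal R S' \<noteq> I)"


section \<open>Semistandard Young tableaux\<close>

text \<open>A tableau is the list of its rows from top to bottom; only nonempty rows are listed.\<close>

type_synonym tableau = "nat list list"

definition SSYT :: "nat \<Rightarrow> nat \<Rightarrow> tableau set" where
  "SSYT n m = {T. length T \<le> n \<and> [] \<notin> set T \<and> sorted_wrt (\<ge>) (map length T) \<and>
     (\<forall>row\<in>set T. set row \<subseteq> {1..m} \<and> sorted row) \<and>
     (\<forall>r c. Suc r < length T \<longrightarrow> c < length (T ! Suc r) \<longrightarrow> T ! r ! c < T ! Suc r ! c)}"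

definition tableau_row :: "tableau \<Rightarrow> nat \<Rightarrow> nat list" where
  "tableau_row T r = (if r < length T then T ! r else [])"

definition tableau_star :: "tableau \<Rightarrow> tableau \<Rightarrow> tableau" (infixl \<open>\<star>\<close> 70) where
  "T \<star> T' = map (\<lambda>r. sort (tableau_row T r @ tableau_row T' r)) [0..<max (length T) (length T')]"

text \<open>The number of columns is the length of the first row.\<close>

definition one_column_tableaux :: "nat \<Rightarrow> nat \<Rightarrow> tableau set" where
  "one_column_tableaux n m = {T \<in> SSYT n m. T \<noteq> [] \<and> length (hd T) = 1}"

definition tableau_ideal :: "nat \<Rightarrow> nat \<Rightarrow> (tableau, 'k::comm_ring_1) mpoly set" where
  "tableau_ideal n m = genideal (poly_ring (one_column_tableaux n m))
     {poly_var T1 * poly_var T2 - poly_var T3 * poly_var T4 | T1 T2 T3 T4.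
        {T1, T2, T3, T4} \<subseteq> one_column_tableaux n m \<and> distinct [T1, T2, T3, T4] \<and>
        T1 \<star> T2 = T3 \<star> T4}"


section \<open>Grassmannians, partial flag varieties and Pluecker ideals\<close>

definition grassmannian :: "nat \<Rightarrow> nat \<Rightarrow> 'k::field vec set set" where
  "grassmannian i m = {W. VectorSpace.subspace class_ring W (module_vec TYPE('k) m) \<and>
     vectorspace.dim class_ring ((module_vec TYPE('k) m)\<lparr>carrier := W\<rparr>) = i}"

text \<open>Only the values \<open>V 1, \<dots>, V n\<close> of a flag \<open>V\<close> are relevant.\<close>

definition partial_flags :: "nat \<Rightarrow> nat \<Rightarrow> (nat \<Rightarrow> 'k::field vec set) set" where
  "partial_flags n m = {V. (\<forall>i\<in>{1..n}. V i \<in> grassmannian i m) \<and>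
     {0\<^sub>v m} \<subset> V 1 \<and> (\<forall>i\<in>{1..<n}. V i \<subset> V (Suc i)) \<and> V n \<subset> carrier_vec m}"

text \<open>
  The columns of \<open>A\<close> are an ordered basis of a subspace \<open>W\<close> of \<open>K\<^sup>m\<close>, and the coordinate \<open>\<sigma>\<close>
  is the maximal minor on the rows in \<open>\<sigma> \<subseteq> {1,\<dots>,m}\<close>; matrix rows are counted from \<open>0\<close>.
\<close>

definition plucker_coord :: "'k::comm_ring_1 mat \<Rightarrow> nat set \<Rightarrow> 'k" where
  "plucker_coord A \<sigma> = det (submatrix A {r. Suc r \<in> \<sigma>} UNIV)"

text \<open>An \<open>m \<times> i\<close> matrix whose columns span an \<open>i\<close>-dimensional space \<open>W\<close>: they form a basis.\<close>

definition basis_matrix :: "nat \<Rightarrow> nat \<Rightarrow> 'k::field vec set \<Rightarrow> 'k mat \<Rightarrow> bool" where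
  "basis_matrix m i W A \<longleftrightarrow> A \<in> carrier_mat m i \<and> vec_space.col_space m A = W"

definition flag_vars :: "nat \<Rightarrow> nat \<Rightarrow> nat set set" where
  "flag_vars n m = {\<sigma>. \<sigma> \<subseteq> {1..m} \<and> 1 \<le> card \<sigma> \<and> card \<sigma> \<le> n}"

definition grassmannian_vars :: "nat \<Rightarrow> nat \<Rightarrow> nat set set" where
  "grassmannian_vars i m = {\<sigma>. \<sigma> \<subseteq> {1..m} \<and> card \<sigma> = i}"

text \<open>
  The bases of \<open>V 1, \<dots>, V n\<close> range independently over all bases. Hence the coordinates range over
  all representatives of the point of the product of projective spaces, and a polynomial belongs
  to the ideal iff all of its multihomogeneous components vanish on the flag variety.
\<close>

definition plucker_ideal :: "nat \<Rightarrow> nat \<Rightarrow> (nat set, 'k::field) mpoly set" where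
  "plucker_ideal n m = {f \<in> carrier (poly_ring (flag_vars n m)).
     \<forall>V\<in>partial_flags n m. \<forall>A. (\<forall>i\<in>{1..n}. basis_matrix m i (V i) (A i)) \<longrightarrow>
       poly_eval f (\<lambda>\<sigma>. plucker_coord (A (card \<sigma>)) \<sigma>) = 0}"

definition grassmannian_ideal :: "nat \<Rightarrow> nat \<Rightarrow> (nat set, 'k::field) mpoly set" where
  "grassmannian_ideal i m = {f \<in> carrier (poly_ring (grassmannian_vars i m)).
     \<forall>W\<in>grassmannian i m. \<forall>A. basis_matrix m i W A \<longrightarrow> poly_eval f (plucker_coord A) = 0}"

definition multidegree :: "(nat set \<Rightarrow>\<^sub>0 nat) \<Rightarrow> nat \<Rightarrow> nat" where
  "multidegree a i = (\<Sum>\<sigma> \<in> {\<sigma>\<in>Poly_Mapping.keys a. card \<sigma> = i}. Poly_Mapping.lookup a \<sigma>)"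

text \<open>For multihomogeneous \<open>f \<noteq> 0\<close>: the multidegree of \<open>f\<close> involves at least two indices.\<close>

definition incidence_relation :: "(nat set, 'k::comm_ring_1) mpoly \<Rightarrow> bool" where
  "incidence_relation f \<longleftrightarrow>
     (\<exists>a\<in>Poly_Mapping.keys f. \<exists>i j. i \<noteq> j \<and> multidegree a i \<noteq> 0 \<and> multidegree a j \<noteq> 0)"

definition minimal_plucker_relations ::
    "nat \<Rightarrow> nat \<Rightarrow> (nat set, 'k::field) mpoly set \<Rightarrow> bool" where
  "minimal_plucker_relations n m S \<longleftrightarrow>
     minimal_generating_set (poly_ring (flag_vars n m)) (homogeneous_wrt total_degree)
       (plucker_ideal n m) S"

definition minimal_multihomogeneous_plucker_relations ::
    "nat \<Rightarrow> nat \<Rightarrow> (nat set, 'k::field) mpoly set \<Rightarrow> bool" where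
  "minimal_multihomogeneous_plucker_relations n m S \<longleftrightarrow>
     minimal_generating_set (poly_ring (flag_vars n m)) (homogeneous_wrt multidegree)
       (plucker_ideal n m) S"

definition minimal_plucker_grassmann_relations ::
    "nat \<Rightarrow> nat \<Rightarrow> (nat set, 'k::field) mpoly set \<Rightarrow> bool" where
  "minimal_plucker_grassmann_relations i m S \<longleftrightarrow>
     minimal_generating_set (poly_ring (grassmannian_vars i m)) (homogeneous_wrt total_degree)
       (grassmannian_ideal i m) S"

end

theory Submission
  imports Defs "Jordan_Normal_Form.Char_Poly" "HOL-Library.FuncSet"
begin

text \<open>
  The Pluecker ideal of the flag variety, the ideal of a Grassmannian and the ideal of the tableau
  binomials are governed by one partial order. A column \<open>\<sigma>\<close> dominates a column \<open>\<tau>\<close> if \<open>\<sigma>\<close> can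
  stand to the left of \<open>\<tau>\<close> in a semistandard tableau: it is at least as long, and its entries are
  at most those of \<open>\<tau>\<close>, row by row. A monomial is standard if its variables are pairwise comparable,
  that is, if they are the columns of a semistandard tableau. In all three cases a product of two
  incomparable variables is congruent, modulo the ideal, to a combination of products of two
  variables that are further apart, and no nonzero combination of standard monomials lies in the
  ideal.

  These two properties, collected in the locale \<open>straightening\<close>, already determine the minimal
  number of generators. Rewriting ends, because the variables are finitely many, and so each
  monomial has a standard representative modulo the quadrics of the ideal; hence the quadrics
  generate the ideal, and they have a basis with exactly one element for each incomparable pair of
  variables. Since the ideal contains nothing of degree less than two, the quadratic parts of any
  generators span the space of quadrics. So the minimal number of generators is the number of
  incomparable pairs, and the minimal homogeneous generating sets are the homogeneous bases of the
  space of quadrics. This works in each multidegree separately. The Pluecker ideal and the tableau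
  ideal have the same incomparable pairs, which is the first claim.

  Straightening in the Pluecker ideals comes from the Garnir relations (\<open>garnir_relation\<close>): the
  alternating sum of a product of two minors over all permutations of \<open>a + 1\<close> rows vanishes if both
  minors are formed from the column space of a matrix with \<open>a\<close> columns. In the tableau ideal the two
  variables are replaced by their row-wise minimum and maximum.

  For independence, the matrix with entry \<open>t ^ (B ^ (r * M + c))\<close> in row \<open>r\<close> and column \<open>c\<close> is used.
  As a polynomial in \<open>t\<close>, a minor has the degree of its diagonal term, and the degree of a product of
  minors records in base \<open>B\<close> how often each number occurs in each row of the tableau. The rows
  determine a semistandard tableau, so different standard monomials have different degrees. The
  exponents of the diagonal terms also give points at which the tableau ideal vanishes.

  It remains to count incomparable pairs. Among the pairs of subsets of \<open>{1..m}\<close> of sizes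
  \<open>p \<ge> q \<ge> 1\<close> there are \<open>(m choose (p + 1)) * (m choose (q - 1))\<close> in which the first does not
  dominate the second (\<open>card_nondominating_pairs\<close>), and a Vandermonde sum over the size \<open>k\<close> of an
  intersection turns this product into the sums of the theorem.
\<close>

section \<open>The polynomial ring as a vector space\<close>

abbreviation keys :: "('a \<Rightarrow>\<^sub>0 'b::zero) \<Rightarrow> 'a set" where
  "keys \<equiv> Poly_Mapping.keys"

abbreviation lookup :: "('a \<Rightarrow>\<^sub>0 'b::zero) \<Rightarrow> 'a \<Rightarrow> 'b" where
  "lookup \<equiv> Poly_Mapping.lookup"

abbreviation single :: "'a \<Rightarrow> 'b \<Rightarrow> ('a \<Rightarrow>\<^sub>0 'b::zero)" where
  "single \<equiv> Poly_Mapping.single"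

definition mscale :: "'k::field \<Rightarrow> ('v, 'k) mpoly \<Rightarrow> ('v, 'k) mpoly" where
  "mscale c f = single 0 c * f"

lemma lookup_mscale [simp]: "lookup (mscale c f) a = c * lookup f a"
proof -
  have "mscale c f = Poly_Mapping.map ((*) c) f"
    by (simp add: mscale_def mult_map_scale_conv_mult)
  then show ?thesis
    by (simp add: Poly_Mapping.map.rep_eq when_def)
qed

lemma keys_mscale: "keys (mscale c f) \<subseteq> keys f"
  by (auto simp: in_keys_iff)

interpretation mp: vector_space "mscale :: 'k::field \<Rightarrow> ('v, 'k) mpoly \<Rightarrow> ('v, 'k) mpoly"
  by unfold_locales (rule poly_mapping_eqI, simp add: lookup_add algebra_simps)+

lemma poly_eq_sum_monomials: "f = (\<Sum>a\<in>keys f. mscale (lookup f a) (single a 1))"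
proof (rule poly_mapping_eqI)
  fix b
  have "(\<Sum>a\<in>keys f. lookup f a * lookup (single a 1) b) = (\<Sum>a\<in>keys f. if a = b then lookup f b else 0)"
    by (intro sum.cong) (auto simp: lookup_single)
  also have "\<dots> = lookup f b"
    by (auto simp: in_keys_iff)
  finally show "lookup f b = lookup (\<Sum>a\<in>keys f. mscale (lookup f a) (single a 1)) b"
    by (simp add: lookup_sum)
qed

definition component :: "(('v \<Rightarrow>\<^sub>0 nat) \<Rightarrow> bool) \<Rightarrow> ('v, 'k::field) mpoly \<Rightarrow> ('v, 'k) mpoly" where
  "component P f = Poly_Mapping.mapp (\<lambda>a c. c when P a) f"

lemma lookup_component [simp]: "lookup (component P f) a = (if P a then lookup f a else 0)"
  by (auto simp: component_def lookup_mapp in_keys_iff when_def)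

lemma component_add: "component P (f + g) = component P f + component P g"
  by (rule poly_mapping_eqI) (simp add: lookup_add)

lemma component_mscale: "component P (mscale c f) = mscale c (component P f)"
  by (rule poly_mapping_eqI) simp

lemma component_zero: "component P 0 = 0"
  by (rule poly_mapping_eqI) simp

lemma component_id: "(\<forall>a\<in>keys f. P a) \<Longrightarrow> component P f = f"
  by (rule poly_mapping_eqI) (auto simp: in_keys_iff)

lemma component_eq_0: "(\<forall>a\<in>keys f. \<not> P a) \<Longrightarrow> component P f = 0"
  by (rule poly_mapping_eqI) (auto simp: in_keys_iff)

lemma component_span:
  assumes "f \<in> mp.span S"
  shows "component P f \<in> mp.span (component P ` S)"
  using assms
proof (induction rule: mp.span_induct_alt)
  case base
  then show ?case by (simp add: component_zero mp.span_zero)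
next
  case (step c x y)
  then show ?case
    by (simp add: component_add component_mscale mp.span_add mp.span_scale mp.span_base)
qed

lemma total_degree_superset:
  assumes "finite A" "keys a \<subseteq> A"
  shows "total_degree a = (\<Sum>v\<in>A. lookup a v)"
  unfolding total_degree_def
  by (rule sum.mono_neutral_left) (use assms in \<open>auto simp: in_keys_iff\<close>)

lemma total_degree_add: "total_degree (a + b) = total_degree a + total_degree b"
proof -
  let ?A = "keys a \<union> keys b"
  have "total_degree (a + b) = (\<Sum>v\<in>?A. lookup (a + b) v)"
    by (rule total_degree_superset) (use Poly_Mapping.keys_add[of a b] in auto)
  also have "\<dots> = total_degree a + total_degree b"
    by (simp add: total_degree_superset[of ?A] lookup_add sum.distrib)
  finally show ?thesis .
qed

lemma total_degree_single: "total_degree (single x k) = k"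
  by (cases "k = 0") (auto simp: total_degree_def)

lemma total_degree_eq_0_iff: "total_degree a = 0 \<longleftrightarrow> a = 0"
  by (auto simp: total_degree_def in_keys_iff intro: poly_mapping_eqI)

lemma ring_poly_ring: "ring (poly_ring V)"
  using cring_poly_ring by (rule cring.axioms)

lemma a_inv_poly_ring:
  fixes f :: "('v, 'k::comm_ring_1) mpoly"
  assumes "f \<in> carrier (poly_ring V)"
  shows "a_inv (poly_ring V) f = - f"
proof -
  have "abelian_group (poly_ring V :: ('v, 'k) mpoly ring)"
    using ring_poly_ring ring.is_abelian_group by blast
  then show ?thesis
    using assms by (intro abelian_group.minus_equality) auto
qed

lemma ideal_poly_ringI:
  fixes I :: "('v, 'k::comm_ring_1) mpoly set"
  assumes "I \<subseteq> carrier (poly_ring V)" "0 \<in> I" "\<And>f g. f \<in> I \<Longrightarrow> g \<in> I \<Longrightarrow> f + g \<in> I"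
    and mult: "\<And>x f. x \<in> carrier (poly_ring V) \<Longrightarrow> f \<in> I \<Longrightarrow> x * f \<in> I"
  shows "ideal I (poly_ring V)"
proof (rule idealI[OF ring_poly_ring])
  have neg: "- f \<in> I" if "f \<in> I" for f
    using mult[of "-1" f] that by simp
  show "subgroup I (add_monoid (poly_ring V))"
  proof
    fix f assume "f \<in> I"
    then show "inv\<^bsub>add_monoid (poly_ring V)\<^esub> f \<in> I"
      using neg[of f] a_inv_poly_ring[of f V] assms(1) unfolding a_inv_def by (metis subsetD)
  qed (use assms in auto)
next
  fix f x :: "('v, 'k) mpoly" assume f: "f \<in> I" "x \<in> carrier (poly_ring V)"
  show "f \<otimes>\<^bsub>poly_ring V\<^esub> x \<in> I" "x \<otimes>\<^bsub>poly_ring V\<^esub> f \<in> I"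
    using mult[OF f(2,1)] by (simp_all add: mult.commute[of f x])
qed

context
  fixes V :: "'v set" and I :: "('v, 'k::field) mpoly set"
  assumes I: "ideal I (poly_ring V)"
begin

lemma ideal_carrier: "I \<subseteq> carrier (poly_ring V)"
  using ideal.Icarr[OF I] by blast

lemma ideal_zero: "0 \<in> I"
  using additive_subgroup.zero_closed[OF ideal.axioms(1)[OF I]] by simp

lemma ideal_add: "f \<in> I \<Longrightarrow> g \<in> I \<Longrightarrow> f + g \<in> I"
  using additive_subgroup.a_closed[OF ideal.axioms(1)[OF I], of f g] by simp

lemma ideal_mult: "x \<in> carrier (poly_ring V) \<Longrightarrow> f \<in> I \<Longrightarrow> x * f \<in> I"
  using ideal.I_l_closed[OF I, of f x] by simp

lemma ideal_mscale: "f \<in> I \<Longrightarrow> mscale c f \<in> I"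
  unfolding mscale_def by (rule ideal_mult) (auto split: if_splits)

lemma ideal_diff: "f \<in> I \<Longrightarrow> g \<in> I \<Longrightarrow> f - g \<in> I"
  using ideal_add[of f "mscale (-1) g"] ideal_mscale[of g "-1"]
  by (simp add: mp.scale_minus_left)

lemma ideal_subspace: "mp.subspace I"
  by (rule mp.subspaceI) (use ideal_zero ideal_add ideal_mscale in auto)

lemma span_subset_ideal: "S \<subseteq> I \<Longrightarrow> mp.span S \<subseteq> I"
  by (rule mp.span_minimal[OF _ ideal_subspace])

lemma genideal_subset: "S \<subseteq> I \<Longrightarrow> genideal (poly_ring V) S \<subseteq> I"
  by (rule ring.genideal_minimal[OF ring_poly_ring I])

end

lemma ideal_genideal: "S \<subseteq> carrier (poly_ring V) \<Longrightarrow> ideal (genideal (poly_ring V) S) (poly_ring V)"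
  by (rule ring.genideal_ideal[OF ring_poly_ring])

lemma subset_genideal: "S \<subseteq> carrier (poly_ring V) \<Longrightarrow> S \<subseteq> genideal (poly_ring V) S"
  by (rule ring.genideal_self[OF ring_poly_ring])

lemma genideal_eqI:
  assumes "S \<subseteq> carrier (poly_ring V)" "S \<subseteq> I" "ideal I (poly_ring V)" "B \<subseteq> mp.span S"
    "genideal (poly_ring V) B = I"
  shows "genideal (poly_ring V) S = (I :: ('v, 'k::field) mpoly set)"
proof
  show "genideal (poly_ring V) S \<subseteq> I"
    using genideal_subset[OF assms(3,2)] .
  have "B \<subseteq> genideal (poly_ring V) S"
    using assms(4) span_subset_ideal[OF ideal_genideal[OF assms(1)] subset_genideal[OF assms(1)]]
    by blast
  then show "I \<subseteq> genideal (poly_ring V) S"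
    using genideal_subset[OF ideal_genideal[OF assms(1)]] assms(5) by blast
qed

text \<open>
  A multiple of a generator reaches degree two only through the constant term of the
  multiplier, since the generators themselves start in degree two. So the quadratic parts of
  the generators span the quadratic parts of the whole ideal. This is the instance of
  Nakayama's lemma from which all lower bounds on the number of generators follow.
\<close>

lemma genideal_degree_2_component:
  fixes S :: "('v, 'k::field) mpoly set"
  assumes S: "S \<subseteq> carrier (poly_ring V)"
    and low: "\<And>f a. f \<in> S \<Longrightarrow> a \<in> keys f \<Longrightarrow> 2 \<le> total_degree a"
    and f: "f \<in> genideal (poly_ring V) S"
  defines "quadratic_part \<equiv> component (\<lambda>a. total_degree a = 2)"
  shows "(\<forall>a\<in>keys f. 2 \<le> total_degree a) \<and> quadratic_part f \<in> mp.span (quadratic_part ` S)"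
proof -
  let ?T = "{f \<in> carrier (poly_ring V). (\<forall>a\<in>keys f. 2 \<le> total_degree a) \<and> quadratic_part f \<in> mp.span (quadratic_part ` S)}"
  have "ideal ?T (poly_ring V)"
  proof (rule ideal_poly_ringI)
    fix f g assume fg: "f \<in> ?T" "g \<in> ?T"
    have "keys (f + g) \<subseteq> keys f \<union> keys g"
      by (rule Poly_Mapping.keys_add)
    then show "f + g \<in> ?T"
      using fg by (auto simp: quadratic_part_def component_add mp.span_add)
  next
    fix x f :: "('v, 'k) mpoly" assume x: "x \<in> carrier (poly_ring V)" and f: "f \<in> ?T"
    \<comment> \<open>The multiplier splits into its constant term and a part without constant term; the
      second part moves everything into degree at least three.\<close>
    define c where "c = lookup x 0"
    define y where "y = x - single 0 c"
    have x_eq: "x * f = mscale c f + y * f"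
      by (simp add: y_def mscale_def algebra_simps)
    have "a \<noteq> 0" if "a \<in> keys y" for a
      using that by (auto simp: y_def c_def in_keys_iff lookup_minus)
    then have y: "1 \<le> total_degree a" if "a \<in> keys y" for a
      using that total_degree_eq_0_iff[of a] by fastforce
    have "3 \<le> total_degree a" if a: "a \<in> keys (y * f)" for a
    proof -
      obtain b d where "a = b + d" "b \<in> keys y" "d \<in> keys f"
        using keys_mult[of y f] a by blast
      then show ?thesis
        using y[of b] f by (fastforce simp: total_degree_add)
    qed
    then have yf: "quadratic_part (y * f) = 0" and yf': "\<forall>a\<in>keys (y * f). 2 \<le> total_degree a"
      unfolding quadratic_part_def by (force intro!: component_eq_0)+
    have "x * f \<in> carrier (poly_ring V)"
      using cring.cring_simprules(5)[OF cring_poly_ring x, of f] f by simp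
    moreover have "\<forall>a\<in>keys (x * f). 2 \<le> total_degree a"
      using Poly_Mapping.keys_add[of "mscale c f" "y * f"] yf' f keys_mscale[of c f]
      unfolding x_eq by fastforce
    moreover have "quadratic_part (x * f) = mscale c (quadratic_part f)"
      using yf by (simp add: x_eq quadratic_part_def component_add component_mscale)
    ultimately show "x * f \<in> ?T"
      using f by (auto simp: mp.span_scale)
  qed (auto simp: quadratic_part_def component_zero mp.span_zero)
  moreover have "S \<subseteq> ?T"
    using S low mp.span_base[of _ "quadratic_part ` S"] by blast
  ultimately have "genideal (poly_ring V) S \<subseteq> ?T"
    by (rule genideal_subset)
  then show ?thesis
    using f by blast
qed

section \<open>Ideals with a straightening law\<close>

text \<open>
  For columns of tableaux with \<open>cmp\<close> the comparability of columns, these are the monomials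
  whose variables, with multiplicity, are the columns of one semistandard tableau.
\<close>

definition standard_monomial :: "('v \<Rightarrow> 'v \<Rightarrow> bool) \<Rightarrow> ('v \<Rightarrow>\<^sub>0 nat) \<Rightarrow> bool" where
  "standard_monomial cmp a \<longleftrightarrow> (\<forall>x\<in>keys a. \<forall>y\<in>keys a. cmp x y)"

definition quad_monomial :: "'v \<Rightarrow> 'v \<Rightarrow> 'v \<Rightarrow>\<^sub>0 nat" where
  "quad_monomial x y = single x 1 + single y 1"

definition incomparable_quads :: "('v \<Rightarrow> 'v \<Rightarrow> bool) \<Rightarrow> 'v set \<Rightarrow> ('v \<Rightarrow>\<^sub>0 nat) set" where
  "incomparable_quads cmp V = {quad_monomial x y | x y. x \<in> V \<and> y \<in> V \<and> \<not> cmp x y}"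

lemma keys_quad_monomial: "keys (quad_monomial x y) = {x, y}"
  by (auto simp: quad_monomial_def in_keys_iff lookup_add lookup_single when_def split: if_splits)

lemma total_degree_quad_monomial: "total_degree (quad_monomial x y) = 2"
  by (simp add: quad_monomial_def total_degree_add total_degree_single)

lemma var_mult_var: "poly_var x * poly_var y = single (quad_monomial x y) (1::'k::comm_ring_1)"
  by (simp add: poly_var_def quad_monomial_def mult_single)

lemma split_monomial:
  assumes "x \<in> keys a" "y \<in> keys a" "x \<noteq> y"
  obtains c where "a = quad_monomial x y + c" "keys c \<subseteq> keys a"
proof
  define c where "c = a - quad_monomial x y"
  have "lookup (quad_monomial x y) z \<le> lookup a z" for z
    using assms by (auto simp: quad_monomial_def lookup_add lookup_single when_def in_keys_iff Suc_leI)
  then show "a = quad_monomial x y + c"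
    by (intro poly_mapping_eqI) (simp add: c_def lookup_add lookup_minus)
  show "keys c \<subseteq> keys a"
    by (auto simp: c_def in_keys_iff lookup_minus)
qed

definition weight :: "('v \<Rightarrow> nat) \<Rightarrow> ('v \<Rightarrow>\<^sub>0 nat) \<Rightarrow> nat" where
  "weight w a = (\<Sum>x\<in>keys a. lookup a x * w x)"

lemma weight_superset:
  assumes "finite A" "keys a \<subseteq> A"
  shows "weight w a = (\<Sum>v\<in>A. lookup a v * w v)"
  unfolding weight_def
  by (rule sum.mono_neutral_left) (use assms in \<open>auto simp: in_keys_iff\<close>)

lemma weight_add: "weight w (a + b) = weight w a + weight w b"
proof -
  let ?A = "keys a \<union> keys b"
  have "weight w (a + b) = (\<Sum>v\<in>?A. lookup (a + b) v * w v)"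
    by (rule weight_superset) (use Poly_Mapping.keys_add[of a b] in auto)
  also have "\<dots> = weight w a + weight w b"
    by (simp add: weight_superset[of ?A] lookup_add sum.distrib distrib_right)
  finally show ?thesis .
qed

lemma weight_single: "weight w (single x k) = k * w x"
  by (cases "k = 0") (auto simp: weight_def)

lemma weight_quad: "weight w (quad_monomial x y) = w x + w y"
  by (simp add: quad_monomial_def weight_add weight_single)

lemma subspace_straighten:
  fixes F :: "('v, 'k::field) mpoly"
  assumes J: "mp.subspace J"
    and st: "\<And>b. b \<in> keys F \<Longrightarrow> \<exists>g. single b 1 - g \<in> J \<and> (\<forall>c\<in>keys g. Q c)"
  shows "\<exists>g. F - g \<in> J \<and> (\<forall>c\<in>keys g. Q c)"
proof -
  obtain g where g: "\<And>b. b \<in> keys F \<Longrightarrow> single b 1 - g b \<in> J \<and> (\<forall>c\<in>keys (g b). Q c)"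
    using st by metis
  define h where "h = (\<Sum>b\<in>keys F. mscale (lookup F b) (g b))"
  have "F - h = (\<Sum>b\<in>keys F. mscale (lookup F b) (single b 1 - g b))"
    unfolding h_def mp.scale_right_diff_distrib sum_subtractf
    by (subst poly_eq_sum_monomials[of F]) simp
  also have "\<dots> \<in> J"
    by (intro mp.subspace_sum[OF J] mp.subspace_scale[OF J]) (use g in blast)
  finally have "F - h \<in> J" .
  moreover have "Q c" if c: "c \<in> keys h" for c
  proof -
    obtain b where "b \<in> keys F" "c \<in> keys (mscale (lookup F b) (g b))"
      using c Poly_Mapping.keys_sum[of "\<lambda>b. mscale (lookup F b) (g b)" "keys F"]
      unfolding h_def by blast
    then show ?thesis
      using g keys_mscale by blast
  qed
  ultimately show ?thesis by blast
qed

text \<open>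
  Here \<open>cmp\<close> is comparability of variables and \<open>w\<close> is a potential that makes rewriting end:
  every rewriting step increases the total weight of a monomial, which is bounded in each
  degree because \<open>V\<close> is finite. The function \<open>gr\<close> is any additional grading that the
  quadratic rewriting rules respect; with it the result can be read off in each multidegree
  separately.
\<close>

locale straightening =
  fixes V :: "'v set" and I :: "('v, 'k::field) mpoly set" and cmp :: "'v \<Rightarrow> 'v \<Rightarrow> bool"
    and gr :: "('v \<Rightarrow>\<^sub>0 nat) \<Rightarrow> 'd" and w :: "'v \<Rightarrow> nat"
  assumes finite_V: "finite V"
    and ideal_I: "ideal I (poly_ring V)"
    and cmp_refl: "\<And>x. x \<in> V \<Longrightarrow> cmp x x"
    and cmp_sym: "\<And>x y. cmp x y \<Longrightarrow> cmp y x"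
    and straighten: "\<And>x y. x \<in> V \<Longrightarrow> y \<in> V \<Longrightarrow> \<not> cmp x y \<Longrightarrow>
      \<exists>f. poly_var x * poly_var y - f \<in> I \<and>
        (\<forall>a\<in>keys f. \<exists>x'\<in>V. \<exists>y'\<in>V. a = quad_monomial x' y' \<and> gr a = gr (quad_monomial x y) \<and>
           w x + w y < w x' + w y')"
    and independent: "\<And>f. f \<in> I \<Longrightarrow> \<forall>a\<in>keys f. standard_monomial cmp a \<Longrightarrow> f = 0"
begin

abbreviation "std \<equiv> standard_monomial cmp"
abbreviation "N \<equiv> incomparable_quads cmp V"
abbreviation "R \<equiv> (poly_ring V :: ('v, 'k) mpoly ring)"

definition quadrics :: "(('v \<Rightarrow>\<^sub>0 nat) \<Rightarrow> bool) \<Rightarrow> ('v, 'k) mpoly set" where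
  "quadrics P = {f \<in> I. \<forall>a\<in>keys f. total_degree a = 2 \<and> P a}"

abbreviation "J \<equiv> genideal R (quadrics (\<lambda>_. True))"

lemma I_carrier: "I \<subseteq> carrier R"
  using ideal_carrier[OF ideal_I] .

lemma quadrics_subset: "quadrics P \<subseteq> I" "quadrics P \<subseteq> carrier R"
  using I_carrier unfolding quadrics_def by blast+

lemma ideal_J: "ideal J R"
  by (rule ideal_genideal[OF quadrics_subset(2)])

lemma J_subset_I: "J \<subseteq> I"
  by (rule genideal_subset[OF ideal_I quadrics_subset(1)])

lemma not_std_quad:
  assumes "keys a \<subseteq> V" "\<not> std a"
  obtains x y c where "x \<in> V" "y \<in> V" "\<not> cmp x y" "a = quad_monomial x y + c" "keys c \<subseteq> V"
proof -
  obtain x y where xy: "x \<in> keys a" "y \<in> keys a" "\<not> cmp x y"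
    using assms(2) unfolding standard_monomial_def by blast
  then have "x \<noteq> y"
    using cmp_refl assms(1) by blast
  then show ?thesis
    using that xy assms(1) split_monomial[of x a y] by (metis subset_iff)
qed

lemma weight_le:
  assumes "keys a \<subseteq> V"
  shows "weight w a \<le> total_degree a * Max (insert 0 (w ` V))"
  unfolding weight_def total_degree_def sum_distrib_right
  using assms finite_V by (intro sum_mono mult_le_mono2 Max_ge) auto

text \<open>
  A nonstandard monomial contains an incomparable pair, which is replaced by the straightening
  rule. The weights increase strictly and are bounded by \<open>weight_le\<close>.
\<close>

lemma straighten_monomial:
  assumes "keys a \<subseteq> V"
  shows "\<exists>g. single a 1 - g \<in> J \<and>
    (\<forall>b\<in>keys g. keys b \<subseteq> V \<and> std b \<and> total_degree b = total_degree a \<and>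
       (total_degree a = 2 \<longrightarrow> gr b = gr a))"
  using assms
proof (induction "total_degree a * Max (insert 0 (w ` V)) - weight w a" arbitrary: a rule: less_induct)
  case less
  show ?case
  proof (cases "std a")
    case True
    then show ?thesis
      using less.prems ideal_zero[OF ideal_J] by (intro exI[of _ "single a 1"]) auto
  next
    case False
    obtain x y c where xy: "x \<in> V" "y \<in> V" "\<not> cmp x y"
      and a: "a = quad_monomial x y + c" and c: "keys c \<subseteq> V"
      using not_std_quad[OF less.prems False] by blast
    obtain f where f: "poly_var x * poly_var y - f \<in> I"
      "\<And>b. b \<in> keys f \<Longrightarrow> \<exists>x'\<in>V. \<exists>y'\<in>V. b = quad_monomial x' y' \<and>
         gr b = gr (quad_monomial x y) \<and> w x + w y < w x' + w y'"
      using straighten[OF xy] by blast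
    let ?q = "poly_var x * poly_var y - f"
    let ?F = "single c 1 * f"
    have "keys ?q \<subseteq> keys (poly_var x * poly_var y :: ('v, 'k) mpoly) \<union> keys f"
      by (rule Poly_Mapping.keys_diff)
    then have "?q \<in> quadrics (\<lambda>_. True)"
      using f by (fastforce simp: quadrics_def var_mult_var total_degree_quad_monomial)
    then have "?q \<in> J"
      using subset_genideal[OF quadrics_subset(2)] by blast
    then have "single c 1 * ?q \<in> J"
      by (rule ideal_mult[OF ideal_J, rotated]) (use c in auto)
    moreover have "single c 1 * ?q = single a 1 - ?F"
      by (simp add: var_mult_var mult_single right_diff_distrib a add.commute)
    ultimately have aF: "single a 1 - ?F \<in> J"
      by simp
    have "\<exists>g. single b 1 - g \<in> J \<and>
       (\<forall>b\<in>keys g. keys b \<subseteq> V \<and> std b \<and> total_degree b = total_degree a \<and>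
         (total_degree a = 2 \<longrightarrow> gr b = gr a))" if b: "b \<in> keys ?F" for b
    proof -
      obtain d where bd: "b = c + d" and d: "d \<in> keys f"
        using keys_mult[of "single c 1" f] b by (auto split: if_splits)
      obtain x' y' where x'y': "x' \<in> V" "y' \<in> V" "d = quad_monomial x' y'"
        "gr d = gr (quad_monomial x y)" "w x + w y < w x' + w y'"
        using f(2)[OF d] by blast
      have keys_b: "keys b \<subseteq> V"
        unfolding bd x'y'(3) using Poly_Mapping.keys_add[of c "quad_monomial x' y'"] c x'y'(1,2)
        by (auto simp: keys_quad_monomial)
      have td: "total_degree b = total_degree a"
        unfolding bd x'y'(3) a by (simp add: total_degree_add total_degree_quad_monomial)
      \<comment> \<open>In degree two the cofactor of the incomparable pair is trivial.\<close>
      have gr: "gr b = gr a" if "total_degree a = 2"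
      proof -
        have "c = 0"
          using that unfolding a
          by (simp add: total_degree_add total_degree_quad_monomial total_degree_eq_0_iff)
        then show ?thesis
          using x'y'(4) by (simp add: a bd)
      qed
      have "weight w a < weight w b"
        using x'y'(5) unfolding bd x'y'(3) a by (simp add: weight_add weight_quad)
      then have "total_degree b * Max (insert 0 (w ` V)) - weight w b
          < total_degree a * Max (insert 0 (w ` V)) - weight w a"
        using weight_le[OF keys_b] unfolding td by linarith
      then show ?thesis
        using less.hyps[OF _ keys_b] unfolding td by (metis gr)
    qed
    then obtain g where g: "?F - g \<in> J" "\<forall>b\<in>keys g. keys b \<subseteq> V \<and> std b \<and>
        total_degree b = total_degree a \<and> (total_degree a = 2 \<longrightarrow> gr b = gr a)"
      using subspace_straighten[OF ideal_subspace[OF ideal_J], of ?F] by blast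
    have "single a 1 - g = (single a 1 - ?F) + (?F - g)"
      by simp
    then show ?thesis
      using ideal_add[OF ideal_J aF g(1)] g(2) by metis
  qed
qed

text \<open>
  The standard representative of an element of \<open>I\<close> lies in \<open>I\<close> again, so it vanishes.
\<close>

lemma I_eq_J: "I = J"
proof
  show "I \<subseteq> J"
  proof
    fix f assume f: "f \<in> I"
    have "\<exists>g. single b 1 - g \<in> J \<and> (\<forall>c\<in>keys g. std c)" if "b \<in> keys f" for b
      using straighten_monomial[of b] that f I_carrier by fastforce
    then obtain g where g: "f - g \<in> J" "\<forall>c\<in>keys g. std c"
      using subspace_straighten[OF ideal_subspace[OF ideal_J], of f] by blast
    have "g = f - (f - g)"
      by simp
    then have "g \<in> I"
      using ideal_diff[OF ideal_I f] g(1) J_subset_I by (metis subsetD)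
    then have "g = 0"
      using independent g(2) by blast
    then show "f \<in> J"
      using g(1) by simp
  qed
qed (rule J_subset_I)

lemma I_low: "f \<in> I \<Longrightarrow> a \<in> keys f \<Longrightarrow> 2 \<le> total_degree a"
  using genideal_degree_2_component[OF quadrics_subset(2), of "\<lambda>_. True" f]
  unfolding I_eq_J[symmetric] by (simp add: quadrics_def)

abbreviation quadratic_part :: "('v, 'k) mpoly \<Rightarrow> ('v, 'k) mpoly" where
  "quadratic_part \<equiv> component (\<lambda>a. total_degree a = 2)"

lemma quadrics_subset_span:
  assumes "S \<subseteq> carrier R" "genideal R S = I"
  shows "quadrics P \<subseteq> mp.span (quadratic_part ` S)"
proof
  fix f assume f: "f \<in> quadrics P"
  have "S \<subseteq> I"
    using subset_genideal[OF assms(1)] assms(2) by simp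
  then have "quadratic_part f \<in> mp.span (quadratic_part ` S)"
    using genideal_degree_2_component[OF assms(1), of f] I_low f quadrics_subset(1)
    unfolding assms(2) by blast
  moreover have "quadratic_part f = f"
    using f by (intro component_id) (simp add: quadrics_def)
  ultimately show "f \<in> mp.span (quadratic_part ` S)"
    by simp
qed

text \<open>
  The quadratic relation that rewrites the monomial \<open>u\<close> into its standard form, all of whose
  terms have the grade of \<open>u\<close>. The choice is unique by independence.
\<close>

definition rel :: "('v \<Rightarrow>\<^sub>0 nat) \<Rightarrow> ('v, 'k) mpoly" where
  "rel u = (SOME r. r \<in> I \<and> (\<forall>b\<in>keys (single u 1 - r). std b \<and> total_degree b = 2 \<and> gr b = gr u))"

lemma N_props:
  assumes "u \<in> N"
  shows "keys u \<subseteq> V" "total_degree u = 2" "\<not> std u"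
  using assms by (auto simp: incomparable_quads_def keys_quad_monomial
      total_degree_quad_monomial standard_monomial_def)

lemma in_N_I:
  assumes "keys a \<subseteq> V" "total_degree a = 2" "\<not> std a"
  shows "a \<in> N"
proof -
  obtain x y c where xy: "x \<in> V" "y \<in> V" "\<not> cmp x y" and a: "a = quad_monomial x y + c"
    using not_std_quad[OF assms(1,3)] by blast
  moreover have "c = 0"
    using assms(2) unfolding a
    by (simp add: total_degree_add total_degree_quad_monomial total_degree_eq_0_iff)
  ultimately show ?thesis
    unfolding incomparable_quads_def by auto
qed

lemma finite_N: "finite N"
proof (rule finite_subset)
  show "N \<subseteq> (\<lambda>(x, y). quad_monomial x y) ` (V \<times> V)"
    by (auto simp: incomparable_quads_def)
qed (use finite_V in simp)

lemma rel:
  assumes "u \<in> N"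
  shows "rel u \<in> I" "\<And>b. b \<in> keys (single u 1 - rel u) \<Longrightarrow> std b \<and> total_degree b = 2 \<and> gr b = gr u"
proof -
  obtain g where g: "single u 1 - g \<in> J" "\<forall>b\<in>keys g. std b \<and> total_degree b = 2 \<and> gr b = gr u"
    using straighten_monomial[OF N_props(1)[OF assms]] N_props(2)[OF assms] by metis
  have "\<exists>r. r \<in> I \<and> (\<forall>b\<in>keys (single u 1 - r). std b \<and> total_degree b = 2 \<and> gr b = gr u)"
    using g J_subset_I by (intro exI[of _ "single u 1 - g"]) auto
  then have "rel u \<in> I \<and> (\<forall>b\<in>keys (single u 1 - rel u). std b \<and> total_degree b = 2 \<and> gr b = gr u)"
    unfolding rel_def by (rule someI_ex)
  then show "rel u \<in> I" "\<And>b. b \<in> keys (single u 1 - rel u) \<Longrightarrow> std b \<and> total_degree b = 2 \<and> gr b = gr u"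
    by blast+
qed

lemma keys_rel:
  assumes "u \<in> N" "b \<in> keys (rel u)"
  shows "total_degree b = 2" "gr b = gr u"
proof -
  have "b = u \<or> b \<in> keys (single u 1 - rel u)"
    using assms(2) by (cases "b = u") (auto simp: in_keys_iff lookup_minus lookup_single)
  then show "total_degree b = 2" "gr b = gr u"
    using rel(2)[OF assms(1)] N_props(2)[OF assms(1)] by blast+
qed

lemma lookup_rel:
  assumes "u \<in> N" "v \<in> N"
  shows "lookup (rel u) v = (if u = v then 1 else 0)"
proof -
  have "lookup (single u 1 - rel u) v = 0"
    using rel(2)[OF assms(1), of v] N_props(3)[OF assms(2)] by (auto simp: in_keys_iff)
  then show ?thesis
    by (auto simp: lookup_minus lookup_single)
qed

lemma inj_rel: "inj_on rel N"
  by (rule inj_onI) (metis lookup_rel zero_neq_one)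

lemma rel_in_quadrics:
  assumes "u \<in> N" "P u" "\<And>a b. gr a = gr b \<Longrightarrow> P a = P b"
  shows "rel u \<in> quadrics P"
  unfolding quadrics_def using rel(1)[OF assms(1)] keys_rel[OF assms(1)] assms(2,3) by blast

text \<open>
  Subtracting from a quadric the relations \<open>rel u\<close> with its own coefficients at the
  nonstandard monomials \<open>u\<close> leaves an element of the ideal with standard monomials only,
  which is zero.
\<close>

lemma quadrics_span_rel:
  assumes "\<And>a b. gr a = gr b \<Longrightarrow> P a = P b"
  shows "quadrics P \<subseteq> mp.span (rel ` {u \<in> N. P u})"
proof
  fix f assume f: "f \<in> quadrics P"
  define g where "g = (\<Sum>u\<in>{u \<in> N. P u}. mscale (lookup f u) (rel u))"
  have fin: "finite {u \<in> N. P u}"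
    using finite_N by simp
  have g_span: "g \<in> mp.span (rel ` {u \<in> N. P u})"
    unfolding g_def by (intro mp.span_sum mp.span_scale mp.span_base imageI)
  have "g \<in> I"
    using g_span span_subset_ideal[OF ideal_I, of "rel ` {u \<in> N. P u}"] rel(1) by blast
  then have I: "f - g \<in> I"
    using f quadrics_subset(1) by (intro ideal_diff[OF ideal_I]) auto
  have "std a" if a: "a \<in> keys (f - g)" for a
  proof (rule ccontr)
    assume ns: "\<not> std a"
    have "a \<in> keys f \<or> a \<in> keys g"
      using a Poly_Mapping.keys_diff[of f g] by blast
    moreover have "total_degree a = 2 \<and> P a" if ag: "a \<in> keys g"
    proof -
      obtain u where "u \<in> N" "P u" "a \<in> keys (mscale (lookup f u) (rel u))"
        using ag Poly_Mapping.keys_sum[of "\<lambda>u. mscale (lookup f u) (rel u)" "{u \<in> N. P u}"]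
        unfolding g_def by blast
      then have "u \<in> N" "P u" "a \<in> keys (rel u)"
        using keys_mscale by blast+
      then show ?thesis
        using keys_rel assms by blast
    qed
    ultimately have "total_degree a = 2 \<and> P a"
      using f unfolding quadrics_def by blast
    moreover have "keys a \<subseteq> V"
      using subsetD[OF I_carrier I] a by simp
    ultimately have aN: "a \<in> {u \<in> N. P u}"
      using in_N_I ns by blast
    have "lookup g a = (\<Sum>u\<in>{u \<in> N. P u}. lookup f u * (if u = a then 1 else 0))"
      unfolding g_def lookup_sum using aN by (intro sum.cong) (auto simp: lookup_rel)
    also have "\<dots> = (\<Sum>u\<in>{u \<in> N. P u}. if u = a then lookup f u else 0)"
      by (intro sum.cong) auto
    also have "\<dots> = lookup f a"
      using aN fin by simp
    finally show False
      using a by (simp add: in_keys_iff lookup_minus)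
  qed
  then have "f - g = 0"
    using independent[OF I] by blast
  then show "f \<in> mp.span (rel ` {u \<in> N. P u})"
    using g_span by simp
qed

text \<open>
  The relation \<open>rel u\<close> is the only one in which the nonstandard monomial \<open>u\<close> occurs.
\<close>

lemma independent_rel: "mp.independent (rel ` N)"
  unfolding mp.dependent_explicit
proof (intro notI, elim exE conjE bexE)
  fix T c v assume T: "finite T" "T \<subseteq> rel ` N" "(\<Sum>v\<in>T. mscale (c v) v) = 0" "v \<in> T" "c v \<noteq> 0"
  obtain u where u: "u \<in> N" "v = rel u"
    using T by blast
  have "0 = lookup (\<Sum>v\<in>T. mscale (c v) v) u"
    using T(3) by simp
  also have "\<dots> = (\<Sum>x\<in>T. if x = v then c v else 0)"
    unfolding lookup_sum
  proof (intro sum.cong refl)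
    fix x assume "x \<in> T"
    then obtain u' where "u' \<in> N" "x = rel u'"
      using T(2) by blast
    then show "lookup (mscale (c x) x) u = (if x = v then c v else 0)"
      using u inj_rel by (auto simp: lookup_rel inj_on_eq_iff)
  qed
  also have "\<dots> = c v"
    using T by simp
  finally show False
    using T(5) by simp
qed

lemma card_basis_quadrics:
  assumes P: "\<And>a b. gr a = gr b \<Longrightarrow> P a = P b"
    and S: "S \<subseteq> quadrics P" "mp.independent S" "quadrics P \<subseteq> mp.span S"
  shows "finite S \<and> card S = card {u \<in> N. P u}"
proof -
  let ?B = "rel ` {u \<in> N. P u}"
  have fin: "finite ?B"
    using finite_N by simp
  have card: "card ?B = card {u \<in> N. P u}"
    by (rule card_image) (rule inj_on_subset[OF inj_rel], blast)
  have ind: "mp.independent ?B"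
    by (rule mp.independent_mono[OF independent_rel]) blast
  have le: "finite S \<and> card S \<le> card ?B"
    using S(1) quadrics_span_rel[of P, OF P] by (intro mp.independent_span_bound[OF fin S(2)]) blast
  moreover have "?B \<subseteq> mp.span S"
    using S(3) rel_in_quadrics P by blast
  then have "card ?B \<le> card S"
    using mp.independent_span_bound[OF _ ind] le by blast
  ultimately show ?thesis
    using card by simp
qed

lemma genideal_rel: "genideal R (rel ` N) = I"
proof (rule genideal_eqI[OF _ _ ideal_I])
  show "quadrics (\<lambda>_. True) \<subseteq> mp.span (rel ` N)"
    using quadrics_span_rel[of "\<lambda>_. True"] by simp
  show "genideal R (quadrics (\<lambda>_. True)) = I"
    using I_eq_J by simp
qed (use rel(1) I_carrier in blast)+

text \<open>
  The relations \<open>rel u\<close> attain this number. It is a lower bound for arbitrary finite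
  generating sets, homogeneous or not, because their quadratic parts span the quadrics.
\<close>

theorem min_num_generators_eq: "min_num_generators R I = card N"
  unfolding min_num_generators_def
proof (rule Least_equality)
  show "\<exists>S\<subseteq>carrier R. finite S \<and> card S = card N \<and> genideal R S = I"
    using genideal_rel finite_N card_image[OF inj_rel] rel(1) I_carrier
    by (intro exI[of _ "rel ` N"]) auto
next
  fix k assume "\<exists>S\<subseteq>carrier R. finite S \<and> card S = k \<and> genideal R S = I"
  then obtain S where S: "S \<subseteq> carrier R" "finite S" "card S = k" "genideal R S = I"
    by blast
  have "rel ` N \<subseteq> mp.span (quadratic_part ` S)"
    using quadrics_subset_span[OF S(1,4), of "\<lambda>_. True"] rel_in_quadrics[of _ "\<lambda>_. True"] by blast
  then have "card (rel ` N) \<le> card (quadratic_part ` S)"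
    using mp.independent_span_bound[OF _ independent_rel] S(2) by blast
  also have "\<dots> \<le> k"
    using card_image_le[OF S(2)] S(3) by blast
  finally show "card N \<le> k"
    by (simp add: card_image[OF inj_rel])
qed

text \<open>
  The quadratic part of a homogeneous generator is the generator itself or zero. So the
  quadratic generators alone span the quadrics and generate the ideal, and minimality leaves
  no room for other generators or for a linear relation between them.
\<close>

lemma minimal_generating_set_basis:
  assumes H: "\<And>f. f \<in> carrier R \<Longrightarrow> H f \<Longrightarrow> homogeneous_wrt total_degree f"
    and S: "minimal_generating_set R H I S"
  shows "S \<subseteq> quadrics (\<lambda>_. True)" "mp.independent S" "quadrics (\<lambda>_. True) \<subseteq> mp.span S" "0 \<notin> S"
proof -
  have gen: "S \<subseteq> carrier R" "genideal R S = I"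
    and hom: "\<And>f. f \<in> S \<Longrightarrow> homogeneous_wrt total_degree f"
    and min: "\<And>S'. S' \<subset> S \<Longrightarrow> genideal R S' \<noteq> I"
    using S H unfolding minimal_generating_set_def by blast+
  have SI: "S \<subseteq> I"
    using subset_genideal[OF gen(1)] gen(2) by simp
  have generates: "S' = S" if "S' \<subseteq> S" "quadrics (\<lambda>_. True) \<subseteq> mp.span S'" for S'
  proof -
    have "genideal R S' = I"
      using that gen(1) SI I_eq_J by (intro genideal_eqI[OF _ _ ideal_I that(2)]) auto
    then show ?thesis
      using min that(1) by blast
  qed
  define S2 where "S2 = S \<inter> quadrics (\<lambda>_. True) - {0}"
  have "quadratic_part f \<in> insert 0 S2" if f: "f \<in> S" for f
  proof (cases "f \<in> quadrics (\<lambda>_. True)")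
    case True
    then have "quadratic_part f = f"
      by (intro component_id) (simp add: quadrics_def)
    then show ?thesis
      using True f by (auto simp: S2_def)
  next
    case False
    obtain d where d: "\<forall>a\<in>keys f. total_degree a = d"
      using hom[OF f] unfolding homogeneous_wrt_def by blast
    then have "d \<noteq> 2"
      using False f SI unfolding quadrics_def by auto
    then have "quadratic_part f = 0"
      using d by (intro component_eq_0) auto
    then show ?thesis by simp
  qed
  then have "quadratic_part ` S \<subseteq> insert 0 S2"
    by blast
  then have "quadrics (\<lambda>_. True) \<subseteq> mp.span (insert 0 S2)"
    using quadrics_subset_span[OF gen, of "\<lambda>_. True"] mp.span_mono by blast
  then have "quadrics (\<lambda>_. True) \<subseteq> mp.span S2"
    by (simp add: mp.span_insert_0)
  then have S2: "S2 = S"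
    by (intro generates) (auto simp: S2_def)
  show "S \<subseteq> quadrics (\<lambda>_. True)" "0 \<notin> S"
    using S2 unfolding S2_def by blast+
  show span: "quadrics (\<lambda>_. True) \<subseteq> mp.span S"
    using \<open>quadrics (\<lambda>_. True) \<subseteq> mp.span S2\<close> S2 by simp
  show "mp.independent S"
    unfolding mp.dependent_def
  proof (intro notI, elim bexE)
    fix f assume f: "f \<in> S" "f \<in> mp.span (S - {f})"
    then have "mp.span (S - {f}) = mp.span S"
      by (metis insert_Diff mp.span_redundant)
    then have "S - {f} = S"
      using span by (intro generates) auto
    then show False
      using f(1) by blast
  qed
qed

theorem minimal_generating_set_card:
  assumes H: "\<And>f. f \<in> carrier R \<Longrightarrow> H f \<Longrightarrow> homogeneous_wrt total_degree f"
    and S: "minimal_generating_set R H I S"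
  shows "finite S \<and> card S = card N"
  using card_basis_quadrics[of "\<lambda>_. True" S] minimal_generating_set_basis[OF H S] by simp

theorem minimal_generating_set_exists:
  assumes H: "\<And>f. homogeneous_wrt total_degree f \<Longrightarrow> homogeneous_wrt gr f \<Longrightarrow> H f"
  shows "minimal_generating_set R H I (rel ` N)"
  unfolding minimal_generating_set_def
proof (intro conjI ballI allI impI)
  show "rel ` N \<subseteq> carrier R"
    using rel(1) I_carrier by blast
  show "genideal R (rel ` N) = I"
    by (rule genideal_rel)
next
  fix f assume "f \<in> rel ` N"
  then show "H f"
    using H keys_rel unfolding homogeneous_wrt_def by blast
next
  fix S assume S: "S \<subset> rel ` N"
  then obtain f where f: "f \<in> rel ` N" "f \<notin> S"
    by blast
  have S': "S \<subseteq> quadrics (\<lambda>_. True)"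
    using S rel_in_quadrics[of _ "\<lambda>_. True"] by blast
  have "quadratic_part ` S = S"
  proof -
    have "quadratic_part h = h" if "h \<in> S" for h
      using S' that by (intro component_id) (auto simp: quadrics_def)
    then show ?thesis
      by simp
  qed
  show "genideal R S \<noteq> I"
  proof
    assume "genideal R S = I"
    then have "quadrics (\<lambda>_. True) \<subseteq> mp.span S"
      using quadrics_subset_span[of S "\<lambda>_. True"] S' quadrics_subset(2) \<open>quadratic_part ` S = S\<close> by fastforce
    then have "f \<in> mp.span S"
      using f rel_in_quadrics[of _ "\<lambda>_. True"] by blast
    then have "f \<in> mp.span (rel ` N - {f})"
      using mp.span_mono[of S "rel ` N - {f}"] S f by blast
    then show False
      using independent_rel f(1) unfolding mp.dependent_def by blast
  qed
qed

text \<open>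
  Projecting to the monomials with property \<open>P\<close> maps the basis of the quadrics given by a
  generating set to the generators with that property and to zero.
\<close>

theorem minimal_generating_set_card_component:
  assumes H: "\<And>f. f \<in> carrier R \<Longrightarrow> H f \<Longrightarrow> homogeneous_wrt total_degree f \<and> homogeneous_wrt gr f"
    and S: "minimal_generating_set R H I S"
    and P: "\<And>a b. gr a = gr b \<Longrightarrow> P a = P b"
  shows "card {f \<in> S. \<exists>a\<in>keys f. P a} = card {u \<in> N. P u}"
proof -
  note basis = minimal_generating_set_basis[OF _ S]
  have S1: "S \<subseteq> quadrics (\<lambda>_. True)" "mp.independent S" "quadrics (\<lambda>_. True) \<subseteq> mp.span S" "0 \<notin> S"
    using basis H by blast+
  let ?SP = "{f \<in> S. \<exists>a\<in>keys f. P a}"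
  have hom: "homogeneous_wrt gr f" if "f \<in> S" for f
    using that H S unfolding minimal_generating_set_def by blast
  have all: "(\<exists>a\<in>keys f. P a) \<Longrightarrow> (\<forall>a\<in>keys f. P a)" if "f \<in> S" for f
    using hom[OF that] P unfolding homogeneous_wrt_def by metis
  have "?SP \<subseteq> quadrics P"
    using S1(1) all unfolding quadrics_def by blast
  moreover have "mp.independent ?SP"
    by (rule mp.independent_mono[OF S1(2)]) blast
  moreover have "quadrics P \<subseteq> mp.span ?SP"
  proof
    fix f assume f: "f \<in> quadrics P"
    then have "f \<in> mp.span S"
      using S1(3) unfolding quadrics_def by auto
    then have *: "component P f \<in> mp.span (component P ` S)"
      by (rule component_span)
    have "component P f = f"
      using f by (intro component_id) (simp add: quadrics_def)
    then have f_span: "f \<in> mp.span (component P ` S)"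
      by (rule subst) (rule *)
    have "component P ` S \<subseteq> insert 0 ?SP"
    proof
      fix g assume "g \<in> component P ` S"
      then obtain h where h: "h \<in> S" "g = component P h"
        by blast
      show "g \<in> insert 0 ?SP"
      proof (cases "\<exists>a\<in>keys h. P a")
        case True
        then show ?thesis
          using h all[OF h(1)] component_id[of h P] by simp
      next
        case False
        then show ?thesis
          using h component_eq_0[of h P] by simp
      qed
    qed
    from subsetD[OF mp.span_mono[OF this] f_span] have "f \<in> mp.span (insert 0 ?SP)" .
    then show "f \<in> mp.span ?SP"
      by (simp add: mp.span_insert_0)
  qed
  ultimately have "finite ?SP \<and> card ?SP = card {u \<in> N. P u}"
    by (intro card_basis_quadrics) (use P in blast)
  then show ?thesis ..
qed

end

section \<open>The dominance order on columns\<close>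

text \<open>
  The ballot form of the order: for columns, it says that \<open>\<sigma>\<close> is at least as long as \<open>\<tau>\<close> and
  that the \<open>c\<close>-th smallest entry of \<open>\<sigma>\<close> is at most that of \<open>\<tau>\<close> for each row \<open>c\<close> of \<open>\<tau>\<close>
  (\<open>dominates_iff_pick\<close>). Prefix counts make the order easy to follow when the largest entry
  is removed, which is what the enumeration needs.
\<close>

definition dominates :: "nat set \<Rightarrow> nat set \<Rightarrow> bool" where
  "dominates \<sigma> \<tau> \<longleftrightarrow> (\<forall>x. card (\<tau> \<inter> {..x}) \<le> card (\<sigma> \<inter> {..x}))"

definition comparable :: "nat set \<Rightarrow> nat set \<Rightarrow> bool" where
  "comparable \<sigma> \<tau> \<longleftrightarrow> dominates \<sigma> \<tau> \<or> dominates \<tau> \<sigma>"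

lemma dominates_refl: "dominates \<sigma> \<sigma>"
  by (simp add: dominates_def)

lemma dominates_trans: "dominates \<sigma> \<tau> \<Longrightarrow> dominates \<tau> \<rho> \<Longrightarrow> dominates \<sigma> \<rho>"
  unfolding dominates_def by (meson le_trans)

lemma dominates_card:
  assumes "dominates \<sigma> \<tau>" "finite \<sigma>" "finite \<tau>"
  shows "card \<tau> \<le> card \<sigma>"
proof -
  obtain b where b: "\<And>x. x \<in> \<sigma> \<union> \<tau> \<Longrightarrow> x \<le> b"
    using assms(2,3) by (meson finite_UnI finite_nat_set_iff_bounded_le)
  then have "\<sigma> \<inter> {..b} = \<sigma>" "\<tau> \<inter> {..b} = \<tau>"
    by auto
  then show ?thesis
    using assms(1) unfolding dominates_def by metis
qed

lemma inj_on_pick: "inj_on (pick \<sigma>) {0..<card \<sigma>}"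
  using pick_mono_le[of _ \<sigma>] by (intro linorder_inj_onI) (auto simp: less_imp_neq)

lemma pick_image:
  assumes "finite \<sigma>"
  shows "pick \<sigma> ` {0..<card \<sigma>} = \<sigma>"
  using pick_in_set_le[of _ \<sigma>] card_image[OF inj_on_pick[of \<sigma>]] assms by (intro card_subset_eq) auto

lemma pick_less_iff:
  assumes "finite \<sigma>"
  shows "c < card (\<sigma> \<inter> {..x}) \<longleftrightarrow> c < card \<sigma> \<and> pick \<sigma> c \<le> x"
proof
  assume c: "c < card (\<sigma> \<inter> {..x})"
  then have c': "c < card \<sigma>"
    using card_mono[of \<sigma> "\<sigma> \<inter> {..x}"] assms by auto
  have "pick \<sigma> c \<le> x"
  proof (rule ccontr)
    assume "\<not> pick \<sigma> c \<le> x"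
    then have "\<sigma> \<inter> {..x} \<subseteq> {a \<in> \<sigma>. a < pick \<sigma> c}"
      by auto
    then have "card (\<sigma> \<inter> {..x}) \<le> c"
      using card_mono[of "{a \<in> \<sigma>. a < pick \<sigma> c}"] assms card_pick[of c \<sigma>] c' by auto
    then show False
      using c by simp
  qed
  with c' show "c < card \<sigma> \<and> pick \<sigma> c \<le> x" ..
next
  assume c: "c < card \<sigma> \<and> pick \<sigma> c \<le> x"
  then have "pick \<sigma> c \<in> \<sigma>"
    using pick_in_set[of c \<sigma>] by simp
  then have "insert (pick \<sigma> c) {a \<in> \<sigma>. a < pick \<sigma> c} \<subseteq> \<sigma> \<inter> {..x}"
    using c by auto
  then have "card (insert (pick \<sigma> c) {a \<in> \<sigma>. a < pick \<sigma> c}) \<le> card (\<sigma> \<inter> {..x})"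
    using assms by (intro card_mono) auto
  then show "c < card (\<sigma> \<inter> {..x})"
    using assms card_pick[of c \<sigma>] c by simp
qed

lemma dominates_iff_pick:
  assumes "finite \<sigma>" "finite \<tau>"
  shows "dominates \<sigma> \<tau> \<longleftrightarrow> card \<tau> \<le> card \<sigma> \<and> (\<forall>c<card \<tau>. pick \<sigma> c \<le> pick \<tau> c)"
proof (intro iffI conjI allI impI)
  assume d: "dominates \<sigma> \<tau>"
  then show "card \<tau> \<le> card \<sigma>"
    using dominates_card assms by blast
  fix c assume "c < card \<tau>"
  then have "c < card (\<tau> \<inter> {..pick \<tau> c})"
    using pick_less_iff[OF assms(2)] by simp
  also have "\<dots> \<le> card (\<sigma> \<inter> {..pick \<tau> c})"
    using d by (simp add: dominates_def)
  finally show "pick \<sigma> c \<le> pick \<tau> c"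
    using pick_less_iff[OF assms(1)] by simp
next
  assume a: "card \<tau> \<le> card \<sigma> \<and> (\<forall>c<card \<tau>. pick \<sigma> c \<le> pick \<tau> c)"
  have "c < card (\<sigma> \<inter> {..x})" if "c < card (\<tau> \<inter> {..x})" for c x
    using that a pick_less_iff[OF assms(1)] pick_less_iff[OF assms(2)] by (meson le_trans less_le_trans)
  then show "dominates \<sigma> \<tau>"
    unfolding dominates_def by (meson not_le_imp_less less_irrefl)
qed

lemma dominates_antisym:
  assumes "dominates \<sigma> \<tau>" "dominates \<tau> \<sigma>" "finite \<sigma>" "finite \<tau>"
  shows "\<sigma> = \<tau>"
proof -
  have eq: "card (\<sigma> \<inter> {..x}) = card (\<tau> \<inter> {..x})" for x
    using assms(1,2) unfolding dominates_def by (simp add: le_antisym)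
  have rec: "card (\<rho> \<inter> {..x}) = card {a \<in> \<rho>. a < x} + (if x \<in> \<rho> then 1 else 0)"
    if "finite \<rho>" for x and \<rho> :: "nat set"
  proof -
    have "\<rho> \<inter> {..x} = {a \<in> \<rho>. a < x} \<union> (if x \<in> \<rho> then {x} else {})"
      by (auto simp: le_less split: if_splits)
    then show ?thesis
      using that by (simp add: card_Un_disjoint)
  qed
  have less: "card {a \<in> \<sigma>. a < x} = card {a \<in> \<tau>. a < x}" for x
  proof (cases x)
    case (Suc y)
    then have "{a \<in> \<rho>. a < x} = \<rho> \<inter> {..y}" for \<rho>
      by auto
    then show ?thesis
      using eq by simp
  qed simp
  have "x \<in> \<sigma> \<longleftrightarrow> x \<in> \<tau>" for x
    using eq[of x] rec[OF assms(3), of x] rec[OF assms(4), of x] less[of x] by (auto split: if_splits)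
  then show ?thesis by blast
qed

section \<open>Independence of standard monomials\<close>

lemma base_digits_unique:
  fixes d e :: "nat \<Rightarrow> nat"
  assumes "(\<Sum>i<L. d i * B ^ i) = (\<Sum>i<L. e i * B ^ i)" "\<And>i. i < L \<Longrightarrow> d i < B" "\<And>i. i < L \<Longrightarrow> e i < B" "i < L"
  shows "d i = e i"
  using assms
proof (induction L arbitrary: d e i)
  case (Suc L)
  have split: "(\<Sum>i<Suc L. f i * B ^ i) = f 0 + B * (\<Sum>i<L. f (Suc i) * B ^ i)" for f :: "nat \<Rightarrow> nat"
    unfolding sum.lessThan_Suc_shift by (simp add: sum_distrib_left mult_ac)
  have eq: "d 0 + B * (\<Sum>i<L. d (Suc i) * B ^ i) = e 0 + B * (\<Sum>i<L. e (Suc i) * B ^ i)"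
    using Suc.prems(1) unfolding split .
  have lt: "d 0 < B" "e 0 < B"
    using Suc.prems by auto
  have "d 0 = e 0"
    using arg_cong[OF eq, of "\<lambda>x. x mod B"] lt by simp
  moreover have "(\<Sum>i<L. d (Suc i) * B ^ i) = (\<Sum>i<L. e (Suc i) * B ^ i)"
    using eq \<open>d 0 = e 0\<close> lt by simp
  then have "d (Suc j) = e (Suc j)" if "j < L" for j
    using Suc.IH[of "\<lambda>i. d (Suc i)" "\<lambda>i. e (Suc i)" j] Suc.prems(2,3) that by simp
  ultimately show ?case
    using Suc.prems(4) by (cases i) auto
qed simp

text \<open>
  The exponent of the diagonal term in the minor with rows \<open>\<sigma>\<close> of the matrix with entry
  \<open>t ^ (B ^ (r * M + c))\<close> in row \<open>r\<close> and column \<open>c\<close>.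
\<close>

definition lead_exp :: "nat \<Rightarrow> nat \<Rightarrow> nat set \<Rightarrow> nat" where
  "lead_exp B M \<sigma> = (\<Sum>c<card \<sigma>. B ^ (pick \<sigma> c * M + c))"

definition minor_poly :: "nat \<Rightarrow> nat \<Rightarrow> nat set \<Rightarrow> 'k::field poly" where
  "minor_poly B M \<sigma> = det (mat (card \<sigma>) (card \<sigma>) (\<lambda>(i, j). monom 1 (B ^ (pick \<sigma> i * M + j))))"

text \<open>
  At the largest position \<open>c\<close> that is moved, the diagonal contributes a power of \<open>B\<close> that
  exceeds every power occurring on the left-hand side at the positions up to \<open>c\<close>. There are
  fewer than \<open>B\<close> of those, so together they are still smaller.
\<close>

lemma permuted_exponent_less:
  fixes x :: "nat \<Rightarrow> nat"
  assumes \<pi>: "\<pi> permutes {..<k}" "\<pi> \<noteq> id" and k: "k \<le> M" "k < B"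
    and x: "\<And>i j. i < j \<Longrightarrow> j < k \<Longrightarrow> x i < x j"
  shows "(\<Sum>i<k. B ^ (x i * M + \<pi> i)) < (\<Sum>i<k. B ^ (x i * M + i))"
proof -
  define S where "S = {i. \<pi> i \<noteq> i}"
  have S: "S \<subseteq> {..<k}"
    using \<pi>(1) by (auto simp: S_def permutes_def)
  then have fin: "finite S"
    using finite_subset by blast
  have "S \<noteq> {}"
    using \<pi>(2) by (auto simp: S_def)
  \<comment> \<open>The largest position that is moved; it is necessarily moved down.\<close>
  define c where "c = Max S"
  have c: "c \<in> S" "\<And>i. i \<in> S \<Longrightarrow> i \<le> c"
    using fin \<open>S \<noteq> {}\<close> by (auto simp: c_def)
  have ck: "c < k"
    using c(1) S by auto
  have \<pi>_lt: "\<pi> i < k" if "i < k" for i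
    using permutes_in_image[OF \<pi>(1), of i] that by simp
  have inj: "inj \<pi>"
    using permutes_inj[OF \<pi>(1)] .
  have "\<pi> c \<in> S"
    using c(1) inj by (auto simp: S_def dest: injD)
  then have \<pi>c: "\<pi> c < c"
    using c by (force simp: S_def)
  define e where "e = x c * M + c"
  have e: "0 < e"
    using \<pi>c by (simp add: e_def)
  have small: "x i * M + \<pi> i \<le> e - 1" if "i \<le> c" for i
  proof (cases "i = c")
    case False
    then have "x i * M + M \<le> x c * M"
      using x[of i c] that ck mult_le_mono1[of "Suc (x i)" "x c" M] by simp
    then show ?thesis
      using \<pi>_lt[of i] that ck k unfolding e_def by linarith
  qed (use \<pi>c in \<open>simp add: e_def\<close>)
  have Bpos: "0 < B"
    using k by simp
  have "(\<Sum>i\<le>c. B ^ (x i * M + \<pi> i)) \<le> (\<Sum>i\<le>c. B ^ (e - 1))"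
    by (intro sum_mono power_increasing) (use small Bpos in auto)
  also have "\<dots> = Suc c * B ^ (e - 1)"
    by simp
  also have "\<dots> < B * B ^ (e - 1)"
    by (intro mult_strict_right_mono) (use ck k in auto)
  also have "\<dots> = B ^ (x c * M + c)"
    using e unfolding e_def by (metis power_eq_if neq0_conv)
  also have "\<dots> \<le> (\<Sum>i\<le>c. B ^ (x i * M + i))"
    by (rule member_le_sum) auto
  finally have low: "(\<Sum>i\<le>c. B ^ (x i * M + \<pi> i)) < (\<Sum>i\<le>c. B ^ (x i * M + i))" .
  have "\<pi> i = i" if "c < i" for i
    using c(2)[of i] that by (auto simp: S_def)
  then have high: "(\<Sum>i\<in>{c<..<k}. B ^ (x i * M + \<pi> i)) = (\<Sum>i\<in>{c<..<k}. B ^ (x i * M + i))"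
    by (intro sum.cong) auto
  have "{..<k} = {..c} \<union> {c<..<k}"
    using ck by auto
  then have "(\<Sum>i<k. f i) = (\<Sum>i\<le>c. f i) + (\<Sum>i\<in>{c<..<k}. f i)" for f :: "nat \<Rightarrow> nat"
    by (simp add: sum.union_disjoint ivl_disj_int)
  then show ?thesis
    using low high by simp
qed

lemma minor_poly_leading:
  assumes "card \<sigma> \<le> M" "card \<sigma> < B"
  shows "(minor_poly B M \<sigma> :: 'k::field poly) \<noteq> 0 \<and>
    degree (minor_poly B M \<sigma> :: 'k poly) = lead_exp B M \<sigma>"
proof -
  let ?k = "card \<sigma>"
  let ?E = "\<lambda>\<pi>. \<Sum>i<?k. B ^ (pick \<sigma> i * M + \<pi> i)"
  let ?P = "{\<pi>. \<pi> permutes {0..<?k}}"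
  have fin: "finite ?P"
    by (simp add: finite_permutations)
  have monom_prod: "(\<Prod>i = 0..<?k. monom (1::'k) (B ^ (pick \<sigma> i * M + \<pi> i))) = monom 1 (?E \<pi>)" for \<pi>
  proof -
    have "(\<Prod>i<l. monom (1::'k) (B ^ (pick \<sigma> i * M + \<pi> i))) = monom 1 (\<Sum>i<l. B ^ (pick \<sigma> i * M + \<pi> i))" for l
      by (induction l) (auto simp: mult_monom monom_0)
    then show ?thesis
      by (simp add: atLeast0LessThan)
  qed
  have "minor_poly B M \<sigma> = (\<Sum>\<pi>\<in>?P. signof \<pi> * monom (1::'k) (?E \<pi>))"
    unfolding minor_poly_def
    by (subst det_def'[of _ ?k]) (auto intro!: sum.cong simp: monom_prod[symmetric] intro!: prod.cong dest: permutes_in_image)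
  also have "\<dots> = monom 1 (?E id) + (\<Sum>\<pi>\<in>?P - {id}. signof \<pi> * monom (1::'k) (?E \<pi>))"
    by (subst sum.remove[OF fin, of id]) (auto simp: permutes_id sign_id)
  finally have eq: "minor_poly B M \<sigma> = monom 1 (?E id) + (\<Sum>\<pi>\<in>?P - {id}. signof \<pi> * monom (1::'k) (?E \<pi>))" .
  show ?thesis
  proof (cases "?P - {id} = {}")
    case True
    then show ?thesis
      unfolding eq True by (simp add: lead_exp_def degree_monom_eq)
  next
    case False
    have less: "?E \<pi> < ?E id" if "\<pi> \<in> ?P - {id}" for \<pi>
      using permuted_exponent_less[of \<pi> ?k M B "pick \<sigma>"] that assms pick_mono_le[of _ \<sigma>]
      by (auto simp: atLeast0LessThan)
    obtain \<rho> where "\<rho> \<in> ?P - {id}"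
      using False by blast
    from less[OF this] have "0 < ?E id"
      by (rule le_less_trans[OF le0])
    have "degree (signof \<pi> * monom (1::'k) (?E \<pi>)) \<le> ?E \<pi>" for \<pi>
      by (auto simp: sign_def degree_monom_le)
    from le_less_trans[OF this less]
    have "degree (\<Sum>\<pi>\<in>?P - {id}. signof \<pi> * monom (1::'k) (?E \<pi>)) < ?E id"
      using \<open>0 < ?E id\<close> by (rule degree_sum_less)
    moreover have "degree (monom (1::'k) (?E id)) = ?E id"
      by (simp add: degree_monom_eq)
    ultimately have deg: "degree (minor_poly B M \<sigma> :: 'k poly) = ?E id"
      unfolding eq by (subst degree_add_eq_left) auto
    have "(minor_poly B M \<sigma> :: 'k poly) \<noteq> 0"
    proof
      assume "(minor_poly B M \<sigma> :: 'k poly) = 0"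
      then have "?E id = 0"
        using deg by (simp only: degree_0)
      then show False
        using \<open>0 < ?E id\<close> by linarith
    qed
    then show ?thesis
      using deg by (simp add: lead_exp_def)
  qed
qed

lemma sum_distinct_degree_nonzero:
  fixes g :: "'a \<Rightarrow> 'k::field poly"
  assumes "finite S" "S \<noteq> {}" "\<And>a. a \<in> S \<Longrightarrow> g a \<noteq> 0" "inj_on (\<lambda>a. degree (g a)) S"
  shows "(\<Sum>a\<in>S. g a) \<noteq> 0"
proof -
  define d where "d = Max ((\<lambda>a. degree (g a)) ` S)"
  have "d \<in> (\<lambda>a. degree (g a)) ` S"
    unfolding d_def using assms(1,2) by (intro Max_in) auto
  then obtain a where a: "a \<in> S" "degree (g a) = d"
    by blast
  have "coeff (g b) d = 0" if "b \<in> S - {a}" for b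
  proof (rule coeff_eq_0)
    have "degree (g b) \<le> d"
      using that assms(1) unfolding d_def by (intro Max_ge) auto
    moreover have "degree (g b) \<noteq> d"
      using that a assms(4) by (auto simp: inj_on_def)
    ultimately show "degree (g b) < d" by simp
  qed
  then have "coeff (\<Sum>a\<in>S. g a) d = coeff (g a) d"
    using a assms(1) by (simp add: coeff_sum sum.remove[of S a])
  also have "\<dots> \<noteq> 0"
    using a assms(3) by auto
  finally show ?thesis by auto
qed

text \<open>
  If the monomials of \<open>f\<close> acquire different degrees along a curve, then the term of largest
  degree cannot cancel.
\<close>

lemma poly_eval_curve:
  fixes f :: "('v, 'k::field) mpoly" and D :: "'v \<Rightarrow> 'k poly"
  assumes "f \<noteq> 0" "\<And>a x. a \<in> keys f \<Longrightarrow> x \<in> keys a \<Longrightarrow> D x \<noteq> 0"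
    and inj: "inj_on (weight (\<lambda>x. degree (D x))) (keys f)"
  obtains Q where "Q \<noteq> 0" "\<And>t. poly_eval f (\<lambda>x. poly (D x) t) = poly Q t"
proof
  define g where "g = (\<lambda>a. smult (lookup f a) (\<Prod>x\<in>keys a. D x ^ lookup a x))"
  have nz: "g a \<noteq> 0" if "a \<in> keys f" for a
    using that assms(2) by (auto simp: g_def in_keys_iff)
  have deg: "degree (g a) = weight (\<lambda>x. degree (D x)) a" if "a \<in> keys f" for a
  proof -
    have "degree (g a) = degree (\<Prod>x\<in>keys a. D x ^ lookup a x)"
      using that by (simp add: g_def in_keys_iff)
    also have "\<dots> = (\<Sum>x\<in>keys a. degree (D x ^ lookup a x))"
      using assms(2)[OF that] by (intro degree_prod_sum_eq) auto
    also have "\<dots> = weight (\<lambda>x. degree (D x)) a"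
      unfolding weight_def using assms(2)[OF that] by (intro sum.cong) (auto simp: degree_power_eq)
    finally show ?thesis .
  qed
  have "inj_on (\<lambda>a. degree (g a)) (keys f)"
    using inj deg by (simp add: inj_on_def)
  then show "(\<Sum>a\<in>keys f. g a) \<noteq> 0"
    using nz assms(1) by (intro sum_distinct_degree_nonzero) auto
  show "poly_eval f (\<lambda>x. poly (D x) t) = poly (\<Sum>a\<in>keys f. g a) t" for t
    by (simp add: poly_eval_def g_def poly_sum poly_prod)
qed

text \<open>
  The digits of \<open>lead_exp\<close> in base \<open>B\<close>: the position \<open>r * M + c\<close> carries a 1 if \<open>r\<close> is the
  entry of \<open>\<sigma>\<close> in row \<open>c\<close>, and 0 otherwise.
\<close>

definition entry_digit :: "nat \<Rightarrow> nat set \<Rightarrow> nat \<Rightarrow> nat" where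
  "entry_digit M \<sigma> i = of_bool (\<exists>c<card \<sigma>. i = pick \<sigma> c * M + c)"

lemma entry_digit_iff:
  assumes "c < M" "card \<sigma> \<le> M"
  shows "0 < entry_digit M \<sigma> (r * M + c) \<longleftrightarrow> c < card \<sigma> \<and> pick \<sigma> c = r"
proof -
  have "c' = c \<and> r' = r" if "r * M + c = r' * M + c'" "c' < M" for r' c'
  proof -
    have "c' = c"
      using arg_cong[OF that(1), of "\<lambda>x. x mod M"] that(2) assms(1) by simp
    then show ?thesis
      using that assms(1) by simp
  qed
  then show ?thesis
    using assms(2) by (auto simp: entry_digit_def)
qed

lemma lead_exp_digits:
  assumes "\<sigma> \<subseteq> {1..m}" "card \<sigma> \<le> M" "Suc m * M \<le> L"
  shows "lead_exp B M \<sigma> = (\<Sum>i<L. entry_digit M \<sigma> i * B ^ i)"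
proof -
  let ?f = "\<lambda>c. pick \<sigma> c * M + c"
  have inj: "inj_on ?f {..<card \<sigma>}"
  proof (rule inj_onI)
    fix c d assume cd: "c \<in> {..<card \<sigma>}" "d \<in> {..<card \<sigma>}" "?f c = ?f d"
    then have "c < M" "d < M"
      using assms(2) by auto
    then show "c = d"
      using arg_cong[OF cd(3), of "\<lambda>x. x mod M"] by simp
  qed
  have sub: "?f ` {..<card \<sigma>} \<subseteq> {..<L}"
  proof
    fix i assume "i \<in> ?f ` {..<card \<sigma>}"
    then obtain c where c: "c < card \<sigma>" "i = ?f c"
      by auto
    have "pick \<sigma> c \<le> m"
      using pick_in_set_le[OF c(1)] assms(1) by auto
    then have "pick \<sigma> c * M \<le> m * M"
      by (rule mult_le_mono1)
    then have "pick \<sigma> c * M + c < Suc m * M"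
      using c(1) assms(2) unfolding mult_Suc by linarith
    then show "i \<in> {..<L}"
      using c assms(3) by simp
  qed
  have "lead_exp B M \<sigma> = (\<Sum>i\<in>?f ` {..<card \<sigma>}. B ^ i)"
    unfolding lead_exp_def by (simp add: sum.reindex[OF inj])
  also have "\<dots> = (\<Sum>i\<in>?f ` {..<card \<sigma>}. entry_digit M \<sigma> i * B ^ i)"
    by (intro sum.cong) (auto simp: entry_digit_def)
  also have "\<dots> = (\<Sum>i<L. entry_digit M \<sigma> i * B ^ i)"
    using sub by (intro sum.mono_neutral_left) (auto simp: entry_digit_def)
  finally show ?thesis .
qed

lemma weight_sum_digits:
  assumes "\<And>x. x \<in> keys a \<Longrightarrow> w x = (\<Sum>i<L. d x i * B i)"
  shows "weight w a = (\<Sum>i<L. weight (\<lambda>x. d x i) a * B i)"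
proof -
  have "weight w a = (\<Sum>x\<in>keys a. \<Sum>i<L. lookup a x * d x i * B i)"
    unfolding weight_def by (intro sum.cong) (auto simp: assms sum_distrib_left mult.assoc)
  also have "\<dots> = (\<Sum>i<L. weight (\<lambda>x. d x i) a * B i)"
    unfolding weight_def sum_distrib_right by (rule sum.swap)
  finally show ?thesis .
qed

lemma chain_least:
  assumes "finite S" "S \<noteq> {}" "\<And>x y. x \<in> S \<Longrightarrow> y \<in> S \<Longrightarrow> comparable (s x) (s y)"
  shows "\<exists>x\<in>S. \<forall>y\<in>S. dominates (s x) (s y)"
  using assms
proof (induction rule: finite_ne_induct)
  case (singleton x)
  then show ?case by (simp add: dominates_refl)
next
  case (insert z S)
  then obtain x where x: "x \<in> S" "\<forall>y\<in>S. dominates (s x) (s y)"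
    by blast
  show ?case
  proof (cases "dominates (s x) (s z)")
    case True
    then show ?thesis
      using x by blast
  next
    case False
    then have "dominates (s z) (s x)"
      using insert.prems[of x z] x(1) by (auto simp: comparable_def)
    then show ?thesis
      using x(2) dominates_trans dominates_refl by (intro bexI[of _ z]) blast+
  qed
qed

text \<open>
  Variables labelled by columns. The labelling allows the same argument for subsets of
  \<open>{1..m}\<close> and for tableaux with one column.
\<close>

locale column_labels =
  fixes V :: "'v set" and s :: "'v \<Rightarrow> nat set" and m :: nat
  assumes inj_s: "inj_on s V" and s_sub: "\<And>x. x \<in> V \<Longrightarrow> s x \<subseteq> {1..m}" and s_ne: "\<And>x. x \<in> V \<Longrightarrow> s x \<noteq> {}"
begin

abbreviation "cmp \<equiv> \<lambda>x y. comparable (s x) (s y)"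

lemma finite_s: "x \<in> V \<Longrightarrow> finite (s x)"
  using s_sub finite_subset by blast

lemma card_s: "x \<in> V \<Longrightarrow> card (s x) \<le> m"
  using card_mono[OF _ s_sub] by fastforce

lemma card_s_pos: "x \<in> V \<Longrightarrow> 0 < card (s x)"
  using finite_s s_ne by (simp add: card_gt_0_iff)

lemma weight_pos_iff: "0 < weight w a \<longleftrightarrow> (\<exists>x\<in>keys a. 0 < w x)"
  unfolding weight_def neq0_conv[symmetric] by (auto simp: in_keys_iff)

text \<open>
  Equal digits mean that the two tableaux have the same entries in each row. The entry of \<open>y\<close>
  in row \<open>c\<close> therefore occurs in row \<open>c\<close> of some column \<open>z\<close> of the first tableau, and \<open>x\<close>
  dominates \<open>z\<close>.
\<close>

lemma least_dominates:
  assumes a: "keys a \<subseteq> V" and b: "keys b \<subseteq> V"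
    and eq: "\<And>i. weight (\<lambda>x. entry_digit (Suc m) (s x) i) a = weight (\<lambda>x. entry_digit (Suc m) (s x) i) b"
    and x: "x \<in> keys a" "\<forall>z\<in>keys a. dominates (s x) (s z)" and y: "y \<in> keys b"
  shows "dominates (s x) (s y)"
proof -
  have *: "c < card (s x) \<and> pick (s x) c \<le> pick (s y) c" if c: "c < card (s y)" for c
  proof -
    let ?i = "pick (s y) c * Suc m + c"
    have cM: "c < Suc m"
      using c card_s[of y] y b by auto
    have "0 < entry_digit (Suc m) (s y) ?i"
      using entry_digit_iff[of c "Suc m" "s y"] c cM card_s[of y] y b by auto
    then have "0 < weight (\<lambda>x. entry_digit (Suc m) (s x) ?i) b"
      using y weight_pos_iff by blast
    then have "0 < weight (\<lambda>x. entry_digit (Suc m) (s x) ?i) a"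
      unfolding eq[of ?i] .
    then obtain z where z: "z \<in> keys a" "0 < entry_digit (Suc m) (s z) ?i"
      unfolding weight_pos_iff by blast
    then have "c < card (s z) \<and> pick (s z) c = pick (s y) c"
      using entry_digit_iff[of c "Suc m" "s z"] cM card_s[of z] a by auto
    moreover have "card (s z) \<le> card (s x) \<and> (\<forall>c<card (s z). pick (s x) c \<le> pick (s z) c)"
      using x z(1) a finite_s dominates_iff_pick[of "s x" "s z"] by blast
    ultimately show ?thesis by (metis less_le_trans)
  qed
  have "card (s y) \<le> card (s x)"
    using *[of "card (s y) - 1"] card_s_pos[of y] y b by fastforce
  then show ?thesis
    using * dominates_iff_pick[of "s x" "s y"] finite_s x(1) y a b by blast
qed

text \<open>
  A semistandard tableau is determined by the contents of its rows: the smallest entries of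
  the rows form its first column, and the remaining columns follow by induction.
\<close>

lemma standard_determined_by_digits:
  assumes "keys a \<subseteq> V" "keys b \<subseteq> V" "standard_monomial cmp a" "standard_monomial cmp b"
    and "\<And>i. weight (\<lambda>x. entry_digit (Suc m) (s x) i) a = weight (\<lambda>x. entry_digit (Suc m) (s x) i) b"
  shows "a = b"
  using assms
proof (induction "total_degree a" arbitrary: a b rule: less_induct)
  case less
  have empty: "q = 0" if "p = 0" and q: "keys q \<subseteq> V"
    and eq: "\<And>i. weight (\<lambda>x. entry_digit (Suc m) (s x) i) p = weight (\<lambda>x. entry_digit (Suc m) (s x) i) q"
    for p q :: "'v \<Rightarrow>\<^sub>0 nat"
  proof (rule ccontr)
    assume "q \<noteq> 0"
    then obtain y where y: "y \<in> keys q"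
      by (metis all_not_in_conv keys_eq_empty)
    let ?i = "pick (s y) 0 * Suc m + 0"
    have "0 < entry_digit (Suc m) (s y) ?i"
      using y q card_s_pos[of y] card_s[of y] by (subst entry_digit_iff) auto
    then have "0 < weight (\<lambda>x. entry_digit (Suc m) (s x) ?i) q"
      using y weight_pos_iff by blast
    then show False
      using eq[of ?i] that(1) by (simp add: weight_def)
  qed
  show ?case
  proof (cases "a = 0 \<or> b = 0")
    case True
    then show ?thesis
      using empty[of a b] empty[of b a] less.prems by metis
  next
    case False
    then have ne: "keys a \<noteq> {}" "keys b \<noteq> {}"
      by auto
    obtain x where x: "x \<in> keys a" "\<forall>z\<in>keys a. dominates (s x) (s z)"
      using chain_least[of "keys a" s] ne less.prems(3) unfolding standard_monomial_def by auto
    obtain y where y: "y \<in> keys b" "\<forall>z\<in>keys b. dominates (s y) (s z)"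
      using chain_least[of "keys b" s] ne less.prems(4) unfolding standard_monomial_def by auto
    have "dominates (s x) (s y)"
      using least_dominates[OF less.prems(1,2,5) x y(1)] .
    moreover have "dominates (s y) (s x)"
      using least_dominates[OF less.prems(2,1) less.prems(5)[symmetric] y x(1)] .
    ultimately have "s x = s y"
      using dominates_antisym finite_s x(1) y(1) less.prems(1,2) by blast
    then have "x = y"
      using inj_onD[OF inj_s] x(1) y(1) less.prems(1,2) by blast
    define a' b' where "a' = a - single x 1" "b' = b - single x 1"
    have ab: "a = a' + single x 1" "b = b' + single x 1"
      using x(1) y(1) \<open>x = y\<close>
      by (auto simp: a'_b'_def in_keys_iff lookup_add lookup_minus lookup_single when_def intro!: poly_mapping_eqI)
    have sub: "keys a' \<subseteq> keys a" "keys b' \<subseteq> keys b"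
      by (auto simp: a'_b'_def in_keys_iff lookup_minus)
    have "a' = b'"
    proof (rule less.hyps)
      show "total_degree a' < total_degree a"
        unfolding ab(1) by (simp add: total_degree_add total_degree_single)
      show "standard_monomial cmp a'" "standard_monomial cmp b'"
        using less.prems(3,4) sub unfolding standard_monomial_def by blast+
      show "weight (\<lambda>x. entry_digit (Suc m) (s x) i) a' = weight (\<lambda>x. entry_digit (Suc m) (s x) i) b'" for i
        using less.prems(5)[of i] unfolding ab by (simp add: weight_add)
    qed (use less.prems(1,2) sub in auto)
    then show ?thesis
      using ab by simp
  qed
qed

lemma standard_determined_by_lead_exp:
  assumes "keys a \<subseteq> V" "keys b \<subseteq> V" "standard_monomial cmp a" "standard_monomial cmp b"
    and B: "total_degree a < B" "total_degree b < B"
    and eq: "weight (\<lambda>x. lead_exp B (Suc m) (s x)) a = weight (\<lambda>x. lead_exp B (Suc m) (s x)) b"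
  shows "a = b"
proof (rule standard_determined_by_digits[OF assms(1-4)])
  fix i
  define L where "L = Suc i + Suc m * Suc m"
  let ?d = "\<lambda>a i. weight (\<lambda>x. entry_digit (Suc m) (s x) i) a"
  have digits: "weight (\<lambda>x. lead_exp B (Suc m) (s x)) p = (\<Sum>i<L. ?d p i * B ^ i)" if "keys p \<subseteq> V" for p
  proof (rule weight_sum_digits)
    fix x assume "x \<in> keys p"
    then have "x \<in> V"
      using that by blast
    then show "lead_exp B (Suc m) (s x) = (\<Sum>i<L. entry_digit (Suc m) (s x) i * B ^ i)"
      using s_sub card_s[of x] by (intro lead_exp_digits[of _ m]) (auto simp: L_def)
  qed
  have le: "?d p i \<le> total_degree p" for p i
    unfolding weight_def total_degree_def by (intro sum_mono) (auto simp: entry_digit_def)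
  show "?d a i = ?d b i"
  proof (rule base_digits_unique[where L = L and B = B and i = i and d = "?d a" and e = "?d b"])
    show "(\<Sum>i<L. ?d a i * B ^ i) = (\<Sum>i<L. ?d b i * B ^ i)"
      using eq digits[OF assms(1)] digits[OF assms(2)] by simp
    show "?d a j < B" "?d b j < B" for j
      using le[of j a] le[of j b] B by linarith+
  qed (simp add: L_def)
qed

text \<open>
  The base \<open>B\<close> depends on \<open>f\<close> only. It exceeds the degrees of all monomials, so that adding
  up digits causes no carries, and it exceeds \<open>m\<close>, as the leading terms of the minors
  require.
\<close>

lemma standard_eval_nonzero:
  fixes f :: "('v, 'k::field) mpoly"
  assumes f: "f \<noteq> 0" "\<And>a. a \<in> keys f \<Longrightarrow> keys a \<subseteq> V \<and> standard_monomial cmp a"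
  obtains B where "m < B" "1 < B"
    "\<And>D :: 'v \<Rightarrow> 'k poly. (\<And>x. x \<in> V \<Longrightarrow> D x \<noteq> 0 \<and> degree (D x) = lead_exp B (Suc m) (s x)) \<Longrightarrow>
       \<exists>Q. Q \<noteq> 0 \<and> (\<forall>t. poly_eval f (\<lambda>x. poly (D x) t) = poly Q t)"
proof
  \<comment> \<open>The sum bounds every single degree.\<close>
  define B where "B = 2 + m + (\<Sum>a\<in>keys f. total_degree a)"
  show "m < B" "1 < B"
    by (auto simp: B_def)
  fix D :: "'v \<Rightarrow> 'k poly"
  assume D: "\<And>x. x \<in> V \<Longrightarrow> D x \<noteq> 0 \<and> degree (D x) = lead_exp B (Suc m) (s x)"
  have "inj_on (weight (\<lambda>x. degree (D x))) (keys f)"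
  proof (rule inj_onI)
    fix a b assume ab: "a \<in> keys f" "b \<in> keys f" "weight (\<lambda>x. degree (D x)) a = weight (\<lambda>x. degree (D x)) b"
    have w: "weight (\<lambda>x. degree (D x)) p = weight (\<lambda>x. lead_exp B (Suc m) (s x)) p" if "p \<in> keys f" for p
      unfolding weight_def using D f(2)[OF that] by (intro sum.cong) auto
    have td: "total_degree p < B" if "p \<in> keys f" for p
      using member_le_sum[OF that, of total_degree] by (simp add: B_def)
    show "a = b"
      using standard_determined_by_lead_exp[of a b B] f(2) ab td w by auto
  qed
  then obtain Q where "Q \<noteq> 0" "\<And>t. poly_eval f (\<lambda>x. poly (D x) t) = poly Q t"
    using poly_eval_curve[of f D] f D by (metis subsetD)
  then show "\<exists>Q. Q \<noteq> 0 \<and> (\<forall>t. poly_eval f (\<lambda>x. poly (D x) t) = poly Q t)"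
    by blast
qed

end

section \<open>Evaluation of polynomials\<close>

definition monomial_eval :: "('v \<Rightarrow> 'k::comm_ring_1) \<Rightarrow> ('v \<Rightarrow>\<^sub>0 nat) \<Rightarrow> 'k" where
  "monomial_eval x a = (\<Prod>v\<in>keys a. x v ^ lookup a v)"

lemma monomial_eval_superset:
  assumes "finite A" "keys a \<subseteq> A"
  shows "monomial_eval x a = (\<Prod>v\<in>A. x v ^ lookup a v)"
  unfolding monomial_eval_def
  by (rule prod.mono_neutral_left) (use assms in \<open>auto simp: in_keys_iff\<close>)

lemma monomial_eval_add: "monomial_eval x (a + b) = monomial_eval x a * monomial_eval x b"
proof -
  let ?A = "keys a \<union> keys b"
  have "monomial_eval x (a + b) = (\<Prod>v\<in>?A. x v ^ lookup (a + b) v)"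
    by (rule monomial_eval_superset) (use Poly_Mapping.keys_add[of a b] in auto)
  also have "\<dots> = monomial_eval x a * monomial_eval x b"
    by (simp add: monomial_eval_superset[of ?A] lookup_add power_add prod.distrib)
  finally show ?thesis .
qed

lemma monomial_eval_quad: "monomial_eval x (quad_monomial u v) = x u * x v"
  unfolding quad_monomial_def monomial_eval_add by (simp add: monomial_eval_def)

lemma poly_eval_superset:
  assumes "finite A" "keys f \<subseteq> A"
  shows "poly_eval f x = (\<Sum>a\<in>A. lookup f a * monomial_eval x a)"
  unfolding poly_eval_def monomial_eval_def
  by (rule sum.mono_neutral_left) (use assms in \<open>auto simp: in_keys_iff\<close>)

lemma poly_eval_zero [simp]: "poly_eval 0 x = 0"
  by (simp add: poly_eval_def)

lemma poly_eval_add: "poly_eval (f + g) x = poly_eval f x + poly_eval g x"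
proof -
  let ?A = "keys f \<union> keys g"
  have "poly_eval (f + g) x = (\<Sum>a\<in>?A. lookup (f + g) a * monomial_eval x a)"
    by (rule poly_eval_superset) (use Poly_Mapping.keys_add[of f g] in auto)
  also have "\<dots> = poly_eval f x + poly_eval g x"
    by (simp add: poly_eval_superset[of ?A] lookup_add distrib_right sum.distrib)
  finally show ?thesis .
qed

lemma poly_eval_sum: "poly_eval (\<Sum>i\<in>S. f i) x = (\<Sum>i\<in>S. poly_eval (f i) x)"
  by (induction S rule: infinite_finite_induct) (auto simp: poly_eval_add)

lemma poly_eval_single: "poly_eval (single a c) x = c * monomial_eval x a"
  by (cases "c = 0") (auto simp: poly_eval_def monomial_eval_def)

lemma poly_eval_mscale: "poly_eval (mscale c f) x = c * poly_eval f x"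
proof -
  have "poly_eval (mscale c f) x = (\<Sum>a\<in>keys f. lookup (mscale c f) a * monomial_eval x a)"
    by (rule poly_eval_superset) (use keys_mscale in auto)
  also have "\<dots> = c * poly_eval f x"
    by (simp add: poly_eval_superset[of "keys f" f] sum_distrib_left mult.assoc)
  finally show ?thesis .
qed

lemma poly_eval_diff: "poly_eval (f - g) x = poly_eval f x - poly_eval (g :: ('v, 'k::field) mpoly) x"
  using poly_eval_add[of "f - g" g x] by simp

lemma poly_eval_single_mult:
  "poly_eval (single a 1 * g) x = monomial_eval x a * poly_eval (g :: ('v, 'k::field) mpoly) x"
proof -
  have "single a 1 * g = (\<Sum>b\<in>keys g. single (a + b) (lookup g b))"
    by (subst poly_eq_sum_monomials[of g]) (simp add: sum_distrib_left mscale_def mult_single)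
  then have "poly_eval (single a 1 * g) x = (\<Sum>b\<in>keys g. monomial_eval x a * (lookup g b * monomial_eval x b))"
    by (simp add: poly_eval_sum poly_eval_single monomial_eval_add mult_ac)
  also have "\<dots> = monomial_eval x a * poly_eval g x"
    by (simp add: poly_eval_superset[of "keys g" g] sum_distrib_left)
  finally show ?thesis .
qed

lemma poly_eval_mult: "poly_eval (f * g) x = poly_eval f x * poly_eval (g :: ('v, 'k::field) mpoly) x"
proof -
  have "f * g = (\<Sum>a\<in>keys f. mscale (lookup f a) (single a 1 * g))"
    by (subst poly_eq_sum_monomials[of f]) (simp add: sum_distrib_right mscale_def mult.assoc)
  then have "poly_eval (f * g) x = (\<Sum>a\<in>keys f. lookup f a * monomial_eval x a * poly_eval g x)"
    by (simp add: poly_eval_sum poly_eval_mscale poly_eval_single_mult mult.assoc)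
  also have "\<dots> = poly_eval f x * poly_eval g x"
    by (simp add: poly_eval_superset[of "keys f" f] sum_distrib_right)
  finally show ?thesis .
qed

lemma ideal_vanishing:
  fixes V :: "'v set" and X :: "('v \<Rightarrow> 'k::field) set"
  shows "ideal {f \<in> carrier (poly_ring V). \<forall>x\<in>X. poly_eval f x = 0} (poly_ring V)"
proof (rule ideal_poly_ringI)
  fix f g :: "('v, 'k) mpoly"
  assume fg: "f \<in> {f \<in> carrier (poly_ring V). \<forall>x\<in>X. poly_eval f x = 0}"
    "g \<in> {f \<in> carrier (poly_ring V). \<forall>x\<in>X. poly_eval f x = 0}"
  have "keys (f + g) \<subseteq> keys f \<union> keys g"
    by (rule Poly_Mapping.keys_add)
  then have "\<forall>a\<in>keys (f + g). keys a \<subseteq> V"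
    using fg by (simp, blast)
  then show "f + g \<in> {f \<in> carrier (poly_ring V). \<forall>x\<in>X. poly_eval f x = 0}"
    using fg by (simp add: poly_eval_add)
next
  fix h f :: "('v, 'k) mpoly"
  assume h: "h \<in> carrier (poly_ring V)" and f: "f \<in> {f \<in> carrier (poly_ring V). \<forall>x\<in>X. poly_eval f x = 0}"
  have "h * f \<in> carrier (poly_ring V)"
    using cring.cring_simprules(5)[OF cring_poly_ring h, of f] f by simp
  then show "h * f \<in> {f \<in> carrier (poly_ring V). \<forall>x\<in>X. poly_eval f x = 0}"
    using f by (auto simp: poly_eval_mult)
qed auto

section \<open>Garnir relations between minors\<close>

text \<open>
  The minor on a sequence of rows that may be unsorted or have repetitions. Rows are counted
  from 1, as in the columns of tableaux.
\<close>

definition row_minor :: "'k::comm_ring_1 mat \<Rightarrow> nat \<Rightarrow> (nat \<Rightarrow> nat) \<Rightarrow> 'k" where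
  "row_minor A k g = det (mat k k (\<lambda>(i, j). A $$ (g i - 1, j)))"

lemma pick_Suc_image:
  assumes "finite S" "c < card S"
  shows "pick (Suc ` S) c = Suc (pick S c)"
proof -
  let ?a = "pick S c"
  have a: "?a \<in> S" "card {b \<in> S. b < ?a} = c"
    using pick_in_set_le[OF assms(2)] card_pick_le[OF assms(2)] by auto
  have "{b \<in> Suc ` S. b < Suc ?a} = Suc ` {b \<in> S. b < ?a}"
    by auto
  then have "card {b \<in> Suc ` S. b < Suc ?a} = c"
    using a(2) by (simp add: card_image)
  then show ?thesis
    using pick_card_in_set[of "Suc ?a" "Suc ` S"] a(1) by auto
qed

text \<open>
  Coordinates count the rows of a matrix from 0, while the entries of columns start at 1.
\<close>

lemma plucker_coord_eq_row_minor:
  assumes A: "A \<in> carrier_mat m k" and \<sigma>: "\<sigma> \<subseteq> {1..m}" "card \<sigma> = k"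
  shows "plucker_coord A \<sigma> = row_minor A k (pick \<sigma>)"
proof -
  let ?S = "{r. Suc r \<in> \<sigma>}"
  have img: "Suc ` ?S = \<sigma>"
  proof
    show "\<sigma> \<subseteq> Suc ` ?S"
    proof
      fix x assume "x \<in> \<sigma>"
      then show "x \<in> Suc ` ?S"
        using \<sigma>(1) by (cases x) auto
    qed
  qed auto
  have fin: "finite ?S"
    by (rule finite_subset[of _ "{..m}"]) (use \<sigma> in auto)
  have card: "card ?S = k"
    using card_image[of Suc ?S] img \<sigma>(2) by simp
  have rows: "{i. i < dim_row A \<and> i \<in> ?S} = ?S"
    using A \<sigma>(1) by auto
  have pick: "pick \<sigma> c = Suc (pick ?S c)" if "c < k" for c
    using pick_Suc_image[OF fin, of c] that card img by simp
  show ?thesis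
    unfolding plucker_coord_def row_minor_def submatrix_def rows card
    using A pick by (intro arg_cong[where f = det]) (auto simp: pick_UNIV)
qed

lemma row_minor_permute:
  assumes "\<pi> permutes {0..<k}"
  shows "row_minor A k (g \<circ> \<pi>) = signof \<pi> * row_minor A k g"
proof -
  let ?M = "mat k k (\<lambda>(i, j). A $$ (g i - 1, j))"
  have "mat k k (\<lambda>(i, j). A $$ ((g \<circ> \<pi>) i - 1, j)) = mat k k (\<lambda>(i, j). ?M $$ (\<pi> i, j))"
    using permutes_in_image[OF assms] by (intro cong_mat) auto
  then show ?thesis
    unfolding row_minor_def using det_permute_rows[OF _ assms, of ?M] by simp
qed

lemma row_minor_cong: "(\<And>i. i < k \<Longrightarrow> g i = h i) \<Longrightarrow> row_minor A k g = row_minor A k h"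
  unfolding row_minor_def by (intro arg_cong[where f = det] cong_mat) auto

lemma row_minor_not_inj:
  assumes "\<not> inj_on g {0..<k}"
  shows "row_minor A k g = 0"
proof -
  obtain i j where ij: "i < k" "j < k" "i \<noteq> j" "g i = g j"
    using assms by (auto simp: inj_on_def)
  show ?thesis
    unfolding row_minor_def
    by (rule det_identical_rows[OF _ ij(3,1,2)]) (use ij in \<open>auto intro!: eq_vecI\<close>)
qed

text \<open>
  The factor \<open>\<epsilon>\<close>, a sign or zero, depends on the sequence of rows alone and not on the
  matrix. This is what turns a relation between minors of one matrix into a polynomial
  relation between coordinates.
\<close>

lemma row_minor_eq_plucker_coord:
  assumes g: "g ` {0..<k} \<subseteq> {1..m}"
  shows "\<exists>\<epsilon>::'k::field. (\<epsilon> \<noteq> 0 \<longrightarrow> inj_on g {0..<k}) \<and>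
    (\<forall>A\<in>carrier_mat m k. row_minor A k g = \<epsilon> * plucker_coord A (g ` {0..<k}))"
proof (cases "inj_on g {0..<k}")
  case False
  then show ?thesis
    using row_minor_not_inj by (intro exI[of _ 0]) auto
next
  case True
  let ?S = "g ` {0..<k}"
  have card: "card ?S = k"
    using card_image[OF True] by simp
  define \<pi> where "\<pi> = (\<lambda>i. if i < k then card {a \<in> ?S. a < g i} else i)"
  have pick: "pick ?S (\<pi> i) = g i" if "i < k" for i
    using pick_card_in_set[of "g i" ?S] that by (simp add: \<pi>_def)
  have lt: "\<pi> i < k" if "i < k" for i
  proof -
    have "{a \<in> ?S. a < g i} \<subset> ?S"
      using that by auto
    then have "card {a \<in> ?S. a < g i} < card ?S"
      by (intro psubset_card_mono) auto
    then show ?thesis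
      using that card by (simp add: \<pi>_def)
  qed
  have "inj_on \<pi> {0..<k}"
    by (intro inj_onI) (metis True atLeastLessThan_iff inj_onD pick)
  moreover have "\<pi> ` {0..<k} \<subseteq> {0..<k}"
    using lt by auto
  ultimately have "bij_betw \<pi> {0..<k} {0..<k}"
    by (simp add: bij_betw_def endo_inj_surj)
  then have \<pi>: "\<pi> permutes {0..<k}"
    by (rule bij_imp_permutes) (auto simp: \<pi>_def)
  have "row_minor A k g = signof \<pi> * plucker_coord A ?S" if A: "A \<in> carrier_mat m k" for A :: "'k mat"
  proof -
    have "row_minor A k g = row_minor A k (pick ?S \<circ> \<pi>)"
      by (rule row_minor_cong) (simp add: pick)
    then show ?thesis
      using row_minor_permute[OF \<pi>, of A "pick ?S"] plucker_coord_eq_row_minor[OF A g card] by simp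
  qed
  then show ?thesis
    using True by (intro exI[of _ "signof \<pi>"]) auto
qed

text \<open>
  The determinant of a product that factors through a space of dimension \<open>a\<close>, smaller than
  the size of \<open>X\<close>. After expansion each summand selects an index \<open>f i < a\<close> for every \<open>i\<close> in
  \<open>X\<close>. Two of these indices agree, and exchanging their positions reverses the sign.
\<close>

lemma alternating_sum_vanishes:
  fixes d m :: "nat \<Rightarrow> nat \<Rightarrow> 'k::field_char_0"
  assumes X: "finite X" "a < card X"
  shows "(\<Sum>\<pi> | \<pi> permutes X. of_int (sign \<pi>) * (\<Prod>i\<in>X. \<Sum>q<a. d i q * m (\<pi> i) q)) = 0"
proof -
  let ?P = "{\<pi>. \<pi> permutes X}"
  let ?F = "PiE X (\<lambda>_. {..<a})"
  have zero: "(\<Sum>\<pi>\<in>?P. of_int (sign \<pi>) * (\<Prod>i\<in>X. m (\<pi> i) (f i))) = 0" (is "sum ?g _ = 0")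
    if f: "f \<in> ?F" for f
  proof -
    have "f ` X \<subseteq> {..<a}"
      using f by auto
    then have "card (f ` X) < card X"
      using card_mono[of "{..<a}" "f ` X"] X(2) by simp
    then have "\<not> inj_on f X"
      using card_image[of f X] by auto
    then obtain u v where uv: "u \<in> X" "v \<in> X" "u \<noteq> v" "f u = f v"
      by (auto simp: inj_on_def)
    let ?s = "transpose u v"
    have s: "?s permutes X"
      using uv by (intro permutes_swap_id)
    have "?g (\<pi> \<circ> ?s) = - ?g \<pi>" if \<pi>: "\<pi> permutes X" for \<pi>
    proof -
      have "(\<Prod>i\<in>X. m ((\<pi> \<circ> ?s) i) (f i)) = (\<Prod>i\<in>X. m (\<pi> (?s i)) (f (?s i)))"
        using uv(4) by (intro prod.cong) (auto simp: transpose_def)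
      also have "\<dots> = (\<Prod>i\<in>X. m (\<pi> i) (f i))"
        using prod.permute[OF s, of "\<lambda>i. m (\<pi> i) (f i)"] by (simp add: comp_def)
      finally have prod_eq: "(\<Prod>i\<in>X. m ((\<pi> \<circ> ?s) i) (f i)) = (\<Prod>i\<in>X. m (\<pi> i) (f i))" .
      have "sign (\<pi> \<circ> ?s) = sign \<pi> * sign ?s"
        using permutes_imp_permutation[OF X(1)] \<pi> s by (intro sign_compose) auto
      also have "\<dots> = - sign \<pi>"
        using uv(3) by (simp add: sign_swap_id)
      finally show ?thesis
        unfolding prod_eq by (simp only: of_int_minus mult_minus_left)
    qed
    then have "(\<Sum>\<pi>\<in>?P. ?g (\<pi> \<circ> ?s)) = (\<Sum>\<pi>\<in>?P. - ?g \<pi>)"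
      by (intro sum.cong[OF refl]) blast
    then have "(\<Sum>\<pi>\<in>?P. ?g (\<pi> \<circ> ?s)) = - sum ?g ?P"
      by (simp only: sum_negf)
    then have "sum ?g ?P + sum ?g ?P = 0"
      using sum_permutations_compose_right[OF s, of ?g] by (simp only: eq_neg_iff_add_eq_0)
    then have "2 * sum ?g ?P = 0"
      by (simp only: mult_2)
    then show ?thesis
      using mult_eq_0_iff[of 2 "sum ?g ?P"] zero_neq_numeral by metis
  qed
  have "(\<Sum>\<pi>\<in>?P. of_int (sign \<pi>) * (\<Prod>i\<in>X. \<Sum>q<a. d i q * m (\<pi> i) q))
      = (\<Sum>\<pi>\<in>?P. \<Sum>f\<in>?F. (\<Prod>i\<in>X. d i (f i)) * (of_int (sign \<pi>) * (\<Prod>i\<in>X. m (\<pi> i) (f i))))"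
    using X(1) by (simp add: prod_sum_PiE sum_distrib_left prod.distrib mult_ac)
  also have "\<dots> = (\<Sum>f\<in>?F. (\<Prod>i\<in>X. d i (f i)) * (\<Sum>\<pi>\<in>?P. of_int (sign \<pi>) * (\<Prod>i\<in>X. m (\<pi> i) (f i))))"
    by (subst sum.swap) (simp add: sum_distrib_left)
  also have "\<dots> = 0"
    using zero by simp
  finally show ?thesis .
qed

text \<open>
  A block diagonal matrix whose determinant is the product of a minor of \<open>A\<close> and a minor of
  \<open>B\<close>. Permuting the rows among the blocks is then a permutation of the arguments of one
  determinant, so that signs of permutations that preserve the two blocks need no separate
  treatment.
\<close>

definition paired_minors_mat :: "'k::comm_ring_1 mat \<Rightarrow> 'k mat \<Rightarrow> nat \<Rightarrow> nat \<Rightarrow> (nat \<Rightarrow> nat) \<Rightarrow> 'k mat" where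
  "paired_minors_mat A B a b g = mat (a + b) (a + b) (\<lambda>(i, j).
     if i < a then (if j < a then A $$ (g i - 1, j) else 0)
     else (if j < a then 0 else B $$ (g i - 1, j - a)))"

lemma det_paired_minors:
  "det (paired_minors_mat A B a b g) = row_minor A a g * row_minor B b (\<lambda>i. g (a + i) :: nat)"
  for A :: "'k::field mat"
proof -
  have "paired_minors_mat A B a b g = four_block_mat (mat a a (\<lambda>(i, j). A $$ (g i - 1, j))) (0\<^sub>m a b)
     (0\<^sub>m b a) (mat b b (\<lambda>(i, j). B $$ (g (a + i) - 1, j)))"
    unfolding paired_minors_mat_def by (intro eq_matI) auto
  then show ?thesis
    unfolding row_minor_def by (simp add: det_four_block_mat_upper_right_zero[of _ a _ b])
qed

lemma det_paired_minors_permute: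
  assumes \<pi>: "\<pi> permutes {0..<a + b}" "\<pi> ` {0..<a} = {0..<a}"
  shows "det (paired_minors_mat A B a b (z \<circ> \<pi>)) = signof \<pi> * det (paired_minors_mat A B a b z)"
proof -
  have "\<pi> i < a \<longleftrightarrow> i < a" for i
    using \<pi>(2) inj_image_mem_iff[OF permutes_inj[OF \<pi>(1)], of i "{0..<a}"] by auto
  moreover have "\<pi> i < a + b" if "i < a + b" for i
    using permutes_in_image[OF \<pi>(1), of i] that by simp
  ultimately have "paired_minors_mat A B a b (z \<circ> \<pi>) =
      mat (a + b) (a + b) (\<lambda>(i, j). paired_minors_mat A B a b z $$ (\<pi> i, j))"
    unfolding paired_minors_mat_def by (intro cong_mat) auto
  then show ?thesis
    using det_permute_rows[OF _ \<pi>(1), of "paired_minors_mat A B a b z"]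
    by (simp add: paired_minors_mat_def)
qed

text \<open>
  In the Leibniz expansion of the determinants each column of the block matrix comes from a
  column of \<open>A\<close>, or from a combination of such columns. For a fixed assignment of columns the
  alternating sum over the rows in \<open>X\<close> is thus a determinant of rank at most \<open>a\<close>.
\<close>

lemma garnir_sum_vanishes:
  fixes A :: "'k::field_char_0 mat"
  assumes A: "A \<in> carrier_mat m a" and C: "C \<in> carrier_mat a b"
    and X: "X \<subseteq> {0..<a + b}" "a < card X" and z: "\<And>l. l < a + b \<Longrightarrow> z l \<in> {1..m}"
  shows "(\<Sum>\<pi> | \<pi> permutes X. signof \<pi> * det (paired_minors_mat A (A * C) a b (z \<circ> \<pi>))) = 0"
proof -
  let ?n = "a + b"
  let ?P = "{\<pi>. \<pi> permutes X}" and ?R = "{\<rho>. \<rho> permutes {0..<?n}}"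
  have finX: "finite X"
    using X(1) finite_subset by blast
  \<comment> \<open>The entry at \<open>(i, j)\<close> when row \<open>l\<close> of the list \<open>z\<close> is placed at position \<open>i\<close>; the
    function \<open>d\<close> holds its coefficients in terms of the columns of \<open>A\<close>.\<close>
  define E where "E = (\<lambda>i j l. if i < a then (if j < a then A $$ (z l - 1, j) else 0)
     else (if j < a then 0 else (A * C) $$ (z l - 1, j - a)))"
  define d where "d = (\<lambda>j i q. if i < a then (if j < a then of_bool (q = j) else 0)
     else (if j < a then 0 else C $$ (q, j - a)) :: 'k)"
  have E_eq: "E i j l = (\<Sum>q<a. d j i q * A $$ (z l - 1, q))" if "j < ?n" "l < ?n" for i j l
  proof -
    have "z l - 1 < m"
      using z[OF that(2)] by auto
    then have "(A * C) $$ (z l - 1, j - a) = (\<Sum>q<a. C $$ (q, j - a) * A $$ (z l - 1, q))" if "\<not> j < a"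
      using A C that \<open>j < ?n\<close>
      by (auto simp: scalar_prod_def atLeast0LessThan mult.commute intro!: sum.cong)
    moreover have "(\<Sum>q<a. of_bool (q = j) * A $$ (z l - 1, q)) = A $$ (z l - 1, j)" if "j < a"
      using that by (simp add: of_bool_def if_distrib[of "\<lambda>x. x * _"] cong: if_cong)
    ultimately show ?thesis
      by (auto simp: E_def d_def)
  qed
  have det: "det (paired_minors_mat A (A * C) a b (z \<circ> \<pi>)) =
      (\<Sum>\<rho>\<in>?R. signof \<rho> * ((\<Prod>i\<in>X. E i (\<rho> i) (\<pi> i)) * (\<Prod>i\<in>{0..<?n} - X. E i (\<rho> i) i)))"
    if \<pi>: "\<pi> permutes X" for \<pi>
  proof -
    have "det (paired_minors_mat A (A * C) a b (z \<circ> \<pi>)) = (\<Sum>\<rho>\<in>?R. signof \<rho> * (\<Prod>i = 0..<?n. E i (\<rho> i) (\<pi> i)))"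
      by (subst det_def'[of _ ?n])
        (auto simp: paired_minors_mat_def E_def permutes_in_image intro!: sum.cong prod.cong)
    also have "\<dots> = (\<Sum>\<rho>\<in>?R. signof \<rho> * ((\<Prod>i\<in>X. E i (\<rho> i) (\<pi> i)) * (\<Prod>i\<in>{0..<?n} - X. E i (\<rho> i) i)))"
    proof (intro sum.cong refl arg_cong2[where f = "(*)"])
      fix \<rho>
      have "(\<Prod>i = 0..<?n. E i (\<rho> i) (\<pi> i)) = (\<Prod>i\<in>{0..<?n} - X. E i (\<rho> i) (\<pi> i)) * (\<Prod>i\<in>X. E i (\<rho> i) (\<pi> i))"
        using X(1) by (intro prod.subset_diff) auto
      also have "(\<Prod>i\<in>{0..<?n} - X. E i (\<rho> i) (\<pi> i)) = (\<Prod>i\<in>{0..<?n} - X. E i (\<rho> i) i)"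
        using permutes_not_in[OF \<pi>] by (intro prod.cong) auto
      finally show "(\<Prod>i = 0..<?n. E i (\<rho> i) (\<pi> i)) = (\<Prod>i\<in>X. E i (\<rho> i) (\<pi> i)) * (\<Prod>i\<in>{0..<?n} - X. E i (\<rho> i) i)"
        by (simp add: mult.commute)
    qed
    finally show ?thesis .
  qed
  have zero: "(\<Sum>\<pi>\<in>?P. of_int (sign \<pi>) * (\<Prod>i\<in>X. E i (\<rho> i) (\<pi> i))) = 0" if \<rho>: "\<rho> permutes {0..<?n}" for \<rho>
  proof -
    have "(\<Sum>\<pi>\<in>?P. of_int (sign \<pi>) * (\<Prod>i\<in>X. E i (\<rho> i) (\<pi> i))) =
      (\<Sum>\<pi>\<in>?P. of_int (sign \<pi>) * (\<Prod>i\<in>X. \<Sum>q<a. d (\<rho> i) i q * A $$ (z (\<pi> i) - 1, q)))"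
    proof (intro sum.cong refl arg_cong2[where f = "(*)"] prod.cong E_eq)
      fix \<pi> i assume "\<pi> \<in> ?P" "i \<in> X"
      then have "\<pi> i \<in> X"
        using permutes_in_image[of \<pi> X i] by simp
      then show "\<rho> i < ?n" "\<pi> i < ?n"
        using X(1) permutes_in_image[OF \<rho>, of i] \<open>i \<in> X\<close> by auto
    qed
    also have "\<dots> = 0"
      by (rule alternating_sum_vanishes[OF finX X(2)])
    finally show ?thesis .
  qed
  have "(\<Sum>\<pi>\<in>?P. signof \<pi> * det (paired_minors_mat A (A * C) a b (z \<circ> \<pi>))) =
    (\<Sum>\<pi>\<in>?P. \<Sum>\<rho>\<in>?R. (signof \<rho> * (\<Prod>i\<in>{0..<?n} - X. E i (\<rho> i) i)) * (of_int (sign \<pi>) * (\<Prod>i\<in>X. E i (\<rho> i) (\<pi> i))))"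
    by (intro sum.cong refl) (simp add: det sum_distrib_left mult_ac)
  also have "\<dots> = (\<Sum>\<rho>\<in>?R. (signof \<rho> * (\<Prod>i\<in>{0..<?n} - X. E i (\<rho> i) i)) *
     (\<Sum>\<pi>\<in>?P. of_int (sign \<pi>) * (\<Prod>i\<in>X. E i (\<rho> i) (\<pi> i))))"
    by (subst sum.swap) (simp add: sum_distrib_left)
  also have "\<dots> = 0"
    using zero by simp
  finally show ?thesis .
qed

text \<open>
  Positions below \<open>a\<close> form the first column and the later ones the second. The rearrangement
  \<open>P\<close> of the first column loses some positions with small values and gains equally many with
  large values.
\<close>

lemma exchange_increases_weight:
  fixes v :: "nat \<Rightarrow> nat"
  assumes P: "P \<subseteq> {0..<a + b}" "card P = a" "P \<noteq> {0..<a}" "{0..<c} \<subseteq> P" "P \<inter> {a + c<..} = {}"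
    and high: "\<And>l. c \<le> l \<Longrightarrow> l < a \<Longrightarrow> v l < y" and low: "\<And>l. a \<le> l \<Longrightarrow> l \<le> a + c \<Longrightarrow> y \<le> v l"
  shows "(\<Sum>l<a. v l) < (\<Sum>l\<in>P. v l)"
proof -
  have finP: "finite P"
    using P(1) finite_subset by blast
  let ?A = "{0..<a}"
  have "card (?A - P) + card (?A \<inter> P) = card ?A" "card (P - ?A) + card (?A \<inter> P) = card P"
    using finP card_Int_Diff[of ?A P] card_Int_Diff[of P ?A] by (simp_all add: Int_commute)
  then have card_eq: "card (P - ?A) = card (?A - P)"
    using P(2) by simp
  have "?A - P \<noteq> {}"
    using P(2,3) finP card_subset_eq[of P ?A] by auto
  then have "(\<Sum>l\<in>?A - P. v l) < (\<Sum>l\<in>?A - P. y)"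
  proof (intro sum_strict_mono)
    fix l assume "l \<in> ?A - P"
    moreover have "c \<le> l"
      using P(4) calculation by (meson Diff_iff atLeastLessThan_iff le0 not_le_imp_less subsetD)
    ultimately show "v l < y"
      using high by auto
  qed auto
  also have "\<dots> = (\<Sum>l\<in>P - ?A. y)"
    by (simp add: card_eq)
  also have "\<dots> \<le> (\<Sum>l\<in>P - ?A. v l)"
  proof (intro sum_mono low)
    fix l assume "l \<in> P - ?A"
    then show "a \<le> l" "l \<le> a + c"
      using P(5) by (auto simp: not_le)
  qed
  finally have "(\<Sum>l\<in>?A - P. v l) < (\<Sum>l\<in>P - ?A. v l)" .
  moreover have "(\<Sum>l<a. v l) = (\<Sum>l\<in>?A - P. v l) + (\<Sum>l\<in>?A \<inter> P. v l)"
    by (subst sum.Int_Diff[of ?A _ P, unfolded atLeast0LessThan]) (auto simp: atLeast0LessThan)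
  moreover have "(\<Sum>l\<in>P. v l) = (\<Sum>l\<in>P - ?A. v l) + (\<Sum>l\<in>?A \<inter> P. v l)"
    using finP by (subst sum.Int_Diff[of P _ ?A]) (auto simp: Int_commute)
  ultimately show ?thesis by simp
qed

text \<open>
  Row \<open>c\<close> violates the dominance of \<open>\<sigma>\<close> over \<open>\<tau>\<close>. Written one after the other, \<open>\<sigma>\<close> and
  \<open>\<tau>\<close> contain at the consecutive positions from \<open>c\<close> to \<open>a + c\<close> the \<open>a + 1\<close> numbers in \<open>\<sigma>\<close>
  from row \<open>c\<close> on and in \<open>\<tau>\<close> up to row \<open>c\<close>. Each of the latter is smaller than each of the
  former. In the alternating sum over the permutations of these positions, those that permute
  the positions of \<open>\<sigma>\<close> among themselves all contribute the product of the two given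
  coordinates; their number is invertible in characteristic zero. Any other permutation moves
  smaller numbers into the first column and larger ones into the second.

  The relation is one polynomial for all matrices, and \<open>v\<close> is an arbitrary decreasing
  function that measures the exchange.
\<close>

theorem garnir_relation:
  fixes \<sigma> \<tau> :: "nat set" and v :: "nat \<Rightarrow> nat"
  assumes \<sigma>: "\<sigma> \<subseteq> {1..m}" "card \<sigma> = a" and \<tau>: "\<tau> \<subseteq> {1..m}" "card \<tau> = b" and "b \<le> a"
    and c: "c < b" "pick \<tau> c < pick \<sigma> c"
    and v: "\<And>x y. x < y \<Longrightarrow> y \<le> m \<Longrightarrow> v y < v x"
  shows "\<exists>f :: (nat set, 'k::field_char_0) mpoly.
    (\<forall>u\<in>keys f. \<exists>\<sigma>' \<tau>'. u = quad_monomial \<sigma>' \<tau>' \<and> \<sigma>' \<subseteq> {1..m} \<and> card \<sigma>' = a \<and>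
       \<tau>' \<subseteq> {1..m} \<and> card \<tau>' = b \<and> (\<Sum>x\<in>\<sigma>. v x) < (\<Sum>x\<in>\<sigma>'. v x) \<and>
       (\<Sum>x\<in>\<sigma>'. v x) + (\<Sum>x\<in>\<tau>'. v x) = (\<Sum>x\<in>\<sigma>. v x) + (\<Sum>x\<in>\<tau>. v x)) \<and>
    (\<forall>A C. A a \<in> carrier_mat m a \<longrightarrow> C \<in> carrier_mat a b \<longrightarrow> A b = A a * C \<longrightarrow>
       poly_eval (poly_var \<sigma> * poly_var \<tau> - f) (\<lambda>\<rho>. plucker_coord (A (card \<rho>)) \<rho>) = 0)"
proof -
  \<comment> \<open>The two columns in one list, and the block of positions to be permuted.\<close>
  define z where "z = (\<lambda>i. if i < a then pick \<sigma> i else pick \<tau> (i - a))"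
  define X where "X = {c..a + c}"
  have X: "X \<subseteq> {0..<a + b}" "a < card X"
    using c(1) by (auto simp: X_def)
  have finX: "finite X"
    by (simp add: X_def)
  have z_range: "z l \<in> {1..m}" if "l < a + b" for l
  proof (cases "l < a")
    case True
    then show ?thesis
      using pick_in_set_le[of l \<sigma>] \<sigma> unfolding z_def by auto
  next
    case False
    then have "pick \<tau> (l - a) \<in> \<tau>"
      using that \<tau>(2) by (intro pick_in_set_le) simp
    then show ?thesis
      using False \<tau>(1) unfolding z_def by auto
  qed
  have z_\<sigma>: "z ` {0..<a} = \<sigma>" "inj_on z {0..<a}"
  proof -
    have inj: "inj_on (pick \<sigma>) {0..<a}"
      using inj_on_pick[of \<sigma>] \<sigma>(2) by simp
    then show "inj_on z {0..<a}"
      by (simp add: z_def inj_on_def)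
    have "pick \<sigma> ` {0..<a} = \<sigma>"
      using pick_image[OF finite_subset[OF \<sigma>(1)]] \<sigma>(2) by simp
    then show "z ` {0..<a} = \<sigma>"
      by (simp add: z_def)
  qed
  have z_\<tau>: "z ` {a..<a + b} = \<tau>" "inj_on z {a..<a + b}"
  proof -
    have inj: "inj_on (pick \<tau>) {0..<b}"
      using inj_on_pick[of \<tau>] \<tau>(2) by simp
    show "inj_on z {a..<a + b}"
    proof (rule inj_onI)
      fix i j assume ij: "i \<in> {a..<a + b}" "j \<in> {a..<a + b}" "z i = z j"
      then have "pick \<tau> (i - a) = pick \<tau> (j - a)"
        by (auto simp: z_def)
      then have "i - a = j - a"
        by (rule inj_onD[OF inj]) (use ij in auto)
      then show "i = j"
        using ij by auto
    qed
    have "pick \<tau> ` {0..<b} = \<tau>"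
      using pick_image[OF finite_subset[OF \<tau>(1)]] \<tau>(2) by simp
    moreover have "z ` {a..<a + b} = pick \<tau> ` {0..<b}"
    proof -
      have "{a..<a + b} = (\<lambda>i. a + i) ` {0..<b}"
        by (simp add: image_add_atLeastLessThan add.commute)
      then have "z ` {a..<a + b} = (\<lambda>i. z (a + i)) ` {0..<b}"
        by (simp only: image_image)
      then show ?thesis
        by (simp add: z_def)
    qed
    ultimately show "z ` {a..<a + b} = \<tau>"
      by simp
  qed
  let ?P = "{\<pi>. \<pi> permutes X}"
  \<comment> \<open>The permutations that reproduce the given product.\<close>
  define H where "H = {\<pi> \<in> ?P. \<pi> ` {0..<a} = {0..<a}}"
  have finP: "finite ?P"
    using finX by (simp add: finite_permutations)
  have finH: "finite H" "H \<subseteq> ?P"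
    using finP by (auto simp: H_def)
  have "id \<in> H"
    by (simp add: H_def permutes_id)
  then have cardH: "of_nat (card H) \<noteq> (0::'k)"
    using finH(1) by auto
  have perm: "\<pi> permutes {0..<a + b}" if "\<pi> \<in> ?P" for \<pi>
    using permutes_subset[of \<pi> X "{0..<a + b}"] that X(1) by simp
  define S1 where "S1 = (\<lambda>\<pi>. (z \<circ> \<pi>) ` {0..<a})"
  define S2 where "S2 = (\<lambda>\<pi>. (\<lambda>i. z (\<pi> (a + i))) ` {0..<b})"
  have z\<pi>: "z (\<pi> i) \<in> {1..m}" if "\<pi> \<in> ?P" "i < a + b" for \<pi> i
    using permutes_in_image[OF perm[OF that(1)], of i] that(2) z_range by simp
  have S12: "S1 \<pi> \<subseteq> {1..m}" "S2 \<pi> \<subseteq> {1..m}" if "\<pi> \<in> ?P" for \<pi>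
    using z\<pi>[OF that] by (auto simp: S1_def S2_def)
  have "\<forall>\<pi>\<in>?P. \<exists>\<epsilon>::'k. (\<epsilon> \<noteq> 0 \<longrightarrow> inj_on (z \<circ> \<pi>) {0..<a}) \<and>
    (\<forall>A\<in>carrier_mat m a. row_minor A a (z \<circ> \<pi>) = \<epsilon> * plucker_coord A (S1 \<pi>))"
    using S12(1) unfolding S1_def by (intro ballI row_minor_eq_plucker_coord) blast
  then obtain \<epsilon>1 :: "(nat \<Rightarrow> nat) \<Rightarrow> 'k" where \<epsilon>1:
    "\<And>\<pi>. \<pi> \<in> ?P \<Longrightarrow> \<epsilon>1 \<pi> \<noteq> 0 \<Longrightarrow> inj_on (z \<circ> \<pi>) {0..<a}"
    "\<And>\<pi> A. \<pi> \<in> ?P \<Longrightarrow> A \<in> carrier_mat m a \<Longrightarrow> row_minor A a (z \<circ> \<pi>) = \<epsilon>1 \<pi> * plucker_coord A (S1 \<pi>)"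
    by metis
  have "\<forall>\<pi>\<in>?P. \<exists>\<epsilon>::'k. (\<epsilon> \<noteq> 0 \<longrightarrow> inj_on (\<lambda>i. z (\<pi> (a + i))) {0..<b}) \<and>
    (\<forall>A\<in>carrier_mat m b. row_minor A b (\<lambda>i. z (\<pi> (a + i))) = \<epsilon> * plucker_coord A (S2 \<pi>))"
    using S12(2) unfolding S2_def by (intro ballI row_minor_eq_plucker_coord) blast
  then obtain \<epsilon>2 :: "(nat \<Rightarrow> nat) \<Rightarrow> 'k" where \<epsilon>2:
    "\<And>\<pi>. \<pi> \<in> ?P \<Longrightarrow> \<epsilon>2 \<pi> \<noteq> 0 \<Longrightarrow> inj_on (\<lambda>i. z (\<pi> (a + i))) {0..<b}"
    "\<And>\<pi> A. \<pi> \<in> ?P \<Longrightarrow> A \<in> carrier_mat m b \<Longrightarrow>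
       row_minor A b (\<lambda>i. z (\<pi> (a + i))) = \<epsilon>2 \<pi> * plucker_coord A (S2 \<pi>)"
    by metis
  \<comment> \<open>Permutations with a repeated row in one of the minors contribute nothing and must not
    contribute a monomial.\<close>
  define T where "T = {\<pi> \<in> ?P - H. \<epsilon>1 \<pi> * \<epsilon>2 \<pi> \<noteq> 0}"
  define f where "f = (\<Sum>\<pi>\<in>T. mscale (- (signof \<pi> * \<epsilon>1 \<pi> * \<epsilon>2 \<pi>) / of_nat (card H))
     (single (quad_monomial (S1 \<pi>) (S2 \<pi>)) 1))"
  show ?thesis
  proof (intro exI[of _ f] conjI ballI allI impI)
    fix u assume "u \<in> keys f"
    then obtain \<pi> where \<pi>: "\<pi> \<in> T" and u: "u = quad_monomial (S1 \<pi>) (S2 \<pi>)"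
      using Poly_Mapping.keys_sum[of "\<lambda>\<pi>. mscale (- (signof \<pi> * \<epsilon>1 \<pi> * \<epsilon>2 \<pi>) / of_nat (card H))
        (single (quad_monomial (S1 \<pi>) (S2 \<pi>)) 1)" T] keys_mscale
      unfolding f_def by fastforce
    then have \<pi>P: "\<pi> \<in> ?P" and \<pi>H: "\<pi> ` {0..<a} \<noteq> {0..<a}"
      and inj: "inj_on (z \<circ> \<pi>) {0..<a}" "inj_on (\<lambda>i. z (\<pi> (a + i))) {0..<b}"
      using \<epsilon>1(1)[of \<pi>] \<epsilon>2(1)[of \<pi>] by (auto simp: T_def H_def)
    let ?Q = "\<pi> ` {0..<a}"
    have inj\<pi>: "inj \<pi>"
      using permutes_inj[of \<pi> X] \<pi>P by simp
    have sum_S1: "(\<Sum>x\<in>S1 \<pi>. v x) = (\<Sum>l\<in>?Q. v (z l))"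
        unfolding S1_def sum.reindex[OF inj(1)] sum.reindex[OF inj_on_subset[OF inj\<pi> subset_UNIV]]
      by (simp add: comp_def)
    have sum_S2: "(\<Sum>x\<in>S2 \<pi>. v x) = (\<Sum>i<b. v (z (\<pi> (a + i))))"
      unfolding S2_def using inj(2) by (simp add: sum.reindex atLeast0LessThan)
    have sum_\<sigma>: "(\<Sum>x\<in>\<sigma>. v x) = (\<Sum>l<a. v (z l))"
      unfolding z_\<sigma>(1)[symmetric] using z_\<sigma>(2) by (simp add: sum.reindex atLeast0LessThan)
    have shift: "(\<Sum>l\<in>{a..<a + b}. g l) = (\<Sum>i<b. g (a + i))" for g :: "nat \<Rightarrow> nat"
      using sum.shift_bounds_nat_ivl[of g 0 a b] by (simp add: atLeast0LessThan add.commute)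
    have sum_\<tau>: "(\<Sum>x\<in>\<tau>. v x) = (\<Sum>i<b. v (z (a + i)))"
      unfolding z_\<tau>(1)[symmetric] using z_\<tau>(2) by (simp add: sum.reindex shift)
    have split: "(\<Sum>l<a + b. g l) = (\<Sum>l<a. g l) + (\<Sum>i<b. g (a + i))" for g :: "nat \<Rightarrow> nat"
      using sum.atLeastLessThan_concat[of 0 a "a + b" g] by (simp add: shift atLeast0LessThan)
    have less: "(\<Sum>x\<in>\<sigma>. v x) < (\<Sum>x\<in>S1 \<pi>. v x)"
      unfolding sum_\<sigma> sum_S1
    proof (rule exchange_increases_weight[where b = b and c = c and y = "v (pick \<tau> c)"])
      show "?Q \<subseteq> {0..<a + b}"
        using image_mono[of "{0..<a}" "{0..<a + b}" \<pi>] permutes_image[OF perm[OF \<pi>P]] by simp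
      show "card ?Q = a"
        using card_image[OF inj_on_subset[OF inj\<pi>, of "{0..<a}"]] by simp
      show "?Q \<noteq> {0..<a}"
        by (rule \<pi>H)
      have fixed: "\<pi> l = l" if "l \<notin> X" for l
        using permutes_not_in[of \<pi> X l] \<pi>P that by simp
      show "{0..<c} \<subseteq> ?Q"
      proof
        fix l assume "l \<in> {0..<c}"
        then have "\<pi> l = l" "l < a"
          using fixed[of l] c(1) \<open>b \<le> a\<close> by (auto simp: X_def)
        then show "l \<in> ?Q"
          by (metis atLeastLessThan_iff image_eqI le0)
      qed
      show "?Q \<inter> {a + c<..} = {}"
      proof (rule ccontr)
        assume "?Q \<inter> {a + c<..} \<noteq> {}"
        then obtain i where i: "i < a" "a + c < \<pi> i"
          by auto
        then have "\<pi> (\<pi> i) = \<pi> i"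
          using fixed[of "\<pi> i"] by (auto simp: X_def)
        then have "\<pi> i = i"
          using inj\<pi> by (simp add: inj_eq)
        then show False
          using i by simp
      qed
      have mono: "pick \<rho> i \<le> pick \<rho> j" if "i \<le> j" "j < card \<rho>" for \<rho> i j
        using pick_mono_le[of j \<rho> i] that by (cases "i = j") auto
      show "v (z l) < v (pick \<tau> c)" if "c \<le> l" "l < a" for l
      proof (rule v)
        show "pick \<tau> c < z l"
          using mono[of c l \<sigma>] c(2) that \<sigma>(2) by (simp add: z_def)
        show "z l \<le> m"
          using z_range[of l] that by simp
      qed
      show "v (pick \<tau> c) \<le> v (z l)" if "a \<le> l" "l \<le> a + c" for l
      proof -
        have "z l \<le> pick \<tau> c"
          using mono[of "l - a" c \<tau>] that \<tau>(2) c(1) by (simp add: z_def)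
        moreover have "pick \<tau> c \<le> m"
          using pick_in_set_le[of c \<tau>] \<tau> c(1) by auto
        ultimately show ?thesis
          using v[of "z l" "pick \<tau> c"] by (cases "z l = pick \<tau> c") auto
      qed
    qed
    have total: "(\<Sum>x\<in>S1 \<pi>. v x) + (\<Sum>x\<in>S2 \<pi>. v x) = (\<Sum>x\<in>\<sigma>. v x) + (\<Sum>x\<in>\<tau>. v x)"
    proof -
      have "(\<Sum>l\<in>?Q. v (z l)) = (\<Sum>l<a. v (z (\<pi> l)))"
        using inj_on_subset[OF inj\<pi>, of "{0..<a}"] by (simp add: sum.reindex atLeast0LessThan)
      then have "(\<Sum>x\<in>S1 \<pi>. v x) + (\<Sum>x\<in>S2 \<pi>. v x) = (\<Sum>l<a + b. v (z (\<pi> l)))"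
        by (simp add: sum_S1 sum_S2 split)
      also have "\<dots> = (\<Sum>l<a + b. v (z l))"
        using sum.permute[OF perm[OF \<pi>P], of "\<lambda>l. v (z l)"] by (simp add: atLeast0LessThan comp_def)
      also have "\<dots> = (\<Sum>x\<in>\<sigma>. v x) + (\<Sum>x\<in>\<tau>. v x)"
        by (simp add: split sum_\<sigma> sum_\<tau>)
      finally show ?thesis .
    qed
    have "card (S1 \<pi>) = a" "card (S2 \<pi>) = b"
      using card_image[OF inj(1)] card_image[OF inj(2)] by (simp_all add: S1_def S2_def)
    then show "\<exists>\<sigma>' \<tau>'. u = quad_monomial \<sigma>' \<tau>' \<and> \<sigma>' \<subseteq> {1..m} \<and> card \<sigma>' = a \<and>
       \<tau>' \<subseteq> {1..m} \<and> card \<tau>' = b \<and> (\<Sum>x\<in>\<sigma>. v x) < (\<Sum>x\<in>\<sigma>'. v x) \<and>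
       (\<Sum>x\<in>\<sigma>'. v x) + (\<Sum>x\<in>\<tau>'. v x) = (\<Sum>x\<in>\<sigma>. v x) + (\<Sum>x\<in>\<tau>. v x)"
      using u S12[OF \<pi>P] less total by blast
  next
    fix A :: "nat \<Rightarrow> 'k mat" and C
    assume A: "A a \<in> carrier_mat m a" and C: "C \<in> carrier_mat a b" and AC: "A b = A a * C"
    have Ab: "A b \<in> carrier_mat m b"
      using A C AC by simp
    let ?x = "\<lambda>\<rho>. plucker_coord (A (card \<rho>)) \<rho>"
    let ?D = "\<lambda>\<pi>. det (paired_minors_mat (A a) (A a * C) a b (z \<circ> \<pi>))"
    have D_eq: "?D \<pi> = \<epsilon>1 \<pi> * \<epsilon>2 \<pi> * (?x (S1 \<pi>) * ?x (S2 \<pi>))" if "\<pi> \<in> ?P" for \<pi>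
    proof -
      have D: "?D \<pi> = (\<epsilon>1 \<pi> * plucker_coord (A a) (S1 \<pi>)) * (\<epsilon>2 \<pi> * plucker_coord (A b) (S2 \<pi>))"
        using \<epsilon>1(2)[OF that A] \<epsilon>2(2)[OF that Ab] by (simp add: det_paired_minors comp_def AC)
      show ?thesis
      proof (cases "\<epsilon>1 \<pi> * \<epsilon>2 \<pi> = 0")
        case True
        then show ?thesis
          using D by auto
      next
        case False
        then have "card (S1 \<pi>) = a" "card (S2 \<pi>) = b"
          using \<epsilon>1(1)[OF that] \<epsilon>2(1)[OF that] card_image by (fastforce simp: S1_def S2_def)+
        then show ?thesis
          using D by simp
      qed
    qed
    have D_id: "det (paired_minors_mat (A a) (A a * C) a b z) = ?x \<sigma> * ?x \<tau>"
    proof -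
      have "row_minor (A a) a z = plucker_coord (A a) \<sigma>"
        unfolding plucker_coord_eq_row_minor[OF A \<sigma>] by (rule row_minor_cong) (simp add: z_def)
      moreover have "row_minor (A b) b (\<lambda>i. z (a + i)) = plucker_coord (A b) \<tau>"
        unfolding plucker_coord_eq_row_minor[OF Ab \<tau>] by (rule row_minor_cong) (simp add: z_def)
      ultimately show ?thesis
        using \<sigma>(2) \<tau>(2) by (simp add: det_paired_minors AC)
    qed
    have "0 = (\<Sum>\<pi>\<in>?P. signof \<pi> * ?D \<pi>)"
      using garnir_sum_vanishes[OF A C X z_range] by simp
    also have "\<dots> = (\<Sum>\<pi>\<in>?P - H. signof \<pi> * ?D \<pi>) + (\<Sum>\<pi>\<in>H. signof \<pi> * ?D \<pi>)"
      by (rule sum.subset_diff[OF finH(2) finP])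
    also have "(\<Sum>\<pi>\<in>H. signof \<pi> * ?D \<pi>) = (\<Sum>\<pi>\<in>H. ?x \<sigma> * ?x \<tau>)"
    proof (rule sum.cong[OF refl])
      fix \<pi> assume "\<pi> \<in> H"
      then have "\<pi> permutes {0..<a + b}" "\<pi> ` {0..<a} = {0..<a}"
        using perm[of \<pi>] by (simp_all add: H_def)
      from det_paired_minors_permute[OF this] have "?D \<pi> = signof \<pi> * (?x \<sigma> * ?x \<tau>)"
        unfolding D_id[symmetric] .
      then show "signof \<pi> * ?D \<pi> = ?x \<sigma> * ?x \<tau>"
        by (simp add: sign_def)
    qed
    also have "(\<Sum>\<pi>\<in>?P - H. signof \<pi> * ?D \<pi>) =
        (\<Sum>\<pi>\<in>T. signof \<pi> * (\<epsilon>1 \<pi> * \<epsilon>2 \<pi> * (?x (S1 \<pi>) * ?x (S2 \<pi>))))"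
      using finP D_eq by (intro sum.mono_neutral_cong_right) (auto simp: T_def)
    finally have eq: "of_nat (card H) * (?x \<sigma> * ?x \<tau>) =
        - (\<Sum>\<pi>\<in>T. signof \<pi> * (\<epsilon>1 \<pi> * \<epsilon>2 \<pi> * (?x (S1 \<pi>) * ?x (S2 \<pi>))))"
      by (simp add: eq_neg_iff_add_eq_0 add.commute)
    have "of_nat (card H) * poly_eval f ?x = of_nat (card H) * (?x \<sigma> * ?x \<tau>)"
      unfolding eq f_def poly_eval_sum poly_eval_mscale poly_eval_single monomial_eval_quad sum_distrib_left sum_negf[symmetric]
      using cardH by (intro sum.cong refl) simp
    then have "poly_eval f ?x = ?x \<sigma> * ?x \<tau>"
      using cardH by simp
    then show "poly_eval (poly_var \<sigma> * poly_var \<tau> - f) ?x = 0"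
      by (simp add: poly_eval_diff var_mult_var poly_eval_single monomial_eval_quad)
  qed
qed

section \<open>Straightening in the Pluecker ideals\<close>

text \<open>
  Small entries have large values. The offset makes the values so nearly equal that a longer
  column always has a larger value than a shorter one (\<open>column_value_card\<close>).
\<close>

definition entry_value :: "nat \<Rightarrow> nat \<Rightarrow> nat" where
  "entry_value m x = m * m + m + 1 - x"

definition column_value :: "nat \<Rightarrow> nat set \<Rightarrow> nat" where
  "column_value m \<sigma> = (\<Sum>x\<in>\<sigma>. entry_value m x)"

lemma entry_value_strict: "x < y \<Longrightarrow> y \<le> m \<Longrightarrow> entry_value m y < entry_value m x"
  by (simp add: entry_value_def)

lemma entry_value_pos: "x \<le> m \<Longrightarrow> 0 < entry_value m x"
  by (simp add: entry_value_def)

lemma column_value_card: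
  assumes \<sigma>: "\<sigma> \<subseteq> {1..m}" and \<tau>: "\<tau> \<subseteq> {1..m}" and le: "column_value m \<tau> \<le> column_value m \<sigma>"
  shows "card \<tau> \<le> card \<sigma>"
proof (rule ccontr)
  assume "\<not> card \<tau> \<le> card \<sigma>"
  then have less: "card \<sigma> + 1 \<le> card \<tau>"
    by simp
  have "card \<sigma> \<le> m"
    using card_mono[OF _ \<sigma>] by simp
  then have "card \<sigma> * m \<le> m * m"
    by simp
  have "column_value m \<sigma> \<le> (\<Sum>x\<in>\<sigma>. m * m + m)"
    unfolding column_value_def entry_value_def by (intro sum_mono) (use \<sigma> in fastforce)
  also have "\<dots> = card \<sigma> * (m * m) + card \<sigma> * m"
    by (simp add: algebra_simps)
  also have "\<dots> < (card \<sigma> + 1) * (m * m + 1)"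
    using \<open>card \<sigma> * m \<le> m * m\<close> unfolding add_mult_distrib add_mult_distrib2 by linarith
  also have "\<dots> \<le> card \<tau> * (m * m + 1)"
    using less by (rule mult_le_mono1)
  also have "\<dots> = (\<Sum>x\<in>\<tau>. m * m + 1)"
    by simp
  also have "\<dots> \<le> column_value m \<tau>"
    unfolding column_value_def entry_value_def by (intro sum_mono) (use \<tau> in fastforce)
  finally show False
    using le by simp
qed

lemma squares_spread:
  fixes x y x' y' :: nat
  assumes "x' + y' = x + y" "y \<le> x" "x < x'"
  shows "x\<^sup>2 + y\<^sup>2 < x'\<^sup>2 + y'\<^sup>2"
proof -
  obtain d where d: "x' = x + d" "0 < d"
    using assms(3) less_imp_add_positive by blast
  then have y: "y = y' + d"
    using assms(1) by simp
  have "x'\<^sup>2 + y'\<^sup>2 = x\<^sup>2 + y\<^sup>2 + (2 * d * (x - y) + 2 * d * d)"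
  proof -
    obtain e where "x = y + e"
      using assms(2) le_Suc_ex by blast
    then show ?thesis
      unfolding d(1) y by (simp add: power2_eq_square algebra_simps)
  qed
  moreover have "0 < 2 * d * d"
    using d(2) by simp
  ultimately show ?thesis by simp
qed

lemma multidegree_quad:
  "multidegree (quad_monomial \<sigma> \<tau>) i = of_bool (card \<sigma> = i) + of_bool (card \<tau> = i)"
proof (cases "\<sigma> = \<tau>")
  case True
  have "{\<rho> \<in> keys (quad_monomial \<sigma> \<sigma>). card \<rho> = i} = (if card \<sigma> = i then {\<sigma>} else {})"
    by (auto simp: keys_quad_monomial)
  then show ?thesis
    using True by (simp add: multidegree_def quad_monomial_def lookup_add)
next
  case False
  have "{\<rho> \<in> keys (quad_monomial \<sigma> \<tau>). card \<rho> = i} =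
      (if card \<sigma> = i then {\<sigma>} else {}) \<union> (if card \<tau> = i then {\<tau>} else {})"
    by (auto simp: keys_quad_monomial)
  then show ?thesis
    using False by (auto simp: multidegree_def quad_monomial_def lookup_add lookup_single)
qed

lemma quad_monomial_commute: "quad_monomial x y = quad_monomial y x"
  by (simp add: quad_monomial_def add.commute)

text \<open>
  The terms of \<open>f\<close> may replace the product of the variables \<open>\<sigma>\<close> and \<open>\<tau>\<close>. The values of the
  two columns keep their sum in an exchange, so the sum of squares grows when the larger value
  becomes still larger.
\<close>

definition straightened_quadric :: "nat \<Rightarrow> nat set \<Rightarrow> nat set \<Rightarrow> (nat set, 'k::field) mpoly \<Rightarrow> bool" where
  "straightened_quadric m \<sigma> \<tau> f \<longleftrightarrow> (\<forall>u\<in>keys f. \<exists>\<sigma>' \<tau>'. u = quad_monomial \<sigma>' \<tau>' \<and> \<sigma>' \<subseteq> {1..m} \<and> \<tau>' \<subseteq> {1..m} \<and>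
     {card \<sigma>', card \<tau>'} \<subseteq> {card \<sigma>, card \<tau>} \<and> multidegree u = multidegree (quad_monomial \<sigma> \<tau>) \<and>
     (column_value m \<sigma>)\<^sup>2 + (column_value m \<tau>)\<^sup>2 < (column_value m \<sigma>')\<^sup>2 + (column_value m \<tau>')\<^sup>2)"

text \<open>
  The columns of the matrix \<open>A b\<close> are combinations of those of \<open>A a\<close> for \<open>b \<le> a\<close>, as for bases
  of the members of a flag.
\<close>

definition nested_matrices :: "nat \<Rightarrow> nat set \<Rightarrow> (nat \<Rightarrow> 'k::field mat) \<Rightarrow> bool" where
  "nested_matrices m K A \<longleftrightarrow> (\<forall>a\<in>K. A a \<in> carrier_mat m a) \<and>
     (\<forall>a\<in>K. \<forall>b\<in>K. b \<le> a \<longrightarrow> (\<exists>C\<in>carrier_mat a b. A b = A a * C))"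

abbreviation plucker_point :: "(nat \<Rightarrow> 'k::comm_ring_1 mat) \<Rightarrow> nat set \<Rightarrow> 'k" where
  "plucker_point A \<equiv> \<lambda>\<rho>. plucker_coord (A (card \<rho>)) \<rho>"

text \<open>
  The column with the larger value is at least as long as the other one and takes the first
  place in the Garnir relation.
\<close>

lemma plucker_straightening_ordered:
  assumes \<sigma>: "\<sigma> \<subseteq> {1..m}" and \<tau>: "\<tau> \<subseteq> {1..m}" and nd: "\<not> dominates \<sigma> \<tau>"
    and le: "column_value m \<tau> \<le> column_value m \<sigma>"
  shows "\<exists>f :: (nat set, 'k::field_char_0) mpoly. straightened_quadric m \<sigma> \<tau> f \<and>
    (\<forall>A. nested_matrices m {card \<sigma>, card \<tau>} A \<longrightarrow>
       poly_eval (poly_var \<sigma> * poly_var \<tau> - f) (plucker_point A) = 0)"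
proof -
  have card_le: "card \<tau> \<le> card \<sigma>"
    by (rule column_value_card[OF \<sigma> \<tau> le])
  have "finite \<sigma>" "finite \<tau>"
    using \<sigma> \<tau> finite_subset by blast+
  then obtain c where c: "c < card \<tau>" "pick \<tau> c < pick \<sigma> c"
    using nd card_le dominates_iff_pick[of \<sigma> \<tau>] by (auto simp: not_le)
  obtain f :: "(nat set, 'k) mpoly" where f:
    "\<forall>u\<in>keys f. \<exists>\<sigma>' \<tau>'. u = quad_monomial \<sigma>' \<tau>' \<and> \<sigma>' \<subseteq> {1..m} \<and> card \<sigma>' = card \<sigma> \<and>
       \<tau>' \<subseteq> {1..m} \<and> card \<tau>' = card \<tau> \<and> column_value m \<sigma> < column_value m \<sigma>' \<and>
       column_value m \<sigma>' + column_value m \<tau>' = column_value m \<sigma> + column_value m \<tau>"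
    "\<forall>A C. A (card \<sigma>) \<in> carrier_mat m (card \<sigma>) \<longrightarrow> C \<in> carrier_mat (card \<sigma>) (card \<tau>) \<longrightarrow>
       A (card \<tau>) = A (card \<sigma>) * C \<longrightarrow> poly_eval (poly_var \<sigma> * poly_var \<tau> - f) (plucker_point A) = 0"
    using garnir_relation[where v = "entry_value m", OF \<sigma> refl \<tau> refl card_le c entry_value_strict,
      folded column_value_def]
    by blast
  have "straightened_quadric m \<sigma> \<tau> f"
    unfolding straightened_quadric_def
  proof
    fix u assume "u \<in> keys f"
    then obtain \<sigma>' \<tau>' where u: "u = quad_monomial \<sigma>' \<tau>'" "\<sigma>' \<subseteq> {1..m}" "card \<sigma>' = card \<sigma>" "\<tau>' \<subseteq> {1..m}"
      "card \<tau>' = card \<tau>" "column_value m \<sigma> < column_value m \<sigma>'"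
      "column_value m \<sigma>' + column_value m \<tau>' = column_value m \<sigma> + column_value m \<tau>"
      using f(1) by blast
    show "\<exists>\<sigma>' \<tau>'. u = quad_monomial \<sigma>' \<tau>' \<and> \<sigma>' \<subseteq> {1..m} \<and> \<tau>' \<subseteq> {1..m} \<and>
     {card \<sigma>', card \<tau>'} \<subseteq> {card \<sigma>, card \<tau>} \<and> multidegree u = multidegree (quad_monomial \<sigma> \<tau>) \<and>
     (column_value m \<sigma>)\<^sup>2 + (column_value m \<tau>)\<^sup>2 < (column_value m \<sigma>')\<^sup>2 + (column_value m \<tau>')\<^sup>2"
      using u squares_spread[OF u(7) le u(6)]
      by (intro exI[of _ \<sigma>'] exI[of _ \<tau>']) (simp add: fun_eq_iff multidegree_quad)
  qed
  moreover have "poly_eval (poly_var \<sigma> * poly_var \<tau> - f) (plucker_point A) = 0"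
    if A: "nested_matrices m {card \<sigma>, card \<tau>} A" for A
  proof -
    have "A (card \<sigma>) \<in> carrier_mat m (card \<sigma>)"
      using A by (simp add: nested_matrices_def)
    moreover obtain C where "C \<in> carrier_mat (card \<sigma>) (card \<tau>)" "A (card \<tau>) = A (card \<sigma>) * C"
      using A card_le unfolding nested_matrices_def by blast
    ultimately show ?thesis
      using f(2) by blast
  qed
  ultimately show ?thesis by blast
qed

lemma plucker_straightening:
  assumes \<sigma>: "\<sigma> \<subseteq> {1..m}" and \<tau>: "\<tau> \<subseteq> {1..m}" and nc: "\<not> comparable \<sigma> \<tau>"
  shows "\<exists>f :: (nat set, 'k::field_char_0) mpoly. straightened_quadric m \<sigma> \<tau> f \<and>
    (\<forall>A. nested_matrices m {card \<sigma>, card \<tau>} A \<longrightarrow>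
       poly_eval (poly_var \<sigma> * poly_var \<tau> - f) (plucker_point A) = 0)"
proof (cases "column_value m \<tau> \<le> column_value m \<sigma>")
  case True
  then show ?thesis
    using nc by (intro plucker_straightening_ordered[OF \<sigma> \<tau>]) (auto simp: comparable_def)
next
  case False
  then have "\<exists>f :: (nat set, 'k) mpoly. straightened_quadric m \<tau> \<sigma> f \<and>
    (\<forall>A. nested_matrices m {card \<tau>, card \<sigma>} A \<longrightarrow>
       poly_eval (poly_var \<tau> * poly_var \<sigma> - f) (plucker_point A) = 0)"
    using nc by (intro plucker_straightening_ordered[OF \<tau> \<sigma>]) (auto simp: comparable_def)
  then show ?thesis
    unfolding straightened_quadric_def
    by (simp only: quad_monomial_commute[of \<tau> \<sigma>] mult.commute[of "poly_var \<tau>" "poly_var \<sigma>"]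
        insert_commute[of "card \<tau>" "card \<sigma>"] add.commute[of "(column_value m \<tau>)\<^sup>2" "(column_value m \<sigma>)\<^sup>2"])
qed

lemma poly_eval_cong:
  assumes "\<And>a v. a \<in> keys f \<Longrightarrow> v \<in> keys a \<Longrightarrow> x v = y v"
  shows "poly_eval f x = poly_eval f y"
  unfolding poly_eval_def using assms by (intro sum.cong refl arg_cong2[where f = "(*)"] prod.cong) auto

definition curve_mat :: "nat \<Rightarrow> nat \<Rightarrow> 'k::field \<Rightarrow> nat \<Rightarrow> 'k mat" where
  "curve_mat m B t i = mat m i (\<lambda>(r, c). t ^ (B ^ (Suc r * Suc m + c)))"

lemma curve_mat_carrier [simp]: "curve_mat m B t i \<in> carrier_mat m i"
  by (simp add: curve_mat_def)

lemma plucker_coord_curve_mat: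
  assumes \<sigma>: "\<sigma> \<subseteq> {1..m}"
  shows "plucker_coord (curve_mat m B t (card \<sigma>)) \<sigma> = poly (minor_poly B (Suc m) \<sigma>) (t :: 'k::field)"
proof -
  let ?k = "card \<sigma>"
  have "poly (minor_poly B (Suc m) \<sigma>) t = row_minor (curve_mat m B t ?k) ?k (pick \<sigma>)"
    unfolding minor_poly_def row_minor_def
  proof (rule poly_det_cong[where n = ?k])
    fix i j assume ij: "i < ?k" "j < ?k"
    have "pick \<sigma> i \<in> {1..m}"
      using pick_in_set_le[OF ij(1)] \<sigma> by blast
    then have p: "pick \<sigma> i - 1 < m" "Suc (pick \<sigma> i - 1) = pick \<sigma> i"
      by auto
    then show "poly (mat ?k ?k (\<lambda>(i, j). monom 1 (B ^ (pick \<sigma> i * Suc m + j))) $$ (i, j)) t =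
        mat ?k ?k (\<lambda>(i, j). curve_mat m B t ?k $$ (pick \<sigma> i - 1, j)) $$ (i, j)"
      using ij p(1) unfolding curve_mat_def
      by (simp only: index_mat case_prod_conv poly_monom p(2)) simp
  qed auto
  then show ?thesis
    using plucker_coord_eq_row_minor[OF curve_mat_carrier \<sigma> refl] by simp
qed

lemma col_space_curve_mat_mono:
  assumes "i \<le> j"
  shows "vec_space.col_space m (curve_mat m B t i) \<subseteq> vec_space.col_space m (curve_mat m B (t :: 'k::field) j)"
proof -
  interpret vec_space "TYPE('k)" m .
  have "set (cols (curve_mat m B t i)) \<subseteq> set (cols (curve_mat m B t j))"
  proof
    fix v assume "v \<in> set (cols (curve_mat m B t i))"
    then obtain c where c: "c < i" "v = col (curve_mat m B t i) c"
      by (auto simp: cols_def curve_mat_def)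
    have "col (curve_mat m B t i) c = col (curve_mat m B t j) c"
      using c(1) assms by (intro eq_vecI) (auto simp: curve_mat_def)
    then show "v \<in> set (cols (curve_mat m B t j))"
      using c assms by (auto simp: cols_def curve_mat_def)
  qed
  then show ?thesis
    unfolding col_space_def by (rule span_is_monotone)
qed

lemma col_space_in_grassmannian:
  fixes A :: "'k::field mat"
  assumes A: "A \<in> carrier_mat m i" and ne: "plucker_coord A \<sigma> \<noteq> 0"
  shows "vec_space.col_space m A \<in> grassmannian i m"
    "vectorspace.dim class_ring ((module_vec TYPE('k) m)\<lparr>carrier := vec_space.col_space m A\<rparr>) = i"
proof -
  interpret vec_space "TYPE('k)" m .
  have "i \<le> rank A"
    using rank_gt_minor[OF A, of "{r. Suc r \<in> \<sigma>}" UNIV] ne by (simp add: plucker_coord_def)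
  then have "rank A = i"
    using rank_le_nc[OF A] by simp
  then show dim: "vectorspace.dim class_ring ((module_vec TYPE('k) m)\<lparr>carrier := col_space A\<rparr>) = i"
    by (simp add: rank_def col_space_def)
  have "set (cols A) \<subseteq> carrier_vec m"
    using cols_dim[of A] carrier_matD(1)[OF A] by simp
  then have "VectorSpace.subspace class_ring (col_space A) V"
    unfolding col_space_def by (rule span_is_subspace)
  then show "col_space A \<in> grassmannian i m"
    using dim by (simp add: grassmannian_def)
qed

text \<open>
  The coordinates of the initial subsets do not vanish, so the first \<open>i\<close> columns are
  independent for all \<open>i\<close>.
\<close>

lemma curve_is_partial_flag:
  fixes t :: "'k::field"
  assumes t: "t \<noteq> 0" and n: "0 < n" "n < m"
    and ne: "\<And>i. i \<in> {1..n} \<Longrightarrow> poly (minor_poly B (Suc m) {1..i}) t \<noteq> 0"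
  shows "(\<lambda>i. vec_space.col_space m (curve_mat m B t i)) \<in> partial_flags n m"
proof -
  interpret vec_space "TYPE('k)" m .
  let ?A = "curve_mat m B t"
  let ?V = "\<lambda>i. col_space (?A i)"
  have coord: "plucker_coord (?A i) {1..i} \<noteq> 0" if "i \<in> {1..n}" for i
    using plucker_coord_curve_mat[of "{1..i}" m B t] ne[OF that] that n by simp
  note gr = col_space_in_grassmannian[OF curve_mat_carrier coord]
  have cols: "set (cols (?A i)) \<subseteq> carrier_vec m" for i
    using cols_dim[of "?A i"] by (simp add: curve_mat_def)
  have "0\<^sub>v m \<in> ?V 1"
    unfolding col_space_eq[OF curve_mat_carrier]
    by (auto simp: curve_mat_def intro!: bexI[of _ "0\<^sub>v 1"])
  moreover have "?V 1 \<noteq> {0\<^sub>v m}"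
  proof
    assume V1: "?V 1 = {0\<^sub>v m}"
    have "col (?A 1) 0 \<in> set (cols (?A 1))"
      by (simp add: cols_def curve_mat_def)
    then have "col (?A 1) 0 \<in> ?V 1"
      unfolding col_space_def using in_own_span[OF cols] by blast
    then have "col (?A 1) 0 $ 0 = 0"
      using V1 n by simp
    then show False
      using t n by (simp add: curve_mat_def)
  qed
  moreover have "?V i \<subset> ?V (Suc i)" if "i \<in> {1..<n}" for i
  proof
    show "?V i \<subseteq> ?V (Suc i)"
      by (rule col_space_curve_mat_mono) simp
    show "?V i \<noteq> ?V (Suc i)"
      using gr(2)[of i] gr(2)[of "Suc i"] that by auto
  qed
  moreover have "?V n \<subset> carrier_vec m"
  proof
    show "?V n \<subseteq> carrier_vec m"
      unfolding col_space_def using span_is_subset2[OF cols] by simp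
    show "?V n \<noteq> carrier_vec m"
    proof
      assume eq: "?V n = carrier_vec m"
      have whole: "V\<lparr>carrier := carrier_vec m\<rparr> = V"
        by (simp add: module_vec_def)
      have "n \<in> {1..n}"
        using n by simp
      from gr(2)[OF this] have "vectorspace.dim class_ring V = n"
        unfolding eq whole .
      then show False
        using n dim_is_n by simp
    qed
  qed
  ultimately show ?thesis
    using gr(1) unfolding partial_flags_def by auto
qed

lemma col_space_factor:
  fixes A B :: "'k::field mat"
  assumes A: "A \<in> carrier_mat m a" and B: "B \<in> carrier_mat m b"
    and sub: "vec_space.col_space m B \<subseteq> vec_space.col_space m A"
  shows "\<exists>C\<in>carrier_mat a b. B = A * C"
proof -
  interpret vec_space "TYPE('k)" m .
  have "\<forall>j<b. \<exists>x\<in>carrier_vec a. A *\<^sub>v x = col B j"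
  proof (intro allI impI)
    fix j assume "j < b"
    then have "col B j \<in> set (cols B)"
      using B by (auto simp: cols_def)
    moreover have "set (cols B) \<subseteq> carrier_vec m"
      using cols_dim[of B] carrier_matD(1)[OF B] by simp
    ultimately have "col B j \<in> col_space B"
      unfolding col_space_def using in_own_span by blast
    then show "\<exists>x\<in>carrier_vec a. A *\<^sub>v x = col B j"
      using sub A unfolding col_space_eq[OF A] by auto
  qed
  then obtain x where x: "\<And>j. j < b \<Longrightarrow> x j \<in> carrier_vec a \<and> A *\<^sub>v x j = col B j"
    by metis
  define C where "C = mat a b (\<lambda>(i, j). x j $ i)"
  have "B = A * C"
  proof (rule eq_matI)
    fix i j assume ij: "i < dim_row (A * C)" "j < dim_col (A * C)"
    then have ij': "i < m" "j < b"
      using A by (auto simp: C_def)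
    have "col C j = x j"
      using x[OF ij'(2)] ij'(2) by (intro eq_vecI) (auto simp: C_def)
    then have "(A * C) $$ (i, j) = (A *\<^sub>v x j) $ i"
      using ij A by simp
    also have "\<dots> = B $$ (i, j)"
      using x[OF ij'(2)] ij' B by simp
    finally show "B $$ (i, j) = (A * C) $$ (i, j)" ..
  qed (use A B in \<open>auto simp: C_def\<close>)
  then show ?thesis
    by (auto simp: C_def)
qed

text \<open>
  The bases are chosen independently for the members of a flag, but the inclusions express
  each in terms of any later one.
\<close>

lemma flag_basis_matrices_nested:
  fixes A :: "nat \<Rightarrow> 'k::field mat"
  assumes V: "V \<in> partial_flags n m" and A: "\<forall>i\<in>{1..n}. basis_matrix m i (V i) (A i)"
    and K: "K \<subseteq> {1..n}"
  shows "nested_matrices m K A"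
proof -
  have mono: "V b \<subseteq> V a" if "b \<le> a" "1 \<le> b" "a \<le> n" for a b
    using that
  proof (induction a rule: dec_induct)
    case (step k)
    then have "V k \<subset> V (Suc k)"
      using V by (auto simp: partial_flags_def)
    then show ?case
      using step by auto
  qed simp
  have "\<exists>C\<in>carrier_mat a b. A b = A a * C" if "a \<in> K" "b \<in> K" "b \<le> a" for a b
  proof (rule col_space_factor)
    have ab: "a \<in> {1..n}" "b \<in> {1..n}"
      using that K by auto
    then show "A a \<in> carrier_mat m a" "A b \<in> carrier_mat m b"
      using A by (auto simp: basis_matrix_def)
    show "vec_space.col_space m (A b) \<subseteq> vec_space.col_space m (A a)"
      using A ab mono[of b a] that(3) by (auto simp: basis_matrix_def)
  qed
  then show ?thesis
    using A K unfolding nested_matrices_def basis_matrix_def by blast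
qed

text \<open>
  A polynomial in one variable has only finitely many zeros, so finitely many conditions can
  be met at once.
\<close>

lemma curve_parameter_exists:
  fixes Q :: "'k::field_char_0 poly"
  assumes "Q \<noteq> 0" "n \<le> m" "m < B"
  obtains t where "t \<noteq> 0" "poly Q t \<noteq> 0" "\<And>i. i \<in> {1..n} \<Longrightarrow> poly (minor_poly B (Suc m) {1..i}) t \<noteq> 0"
proof -
  \<comment> \<open>The factor \<open>[:0, 1:]\<close> excludes the parameter 0.\<close>
  let ?R = "Q * [:0, 1:] * (\<Prod>i\<in>{1..n}. minor_poly B (Suc m) {1..i}) :: 'k poly"
  have "minor_poly B (Suc m) {1..i} \<noteq> (0::'k poly)" if "i \<in> {1..n}" for i
    using minor_poly_leading[of "{1..i}" "Suc m" B] that assms by auto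
  then have "?R \<noteq> 0"
    using assms(1) by auto
  then obtain t where "poly ?R t \<noteq> 0"
    using poly_all_0_iff_0 by blast
  then have "t \<noteq> 0" "poly Q t \<noteq> 0" "(\<Prod>i\<in>{1..n}. poly (minor_poly B (Suc m) {1..i}) t) \<noteq> 0"
    by (auto simp: poly_prod)
  then show ?thesis
    using that by (simp add: prod_zero_iff)
qed

lemma finite_flag_vars: "finite (flag_vars n m)"
  by (rule finite_subset[of _ "Pow {1..m}"]) (auto simp: flag_vars_def)

lemma column_labels_id:
  assumes "\<And>\<sigma>. \<sigma> \<in> V \<Longrightarrow> \<sigma> \<subseteq> {1..m} \<and> 1 \<le> card \<sigma>"
  shows "column_labels V (\<lambda>\<sigma>. \<sigma>) m"
  using assms by unfold_locales fastforce+

text \<open>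
  Along the curve, the value of \<open>f\<close> is a polynomial in the parameter that is nonzero by
  comparison of degrees.
\<close>

lemma standard_nonvanishing_on_curve:
  fixes f :: "(nat set, 'k::field_char_0) mpoly"
  assumes V: "\<And>\<sigma>. \<sigma> \<in> V \<Longrightarrow> \<sigma> \<subseteq> {1..m} \<and> 1 \<le> card \<sigma>"
    and f: "f \<noteq> 0" "\<And>a. a \<in> keys f \<Longrightarrow> keys a \<subseteq> V \<and> standard_monomial comparable a" and "n \<le> m"
  obtains B t where "t \<noteq> 0" "\<And>i. i \<in> {1..n} \<Longrightarrow> poly (minor_poly B (Suc m) {1..i}) t \<noteq> 0"
    "poly_eval f (plucker_point (curve_mat m B t)) \<noteq> 0"
proof -
  interpret column_labels V "\<lambda>\<sigma>. \<sigma>" m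
    using V by (rule column_labels_id)
  obtain B where B: "m < B" "1 < B"
    "\<And>D :: nat set \<Rightarrow> 'k poly. (\<And>\<sigma>. \<sigma> \<in> V \<Longrightarrow> D \<sigma> \<noteq> 0 \<and> degree (D \<sigma>) = lead_exp B (Suc m) \<sigma>) \<Longrightarrow>
       \<exists>Q. Q \<noteq> 0 \<and> (\<forall>t. poly_eval f (\<lambda>\<sigma>. poly (D \<sigma>) t) = poly Q t)"
    using standard_eval_nonzero[OF f] by blast
  have "minor_poly B (Suc m) \<sigma> \<noteq> (0 :: 'k poly) \<and> degree (minor_poly B (Suc m) \<sigma> :: 'k poly) = lead_exp B (Suc m) \<sigma>"
    if "\<sigma> \<in> V" for \<sigma>
    using minor_poly_leading[of \<sigma> "Suc m" B] card_s[OF that] B(1) by simp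
  then obtain Q :: "'k poly" where Q: "Q \<noteq> 0"
    "\<And>t. poly_eval f (\<lambda>\<sigma>. poly (minor_poly B (Suc m) \<sigma>) t) = poly Q t"
    using B(3)[of "minor_poly B (Suc m)"] by blast
  obtain t where t: "t \<noteq> 0" "poly Q t \<noteq> 0" "\<And>i. i \<in> {1..n} \<Longrightarrow> poly (minor_poly B (Suc m) {1..i}) t \<noteq> 0"
    using curve_parameter_exists[OF Q(1) \<open>n \<le> m\<close> B(1)] by blast
  have "poly_eval f (plucker_point (curve_mat m B t)) = poly_eval f (\<lambda>\<sigma>. poly (minor_poly B (Suc m) \<sigma>) t)"
  proof (rule poly_eval_cong)
    fix a \<sigma> assume "a \<in> keys f" "\<sigma> \<in> keys a"
    then have "\<sigma> \<subseteq> {1..m}"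
      using f(2) V by blast
    then show "plucker_point (curve_mat m B t) \<sigma> = poly (minor_poly B (Suc m) \<sigma>) t"
      by (rule plucker_coord_curve_mat)
  qed
  then show ?thesis
    using that[of t B] t Q(2) by simp
qed

lemma comparable_sym: "comparable \<sigma> \<tau> \<Longrightarrow> comparable \<tau> \<sigma>"
  by (auto simp: comparable_def)

lemma comparable_refl: "comparable \<sigma> \<sigma>"
  by (simp add: comparable_def dominates_refl)

lemma straightened_quadric_carrier:
  assumes f: "straightened_quadric m \<sigma> \<tau> f" and V: "V = {\<rho>. \<rho> \<subseteq> {1..m} \<and> card \<rho> \<in> K}"
    and st: "\<sigma> \<in> V" "\<tau> \<in> V"
  shows "poly_var \<sigma> * poly_var \<tau> - f \<in> carrier (poly_ring V)"
    "\<forall>u\<in>keys f. \<exists>\<sigma>'\<in>V. \<exists>\<tau>'\<in>V. u = quad_monomial \<sigma>' \<tau>' \<and> multidegree u = multidegree (quad_monomial \<sigma> \<tau>) \<and>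
       (column_value m \<sigma>)\<^sup>2 + (column_value m \<tau>)\<^sup>2 < (column_value m \<sigma>')\<^sup>2 + (column_value m \<tau>')\<^sup>2"
proof -
  show f': "\<forall>u\<in>keys f. \<exists>\<sigma>'\<in>V. \<exists>\<tau>'\<in>V. u = quad_monomial \<sigma>' \<tau>' \<and> multidegree u = multidegree (quad_monomial \<sigma> \<tau>) \<and>
       (column_value m \<sigma>)\<^sup>2 + (column_value m \<tau>)\<^sup>2 < (column_value m \<sigma>')\<^sup>2 + (column_value m \<tau>')\<^sup>2"
  proof
    fix u assume "u \<in> keys f"
    then obtain \<sigma>' \<tau>' where *: "u = quad_monomial \<sigma>' \<tau>'" "\<sigma>' \<subseteq> {1..m}" "\<tau>' \<subseteq> {1..m}"
      "{card \<sigma>', card \<tau>'} \<subseteq> {card \<sigma>, card \<tau>}" "multidegree u = multidegree (quad_monomial \<sigma> \<tau>)"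
      "(column_value m \<sigma>)\<^sup>2 + (column_value m \<tau>)\<^sup>2 < (column_value m \<sigma>')\<^sup>2 + (column_value m \<tau>')\<^sup>2"
      using f unfolding straightened_quadric_def by blast
    have "{card \<sigma>, card \<tau>} \<subseteq> K"
      using st unfolding V by simp
    then have "\<sigma>' \<in> V" "\<tau>' \<in> V"
      using *(2,3,4) unfolding V by blast+
    then show "\<exists>\<sigma>'\<in>V. \<exists>\<tau>'\<in>V. u = quad_monomial \<sigma>' \<tau>' \<and> multidegree u = multidegree (quad_monomial \<sigma> \<tau>) \<and>
       (column_value m \<sigma>)\<^sup>2 + (column_value m \<tau>)\<^sup>2 < (column_value m \<sigma>')\<^sup>2 + (column_value m \<tau>')\<^sup>2"
      using * by blast
  qed
  have "keys u \<subseteq> V" if "u \<in> keys (poly_var \<sigma> * poly_var \<tau> - f)" for u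
  proof -
    have "u = quad_monomial \<sigma> \<tau> \<or> u \<in> keys f"
      using that Poly_Mapping.keys_diff[of "poly_var \<sigma> * poly_var \<tau>" f] by (auto simp: var_mult_var)
    then show ?thesis
    proof
      assume "u \<in> keys f"
      then show ?thesis
        using f' by (metis (no_types, lifting) empty_subsetI insert_subset keys_quad_monomial)
    qed (use st in \<open>simp add: keys_quad_monomial\<close>)
  qed
  then show "poly_var \<sigma> * poly_var \<tau> - f \<in> carrier (poly_ring V)"
    by simp
qed

text \<open>
  The Garnir relations hold for all bases of the members of a flag. A standard combination in
  the ideal would vanish at all flags of the curve.
\<close>

proposition straightening_plucker_ideal:
  assumes "0 < n" "n < m"
  shows "straightening (flag_vars n m) (plucker_ideal n m :: (nat set, 'k::field_char_0) mpoly set)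
    comparable multidegree (\<lambda>\<sigma>. (column_value m \<sigma>)\<^sup>2)"
proof (rule straightening.intro)
  let ?I = "plucker_ideal n m :: (nat set, 'k) mpoly set"
  have V: "flag_vars n m = {\<rho>. \<rho> \<subseteq> {1..m} \<and> card \<rho> \<in> {1..n}}"
    by (auto simp: flag_vars_def)
  let ?X = "{plucker_point A | A. \<exists>V\<in>partial_flags n m. \<forall>i\<in>{1..n}. basis_matrix m i (V i) (A i :: 'k mat)}"
  have I: "?I = {f \<in> carrier (poly_ring (flag_vars n m)). \<forall>x\<in>?X. poly_eval f x = 0}"
    unfolding plucker_ideal_def by blast
  show "ideal ?I (poly_ring (flag_vars n m))"
    unfolding I by (rule ideal_vanishing)
  show "finite (flag_vars n m)"
    by (rule finite_flag_vars)
  show "comparable x x" for x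
    by (rule comparable_refl)
  show "comparable y x" if "comparable x y" for x y
    using that by (rule comparable_sym)
  fix \<sigma> \<tau> assume st: "\<sigma> \<in> flag_vars n m" "\<tau> \<in> flag_vars n m" "\<not> comparable \<sigma> \<tau>"
  then have sub: "\<sigma> \<subseteq> {1..m}" "\<tau> \<subseteq> {1..m}" "{card \<sigma>, card \<tau>} \<subseteq> {1..n}"
    by (auto simp: flag_vars_def)
  obtain f :: "(nat set, 'k) mpoly" where f: "straightened_quadric m \<sigma> \<tau> f"
    "\<forall>A. nested_matrices m {card \<sigma>, card \<tau>} A \<longrightarrow> poly_eval (poly_var \<sigma> * poly_var \<tau> - f) (plucker_point A) = 0"
    using plucker_straightening[OF sub(1,2) st(3)] by blast
  have "poly_eval (poly_var \<sigma> * poly_var \<tau> - f) x = 0" if "x \<in> ?X" for x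
    using that f(2) flag_basis_matrices_nested[OF _ _ sub(3)] by blast
  then have "poly_var \<sigma> * poly_var \<tau> - f \<in> ?I"
    unfolding I using straightened_quadric_carrier(1)[OF f(1) V st(1,2)] by blast
  then show "\<exists>f. poly_var \<sigma> * poly_var \<tau> - f \<in> ?I \<and>
      (\<forall>a\<in>keys f. \<exists>x'\<in>flag_vars n m. \<exists>y'\<in>flag_vars n m. a = quad_monomial x' y' \<and>
         multidegree a = multidegree (quad_monomial \<sigma> \<tau>) \<and>
         (column_value m \<sigma>)\<^sup>2 + (column_value m \<tau>)\<^sup>2 < (column_value m x')\<^sup>2 + (column_value m y')\<^sup>2)"
    using straightened_quadric_carrier(2)[OF f(1) V st(1,2)] by blast
next
  fix f :: "(nat set, 'k) mpoly"
  assume f: "f \<in> plucker_ideal n m" "\<forall>a\<in>keys f. standard_monomial comparable a"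
  show "f = 0"
  proof (rule ccontr)
    assume "f \<noteq> 0"
    have car: "\<And>a. a \<in> keys f \<Longrightarrow> keys a \<subseteq> flag_vars n m \<and> standard_monomial comparable a"
      using f by (auto simp: plucker_ideal_def)
    have vars: "\<And>\<sigma>. \<sigma> \<in> flag_vars n m \<Longrightarrow> \<sigma> \<subseteq> {1..m} \<and> 1 \<le> card \<sigma>"
      by (simp add: flag_vars_def)
    obtain B and t :: 'k where t: "t \<noteq> 0" "\<And>i. i \<in> {1..n} \<Longrightarrow> poly (minor_poly B (Suc m) {1..i}) t \<noteq> 0"
      and ne: "poly_eval f (plucker_point (curve_mat m B t)) \<noteq> 0"
      using standard_nonvanishing_on_curve[OF vars \<open>f \<noteq> 0\<close> car less_imp_le[OF assms(2)]] by blast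
    have zero: "poly_eval f (plucker_point A) = 0"
      if "V \<in> partial_flags n m" "\<forall>i\<in>{1..n}. basis_matrix m i (V i) (A i)" for V A
      using f(1) that unfolding plucker_ideal_def by blast
    have "(\<lambda>i. vec_space.col_space m (curve_mat m B t i)) \<in> partial_flags n m"
      using t assms by (intro curve_is_partial_flag)
    moreover have "\<forall>i\<in>{1..n}. basis_matrix m i (vec_space.col_space m (curve_mat m B t i)) (curve_mat m B t i)"
      by (simp add: basis_matrix_def)
    ultimately have "poly_eval f (plucker_point (curve_mat m B t)) = 0"
      by (rule zero)
    then show False
      using ne by contradiction
  qed
qed

proposition straightening_grassmannian_ideal:
  assumes "1 \<le> i" "i < m"
  shows "straightening (grassmannian_vars i m) (grassmannian_ideal i m :: (nat set, 'k::field_char_0) mpoly set)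
    comparable multidegree (\<lambda>\<sigma>. (column_value m \<sigma>)\<^sup>2)"
proof (rule straightening.intro)
  let ?I = "grassmannian_ideal i m :: (nat set, 'k) mpoly set"
  have V: "grassmannian_vars i m = {\<rho>. \<rho> \<subseteq> {1..m} \<and> card \<rho> \<in> {i}}"
    by (auto simp: grassmannian_vars_def)
  let ?X = "{plucker_coord A | A. \<exists>W\<in>grassmannian i m. basis_matrix m i W (A :: 'k mat)}"
  have I: "?I = {f \<in> carrier (poly_ring (grassmannian_vars i m)). \<forall>x\<in>?X. poly_eval f x = 0}"
    unfolding grassmannian_ideal_def by blast
  show "ideal ?I (poly_ring (grassmannian_vars i m))"
    unfolding I by (rule ideal_vanishing)
  show "finite (grassmannian_vars i m)"
    by (rule finite_subset[of _ "Pow {1..m}"]) (auto simp: grassmannian_vars_def)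
  show "comparable x x" for x
    by (rule comparable_refl)
  show "comparable y x" if "comparable x y" for x y
    using that by (rule comparable_sym)
  fix \<sigma> \<tau> assume st: "\<sigma> \<in> grassmannian_vars i m" "\<tau> \<in> grassmannian_vars i m" "\<not> comparable \<sigma> \<tau>"
  then have sub: "\<sigma> \<subseteq> {1..m}" "\<tau> \<subseteq> {1..m}" "{card \<sigma>, card \<tau>} = {i}"
    by (auto simp: grassmannian_vars_def)
  obtain f :: "(nat set, 'k) mpoly" where f: "straightened_quadric m \<sigma> \<tau> f"
    "\<forall>A. nested_matrices m {i} A \<longrightarrow> poly_eval (poly_var \<sigma> * poly_var \<tau> - f) (plucker_point A) = 0"
    using plucker_straightening[OF sub(1,2) st(3)] unfolding sub(3) by blast
  note car = straightened_quadric_carrier[OF f(1) V st(1,2)]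
  have "poly_eval (poly_var \<sigma> * poly_var \<tau> - f) x = 0" if x: "x \<in> ?X" for x
  proof -
    obtain A W where A: "x = plucker_coord A" "basis_matrix m i W (A :: 'k mat)"
      using x by blast
    then have "A \<in> carrier_mat m i"
      by (simp add: basis_matrix_def)
    then have "nested_matrices m {i} (\<lambda>_. A)"
      by (auto simp: nested_matrices_def intro!: bexI[of _ "1\<^sub>m i"])
    then show ?thesis
      using f(2)[rule_format, of "\<lambda>_. A"] A(1) by simp
  qed
  then have "poly_var \<sigma> * poly_var \<tau> - f \<in> ?I"
    unfolding I using car(1) by blast
  then show "\<exists>f. poly_var \<sigma> * poly_var \<tau> - f \<in> ?I \<and>
      (\<forall>a\<in>keys f. \<exists>x'\<in>grassmannian_vars i m. \<exists>y'\<in>grassmannian_vars i m. a = quad_monomial x' y' \<and>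
         multidegree a = multidegree (quad_monomial \<sigma> \<tau>) \<and>
         (column_value m \<sigma>)\<^sup>2 + (column_value m \<tau>)\<^sup>2 < (column_value m x')\<^sup>2 + (column_value m y')\<^sup>2)"
    using car(2) by blast
next
  fix f :: "(nat set, 'k) mpoly"
  assume f: "f \<in> grassmannian_ideal i m" "\<forall>a\<in>keys f. standard_monomial comparable a"
  show "f = 0"
  proof (rule ccontr)
    assume "f \<noteq> 0"
    have car: "\<And>a. a \<in> keys f \<Longrightarrow> keys a \<subseteq> grassmannian_vars i m \<and> standard_monomial comparable a"
      using f by (auto simp: grassmannian_ideal_def)
    have vars: "\<And>\<sigma>. \<sigma> \<in> grassmannian_vars i m \<Longrightarrow> \<sigma> \<subseteq> {1..m} \<and> 1 \<le> card \<sigma>"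
      using assms by (simp add: grassmannian_vars_def)
    obtain B and t :: 'k where t: "\<And>j. j \<in> {1..i} \<Longrightarrow> poly (minor_poly B (Suc m) {1..j}) t \<noteq> 0"
      and ne: "poly_eval f (plucker_point (curve_mat m B t)) \<noteq> 0"
      using standard_nonvanishing_on_curve[OF vars \<open>f \<noteq> 0\<close> car less_imp_le[OF assms(2)]] by blast
    let ?A = "curve_mat m B t i"
    have "plucker_coord ?A {1..i} \<noteq> 0"
      using plucker_coord_curve_mat[of "{1..i}" m B t] t[of i] assms by simp
    then have "vec_space.col_space m ?A \<in> grassmannian i m"
      using col_space_in_grassmannian(1)[OF curve_mat_carrier] by blast
    moreover have "basis_matrix m i (vec_space.col_space m ?A) ?A"
      by (simp add: basis_matrix_def)
    moreover have "poly_eval f (plucker_point (curve_mat m B t)) = poly_eval f (plucker_coord ?A)"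
      using car by (intro poly_eval_cong) (auto simp: grassmannian_vars_def)
    ultimately show False
      using f(1) ne unfolding grassmannian_ideal_def by auto
  qed
qed

section \<open>Straightening in the tableau ideal\<close>

definition column_tableau :: "nat set \<Rightarrow> tableau" where
  "column_tableau \<sigma> = map (\<lambda>c. [pick \<sigma> c]) [0..<card \<sigma>]"

definition entries :: "tableau \<Rightarrow> nat set" where
  "entries T = set (concat T)"

lemma picks_sorted:
  "sorted_wrt (<) (map (pick \<sigma>) [0..<card \<sigma>])"
  using pick_mono_le[of _ \<sigma>] by (simp add: sorted_wrt_iff_nth_less)

lemma pick_sorted_list:
  assumes "sorted_wrt (<) xs"
  shows "map (pick (set xs)) [0..<length xs] = xs" "card (set xs) = length xs"
proof -
  show card: "card (set xs) = length xs"
    using assms by (simp add: distinct_card strict_sorted_iff)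
  show "map (pick (set xs)) [0..<length xs] = xs"
    using picks_sorted[of "set xs"] pick_image[of "set xs"] assms card
    by (intro strict_sorted_equal) auto
qed

lemma pick_nth:
  assumes "sorted_wrt (<) xs" "c < length xs"
  shows "pick (set xs) c = xs ! c"
  using arg_cong[OF pick_sorted_list(1)[OF assms(1)], of "\<lambda>ys. ys ! c"] assms(2) by simp

lemma entries_column_tableau:
  assumes "finite \<sigma>"
  shows "entries (column_tableau \<sigma>) = \<sigma>"
  using pick_image[OF assms] by (auto simp: entries_def column_tableau_def)

lemma column_tableau_set:
  assumes "sorted_wrt (<) xs"
  shows "column_tableau (set xs) = map (\<lambda>x. [x]) xs"
  using arg_cong[OF pick_sorted_list(1)[OF assms], of "map (\<lambda>x. [x])"] pick_sorted_list(2)[OF assms]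
  by (simp add: column_tableau_def comp_def)

lemma one_column_tableaux_eq: "one_column_tableaux n m = column_tableau ` flag_vars n m"
proof
  show "column_tableau ` flag_vars n m \<subseteq> one_column_tableaux n m"
  proof
    fix T assume "T \<in> column_tableau ` flag_vars n m"
    then obtain \<sigma> where \<sigma>: "\<sigma> \<subseteq> {1..m}" "1 \<le> card \<sigma>" "card \<sigma> \<le> n" and T: "T = column_tableau \<sigma>"
      by (auto simp: flag_vars_def)
    have "pick \<sigma> c \<in> {1..m}" if "c < card \<sigma>" for c
      using pick_in_set_le[OF that] \<sigma>(1) by blast
    moreover have "T \<noteq> []"
      using \<sigma>(2) by (simp add: T column_tableau_def)
    ultimately show "T \<in> one_column_tableaux n m"
      using \<sigma> pick_mono_le[of _ \<sigma>]
      by (auto simp: one_column_tableaux_def SSYT_def T column_tableau_def sorted_wrt_iff_nth_less hd_map comp_def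
            simp del: pick.simps)
  qed
  show "one_column_tableaux n m \<subseteq> column_tableau ` flag_vars n m"
  proof
    fix T assume T: "T \<in> one_column_tableaux n m"
    then have S: "length T \<le> n" "[] \<notin> set T" "sorted_wrt (\<ge>) (map length T)"
      "\<And>row. row \<in> set T \<Longrightarrow> set row \<subseteq> {1..m}" "T \<noteq> []" "length (hd T) = 1"
      and strict: "\<And>r c. Suc r < length T \<Longrightarrow> c < length (T ! Suc r) \<Longrightarrow> T ! r ! c < T ! Suc r ! c"
      by (auto simp: one_column_tableaux_def SSYT_def)
    have len: "length row = 1" if "row \<in> set T" for row
    proof -
      have "length row \<le> length (hd T)"
        using S(3,5) that by (cases T) auto
      moreover have "row \<noteq> []"
        using S(2) that by auto
      ultimately show ?thesis
        using S(6) by (cases row) auto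
    qed
    define xs where "xs = map hd T"
    have T_eq: "T = map (\<lambda>x. [x]) xs"
    proof -
      have "[hd row] = row" if "row \<in> set T" for row
        using len[OF that] by (cases row) auto
      then show ?thesis
        by (simp add: xs_def comp_def map_idI)
    qed
    have "sorted_wrt (<) xs"
      unfolding sorted_wrt_iff_nth_Suc_transp[OF transp_on_less]
    proof (intro allI impI)
      fix r assume "Suc r < length xs"
      then show "xs ! r < xs ! Suc r"
        using strict[of r 0] by (simp add: T_eq)
    qed
    then have "T = column_tableau (set xs)" "card (set xs) = length xs"
      using column_tableau_set pick_sorted_list(2) T_eq by auto
    moreover have "set xs \<subseteq> {1..m}"
    proof
      fix x assume "x \<in> set xs"
      then have "[x] \<in> set T"
        by (simp add: T_eq)
      from S(4)[OF this] show "x \<in> {1..m}"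
        by simp
    qed
    moreover have "1 \<le> length xs" "length xs \<le> n"
      using S(1,5) by (auto simp: T_eq Suc_le_eq)
    ultimately show "T \<in> column_tableau ` flag_vars n m"
      by (auto simp: flag_vars_def)
  qed
qed

lemma flag_vars_finite_member: "\<sigma> \<in> flag_vars n m \<Longrightarrow> finite \<sigma>"
  using finite_subset by (auto simp: flag_vars_def)

lemma bij_betw_entries: "bij_betw entries (one_column_tableaux n m) (flag_vars n m)"
proof (rule bij_betwI')
  fix T T' assume "T \<in> one_column_tableaux n m" "T' \<in> one_column_tableaux n m"
  then show "entries T = entries T' \<longleftrightarrow> T = T'"
    using flag_vars_finite_member by (auto simp: one_column_tableaux_eq entries_column_tableau)
next
  fix T assume "T \<in> one_column_tableaux n m"
  then show "entries T \<in> flag_vars n m"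
    using flag_vars_finite_member by (auto simp: one_column_tableaux_eq entries_column_tableau)
next
  fix \<sigma> assume "\<sigma> \<in> flag_vars n m"
  then show "\<exists>T\<in>one_column_tableaux n m. \<sigma> = entries T"
    using flag_vars_finite_member by (auto simp: one_column_tableaux_eq entries_column_tableau)
qed

text \<open>
  Every such function is additive for \<open>\<star>\<close>, since \<open>\<star>\<close> only merges rows. Both the exponents of
  diagonal terms and the values of columns are of this form.
\<close>

definition tableau_sum :: "(nat \<Rightarrow> nat \<Rightarrow> nat) \<Rightarrow> tableau \<Rightarrow> nat" where
  "tableau_sum g T = (\<Sum>c<length T. \<Sum>x\<leftarrow>T ! c. g c x)"

lemma tableau_sum_rows:
  assumes "length T \<le> K"
  shows "tableau_sum g T = (\<Sum>c<K. \<Sum>x\<leftarrow>tableau_row T c. g c x)"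
proof -
  have "tableau_sum g T = (\<Sum>c<length T. \<Sum>x\<leftarrow>tableau_row T c. g c x)"
    unfolding tableau_sum_def by (intro sum.cong) (auto simp: tableau_row_def)
  also have "\<dots> = (\<Sum>c<K. \<Sum>x\<leftarrow>tableau_row T c. g c x)"
    using assms by (intro sum.mono_neutral_left) (auto simp: tableau_row_def)
  finally show ?thesis .
qed

lemma sum_list_sort: "(\<Sum>x\<leftarrow>sort xs. g x) = (\<Sum>x\<leftarrow>xs. g x :: nat)"
proof -
  have "mset (map g (sort xs)) = mset (map g xs)"
    by simp
  then show ?thesis
    by (metis sum_mset_sum_list)
qed

lemma tableau_sum_star: "tableau_sum g (T \<star> T') = tableau_sum g T + tableau_sum g T'"
proof -
  let ?K = "max (length T) (length T')"
  have "tableau_sum g (T \<star> T') = (\<Sum>c<?K. \<Sum>x\<leftarrow>sort (tableau_row T c @ tableau_row T' c). g c x)"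
    unfolding tableau_sum_def tableau_star_def by simp
  also have "\<dots> = (\<Sum>c<?K. (\<Sum>x\<leftarrow>tableau_row T c. g c x) + (\<Sum>x\<leftarrow>tableau_row T' c. g c x))"
    unfolding sum_list_sort by simp
  also have "\<dots> = tableau_sum g T + tableau_sum g T'"
    by (simp add: sum.distrib tableau_sum_rows[of _ ?K])
  finally show ?thesis .
qed

lemma tableau_sum_column: "tableau_sum g (column_tableau \<sigma>) = (\<Sum>c<card \<sigma>. g c (pick \<sigma> c))"
  by (simp add: tableau_sum_def column_tableau_def)

lemma column_value_tableau_sum:
  assumes "finite \<sigma>"
  shows "column_value m \<sigma> = tableau_sum (\<lambda>_. entry_value m) (column_tableau \<sigma>)"
proof -
  have "column_value m \<sigma> = (\<Sum>x\<in>pick \<sigma> ` {0..<card \<sigma>}. entry_value m x)"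
    by (simp add: column_value_def pick_image[OF assms])
  then show ?thesis
    unfolding sum.reindex[OF inj_on_pick] by (simp add: tableau_sum_column atLeast0LessThan)
qed

text \<open>
  The row-wise minimum of two columns, continued by the longer one. It is the first column of
  their product under \<open>\<star>\<close>, and \<open>join_column\<close> is the second.
\<close>

definition meet_column :: "nat set \<Rightarrow> nat set \<Rightarrow> nat set" where
  "meet_column \<sigma> \<tau> = set (map (\<lambda>c. if c < card \<sigma> \<and> c < card \<tau> then min (pick \<sigma> c) (pick \<tau> c)
     else if c < card \<sigma> then pick \<sigma> c else pick \<tau> c) [0..<max (card \<sigma>) (card \<tau>)])"

definition join_column :: "nat set \<Rightarrow> nat set \<Rightarrow> nat set" where
  "join_column \<sigma> \<tau> = set (map (\<lambda>c. max (pick \<sigma> c) (pick \<tau> c)) [0..<min (card \<sigma>) (card \<tau>)])"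

context
  fixes \<sigma> \<tau> :: "nat set"
  assumes fin: "finite \<sigma>" "finite \<tau>"
begin

lemma meet_sorted: "sorted_wrt (<) (map (\<lambda>c. if c < card \<sigma> \<and> c < card \<tau> then min (pick \<sigma> c) (pick \<tau> c)
     else if c < card \<sigma> then pick \<sigma> c else pick \<tau> c) [0..<max (card \<sigma>) (card \<tau>)])"
  using pick_mono_le[of _ \<sigma>] pick_mono_le[of _ \<tau>]
  by (auto simp: sorted_wrt_iff_nth_less min_def intro: less_trans le_less_trans)
    (meson less_trans le_less_trans not_le)+

lemma join_sorted: "sorted_wrt (<) (map (\<lambda>c. max (pick \<sigma> c) (pick \<tau> c)) [0..<min (card \<sigma>) (card \<tau>)])"
  unfolding sorted_wrt_iff_nth_less
proof (intro allI impI)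
  fix i j assume ij: "i < j" "j < length (map (\<lambda>c. max (pick \<sigma> c) (pick \<tau> c)) [0..<min (card \<sigma>) (card \<tau>)])"
  then have "pick \<sigma> i < pick \<sigma> j" "pick \<tau> i < pick \<tau> j"
    by (auto intro: pick_mono_le)
  then show "map (\<lambda>c. max (pick \<sigma> c) (pick \<tau> c)) [0..<min (card \<sigma>) (card \<tau>)] ! i
      < map (\<lambda>c. max (pick \<sigma> c) (pick \<tau> c)) [0..<min (card \<sigma>) (card \<tau>)] ! j"
    using ij by (simp add: max_def)
qed

lemma card_meet: "card (meet_column \<sigma> \<tau>) = max (card \<sigma>) (card \<tau>)"
  unfolding meet_column_def pick_sorted_list(2)[OF meet_sorted] by simp

lemma card_join: "card (join_column \<sigma> \<tau>) = min (card \<sigma>) (card \<tau>)"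
  unfolding join_column_def pick_sorted_list(2)[OF join_sorted] by simp

lemma pick_meet:
  "c < max (card \<sigma>) (card \<tau>) \<Longrightarrow> pick (meet_column \<sigma> \<tau>) c =
    (if c < card \<sigma> \<and> c < card \<tau> then min (pick \<sigma> c) (pick \<tau> c)
     else if c < card \<sigma> then pick \<sigma> c else pick \<tau> c)"
  unfolding meet_column_def by (subst pick_nth[OF meet_sorted]) auto

lemma pick_join:
  "c < min (card \<sigma>) (card \<tau>) \<Longrightarrow> pick (join_column \<sigma> \<tau>) c = max (pick \<sigma> c) (pick \<tau> c)"
  unfolding join_column_def by (subst pick_nth[OF join_sorted]) auto

lemma finite_meet_join: "finite (meet_column \<sigma> \<tau>)" "finite (join_column \<sigma> \<tau>)"
  by (simp_all add: meet_column_def join_column_def)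

lemma meet_join_subset: "meet_column \<sigma> \<tau> \<subseteq> \<sigma> \<union> \<tau>" "join_column \<sigma> \<tau> \<subseteq> \<sigma> \<union> \<tau>"
  using pick_in_set_le[of _ \<sigma>] pick_in_set_le[of _ \<tau>]
  by (auto simp: meet_column_def join_column_def min_def max_def split: if_splits)

lemma meet_dominates: "dominates (meet_column \<sigma> \<tau>) \<sigma>" "dominates (meet_column \<sigma> \<tau>) \<tau>"
  using fin finite_meet_join by (auto simp: dominates_iff_pick card_meet pick_meet)

lemma dominates_join: "dominates \<sigma> (join_column \<sigma> \<tau>)" "dominates \<tau> (join_column \<sigma> \<tau>)"
  using fin finite_meet_join by (auto simp: dominates_iff_pick card_join pick_join)

lemma star_meet_join:
  "column_tableau \<sigma> \<star> column_tableau \<tau> = column_tableau (meet_column \<sigma> \<tau>) \<star> column_tableau (join_column \<sigma> \<tau>)"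
proof -
  have row: "tableau_row (column_tableau \<rho>) r = (if r < card \<rho> then [pick \<rho> r] else [])" for \<rho> r
    by (simp add: tableau_row_def column_tableau_def)
  have len: "length (column_tableau \<rho>) = card \<rho>" for \<rho>
    by (simp add: column_tableau_def)
  have "max (max (card \<sigma>) (card \<tau>)) (min (card \<sigma>) (card \<tau>)) = max (card \<sigma>) (card \<tau>)"
    by simp
  then show ?thesis
    unfolding tableau_star_def row len card_meet card_join
    by (intro map_cong) (auto simp: pick_meet pick_join min_def max_def)
qed

end

text \<open>
  A dominating column has smaller entries, or more of them.
\<close>

lemma column_value_dominates:
  assumes d: "dominates \<rho> \<sigma>" "\<rho> \<noteq> \<sigma>" and \<rho>: "\<rho> \<subseteq> {1..m}" and \<sigma>: "\<sigma> \<subseteq> {1..m}"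
  shows "column_value m \<sigma> < column_value m \<rho>"
proof -
  have fin: "finite \<rho>" "finite \<sigma>"
    using \<rho> \<sigma> finite_subset by blast+
  have dom: "card \<sigma> \<le> card \<rho>" "\<And>c. c < card \<sigma> \<Longrightarrow> pick \<rho> c \<le> pick \<sigma> c"
    using d(1) dominates_iff_pick[OF fin] by auto
  have val: "column_value m \<upsilon> = (\<Sum>c<card \<upsilon>. entry_value m (pick \<upsilon> c))" if "finite \<upsilon>" for \<upsilon>
    using column_value_tableau_sum[OF that] by (simp add: tableau_sum_column)
  have le_m: "pick \<sigma> c \<le> m" if "c < card \<sigma>" for c
    using pick_in_set_le[OF that] \<sigma> by auto
  have mono: "entry_value m (pick \<sigma> c) \<le> entry_value m (pick \<rho> c)" if "c < card \<sigma>" for c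
    using dom(2)[OF that] by (simp add: entry_value_def)
  show ?thesis
  proof (cases "card \<sigma> = card \<rho>")
    case True
    have "\<not> (\<forall>c<card \<sigma>. pick \<rho> c = pick \<sigma> c)"
    proof
      assume "\<forall>c<card \<sigma>. pick \<rho> c = pick \<sigma> c"
      then have "pick \<rho> ` {0..<card \<rho>} = pick \<sigma> ` {0..<card \<sigma>}"
        using True by (intro image_cong) auto
      then show False
        using d(2) pick_image fin by simp
    qed
    then obtain c where c: "c < card \<sigma>" "pick \<rho> c < pick \<sigma> c"
      using dom(2) by (meson le_neq_implies_less)
    show ?thesis
      unfolding val[OF fin(1)] val[OF fin(2)] True[symmetric]
      using mono entry_value_strict[OF c(2) le_m[OF c(1)]] c(1)
      by (intro sum_strict_mono_ex1) auto
  next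
    case False
    then have less: "card \<sigma> < card \<rho>"
      using dom(1) by simp
    have "column_value m \<sigma> \<le> (\<Sum>c<card \<sigma>. entry_value m (pick \<rho> c))"
      unfolding val[OF fin(2)] using mono by (intro sum_mono) auto
    also have "\<dots> < (\<Sum>c<card \<rho>. entry_value m (pick \<rho> c))"
    proof (rule sum_strict_mono2)
      have "pick \<rho> (card \<sigma>) \<le> m"
        using pick_in_set_le[OF less] \<rho> by auto
      then show "0 < entry_value m (pick \<rho> (card \<sigma>))"
        by (rule entry_value_pos)
    qed (use less in auto)
    finally show ?thesis
      unfolding val[OF fin(1)] .
  qed
qed

definition star_binomials :: "nat \<Rightarrow> nat \<Rightarrow> (tableau, 'k::comm_ring_1) mpoly set" where
  "star_binomials n m = {poly_var T1 * poly_var T2 - poly_var T3 * poly_var T4 | T1 T2 T3 T4.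
     {T1, T2, T3, T4} \<subseteq> one_column_tableaux n m \<and> distinct [T1, T2, T3, T4] \<and> T1 \<star> T2 = T3 \<star> T4}"

lemma star_binomials_carrier: "star_binomials n m \<subseteq> carrier (poly_ring (one_column_tableaux n m))"
proof
  fix f :: "(tableau, 'k::comm_ring_1) mpoly" assume "f \<in> star_binomials n m"
  then obtain T1 T2 T3 T4 where T: "{T1, T2, T3, T4} \<subseteq> one_column_tableaux n m"
    and f: "f = single (quad_monomial T1 T2) 1 - single (quad_monomial T3 T4) 1"
    by (auto simp: star_binomials_def var_mult_var)
  have "keys f \<subseteq> {quad_monomial T1 T2, quad_monomial T3 T4}"
    unfolding f using Poly_Mapping.keys_diff[of "single (quad_monomial T1 T2) (1::'k)" "single (quad_monomial T3 T4) 1"]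
    by auto
  then show "f \<in> carrier (poly_ring (one_column_tableaux n m))"
    using T by (auto simp: keys_quad_monomial)
qed

lemma tableau_ideal_eq: "tableau_ideal n m = genideal (poly_ring (one_column_tableaux n m)) (star_binomials n m)"
  by (simp add: tableau_ideal_def star_binomials_def)

text \<open>
  The exponents of diagonal terms are additive for \<open>\<star>\<close>, so both terms of a generator take the
  same value.
\<close>

lemma tableau_ideal_vanishes:
  fixes f :: "(tableau, 'k::field) mpoly"
  assumes "f \<in> tableau_ideal n m"
  shows "poly_eval f (\<lambda>T. t ^ lead_exp B M (entries T)) = 0"
proof -
  let ?x = "\<lambda>T. t ^ lead_exp B M (entries T)"
  let ?Z = "{f \<in> carrier (poly_ring (one_column_tableaux n m)). \<forall>x\<in>{?x}. poly_eval f x = 0}"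
  have lead: "lead_exp B M (entries T) = tableau_sum (\<lambda>c x. B ^ (x * M + c)) T"
    if "T \<in> one_column_tableaux n m" for T
    using that flag_vars_finite_member
    by (auto simp: one_column_tableaux_eq entries_column_tableau tableau_sum_column lead_exp_def)
  have "star_binomials n m \<subseteq> ?Z"
  proof
    fix f :: "(tableau, 'k) mpoly" assume f: "f \<in> star_binomials n m"
    then obtain T1 T2 T3 T4 where T: "{T1, T2, T3, T4} \<subseteq> one_column_tableaux n m" "T1 \<star> T2 = T3 \<star> T4"
      and f_eq: "f = poly_var T1 * poly_var T2 - poly_var T3 * poly_var T4"
      by (auto simp: star_binomials_def)
    have "lead_exp B M (entries T1) + lead_exp B M (entries T2) = lead_exp B M (entries T3) + lead_exp B M (entries T4)"
      using T tableau_sum_star[of _ T1 T2] tableau_sum_star[of _ T3 T4] by (simp add: lead)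
    then have "poly_eval f ?x = 0"
      by (simp add: f_eq poly_eval_diff var_mult_var poly_eval_single monomial_eval_quad power_add[symmetric])
    then show "f \<in> ?Z"
      using f star_binomials_carrier by blast
  qed
  then have "tableau_ideal n m \<subseteq> ?Z"
    unfolding tableau_ideal_eq by (rule genideal_subset[OF ideal_vanishing])
  then show ?thesis
    using assms by blast
qed

text \<open>
  The meet dominates both given columns and therefore has a larger value than either; the sum
  of the values is preserved.
\<close>

lemma meet_join_relation:
  assumes T: "T \<in> one_column_tableaux n m" "T' \<in> one_column_tableaux n m" "\<not> comparable (entries T) (entries T')"
  shows "\<exists>U\<in>one_column_tableaux n m. \<exists>U'\<in>one_column_tableaux n m.
    poly_var T * poly_var T' - poly_var U * poly_var U' \<in> (star_binomials n m :: (tableau, 'k::comm_ring_1) mpoly set) \<and>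
    (column_value m (entries T))\<^sup>2 + (column_value m (entries T'))\<^sup>2 <
    (column_value m (entries U))\<^sup>2 + (column_value m (entries U'))\<^sup>2"
proof -
  obtain \<sigma> \<tau> where st: "\<sigma> \<in> flag_vars n m" "\<tau> \<in> flag_vars n m" and TT: "T = column_tableau \<sigma>" "T' = column_tableau \<tau>"
    using T by (auto simp: one_column_tableaux_eq)
  have fin: "finite \<sigma>" "finite \<tau>"
    using st flag_vars_finite_member by blast+
  have nc: "\<not> dominates \<sigma> \<tau>" "\<not> dominates \<tau> \<sigma>"
    using T(3) fin by (auto simp: TT entries_column_tableau comparable_def)
  define \<rho> \<upsilon> where "\<rho> = meet_column \<sigma> \<tau>" "\<upsilon> = join_column \<sigma> \<tau>"
  have fin': "finite \<rho>" "finite \<upsilon>"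
    using finite_meet_join[OF fin] by (auto simp: \<rho>_\<upsilon>_def)
  have sub: "\<sigma> \<subseteq> {1..m}" "\<tau> \<subseteq> {1..m}"
    using st by (auto simp: flag_vars_def)
  have sub': "\<rho> \<subseteq> {1..m}" "\<upsilon> \<subseteq> {1..m}"
    using meet_join_subset[OF fin] sub by (auto simp: \<rho>_\<upsilon>_def)
  have vars: "\<rho> \<in> flag_vars n m" "\<upsilon> \<in> flag_vars n m"
    using st sub' card_meet[OF fin] card_join[OF fin] by (auto simp: flag_vars_def \<rho>_\<upsilon>_def)
  have dom: "dominates \<rho> \<sigma>" "dominates \<rho> \<tau>" "dominates \<sigma> \<upsilon>" "dominates \<tau> \<upsilon>"
    using meet_dominates[OF fin] dominates_join[OF fin] by (auto simp: \<rho>_\<upsilon>_def)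
  have ne: "\<sigma> \<noteq> \<tau>" "\<rho> \<noteq> \<sigma>" "\<rho> \<noteq> \<tau>" "\<upsilon> \<noteq> \<sigma>" "\<upsilon> \<noteq> \<tau>" "\<rho> \<noteq> \<upsilon>"
    using dom nc dominates_refl[of \<sigma>] dominates_trans[of \<sigma> \<upsilon> \<tau>] by auto
  have inj: "column_tableau \<alpha> = column_tableau \<beta> \<longleftrightarrow> \<alpha> = \<beta>" if "finite \<alpha>" "finite \<beta>" for \<alpha> \<beta>
  proof
    assume "column_tableau \<alpha> = column_tableau \<beta>"
    then have "entries (column_tableau \<alpha>) = entries (column_tableau \<beta>)"
      by (rule arg_cong)
    then show "\<alpha> = \<beta>"
      unfolding that[THEN entries_column_tableau] .
  qed simp
  let ?U = "column_tableau \<rho>" and ?U' = "column_tableau \<upsilon>"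
  have star: "T \<star> T' = ?U \<star> ?U'"
    unfolding TT \<rho>_\<upsilon>_def by (rule star_meet_join[OF fin])
  have U: "?U \<in> one_column_tableaux n m" "?U' \<in> one_column_tableaux n m"
    using vars by (auto simp: one_column_tableaux_eq)
  have "distinct [T, T', ?U, ?U']"
    using ne ne[symmetric] by (simp add: TT inj fin fin')
  then have mem: "poly_var T * poly_var T' - poly_var ?U * poly_var ?U' \<in> (star_binomials n m :: (tableau, 'k) mpoly set)"
    unfolding star_binomials_def using T(1,2) U star by blast
  have total: "column_value m \<rho> + column_value m \<upsilon> = column_value m \<sigma> + column_value m \<tau>"
    using arg_cong[OF star, of "tableau_sum (\<lambda>_. entry_value m)"] fin fin'
    by (simp add: tableau_sum_star column_value_tableau_sum TT)
  have less: "column_value m \<sigma> < column_value m \<rho>" "column_value m \<tau> < column_value m \<rho>"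
    using column_value_dominates dom ne sub sub' by blast+
  have "(column_value m \<sigma>)\<^sup>2 + (column_value m \<tau>)\<^sup>2 < (column_value m \<rho>)\<^sup>2 + (column_value m \<upsilon>)\<^sup>2"
  proof (cases "column_value m \<tau> \<le> column_value m \<sigma>")
    case True
    then show ?thesis
      using squares_spread[OF total] less by blast
  next
    case False
    then show ?thesis
      using squares_spread[of _ _ "column_value m \<tau>" "column_value m \<sigma>"] total less by (simp add: add.commute)
  qed
  then show ?thesis
    using U mem fin fin' by (intro bexI[of _ ?U] bexI[of _ ?U']) (simp_all add: TT entries_column_tableau)
qed

text \<open>
  The grading is trivial here, because only the total number of generators is wanted.
\<close>

proposition straightening_tableau_ideal:
  "straightening (one_column_tableaux n m) (tableau_ideal n m :: (tableau, 'k::field_char_0) mpoly set)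
    (\<lambda>T T'. comparable (entries T) (entries T')) (\<lambda>_. ()) (\<lambda>T. (column_value m (entries T))\<^sup>2)"
proof (rule straightening.intro)
  let ?V = "one_column_tableaux n m"
  let ?I = "tableau_ideal n m :: (tableau, 'k) mpoly set"
  show "finite ?V"
    unfolding one_column_tableaux_eq using finite_flag_vars by simp
  show "ideal ?I (poly_ring ?V)"
    unfolding tableau_ideal_eq by (rule ideal_genideal[OF star_binomials_carrier])
  show "comparable (entries T) (entries T)" for T
    by (rule comparable_refl)
  show "comparable (entries T') (entries T)" if "comparable (entries T) (entries T')" for T T'
    using that by (rule comparable_sym)
  fix T T' assume T: "T \<in> ?V" "T' \<in> ?V" "\<not> comparable (entries T) (entries T')"
  obtain U U' where U: "U \<in> ?V" "U' \<in> ?V"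
    "poly_var T * poly_var T' - poly_var U * poly_var U' \<in> (star_binomials n m :: (tableau, 'k) mpoly set)"
    "(column_value m (entries T))\<^sup>2 + (column_value m (entries T'))\<^sup>2 <
     (column_value m (entries U))\<^sup>2 + (column_value m (entries U'))\<^sup>2"
    using meet_join_relation[OF T, where 'k = 'k] by blast
  then have "poly_var T * poly_var T' - poly_var U * poly_var U' \<in> ?I"
    unfolding tableau_ideal_eq using subset_genideal[OF star_binomials_carrier] by blast
  then show "\<exists>f. poly_var T * poly_var T' - f \<in> ?I \<and>
      (\<forall>a\<in>keys f. \<exists>x'\<in>?V. \<exists>y'\<in>?V. a = quad_monomial x' y' \<and> () = () \<and>
         (column_value m (entries T))\<^sup>2 + (column_value m (entries T'))\<^sup>2
         < (column_value m (entries x'))\<^sup>2 + (column_value m (entries y'))\<^sup>2)"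
    using U by (intro exI[of _ "poly_var U * poly_var U'"]) (auto simp: var_mult_var)
next
  fix f :: "(tableau, 'k) mpoly"
  assume f: "f \<in> tableau_ideal n m" "\<forall>a\<in>keys f. standard_monomial (\<lambda>T T'. comparable (entries T) (entries T')) a"
  interpret column_labels "one_column_tableaux n m" entries m
  proof
    show "inj_on entries (one_column_tableaux n m)"
      using bij_betw_entries by (rule bij_betw_imp_inj_on)
    fix T assume "T \<in> one_column_tableaux n m"
    then have "entries T \<in> flag_vars n m"
      using bij_betw_entries bij_betwE by blast
    then show "entries T \<subseteq> {1..m}" "entries T \<noteq> {}"
      by (auto simp: flag_vars_def)
  qed
  show "f = 0"
  proof (rule ccontr)
    assume "f \<noteq> 0"
    have "f \<in> carrier (poly_ring (one_column_tableaux n m))"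
      using f(1) ideal_carrier[OF ideal_genideal[OF star_binomials_carrier]] unfolding tableau_ideal_eq by blast
    then have car: "\<And>a. a \<in> keys f \<Longrightarrow> keys a \<subseteq> one_column_tableaux n m \<and> standard_monomial cmp a"
      using f(2) by simp
    obtain B where B:
      "\<And>D :: tableau \<Rightarrow> 'k poly. (\<And>T. T \<in> one_column_tableaux n m \<Longrightarrow> D T \<noteq> 0 \<and> degree (D T) = lead_exp B (Suc m) (entries T)) \<Longrightarrow>
         \<exists>Q. Q \<noteq> 0 \<and> (\<forall>t. poly_eval f (\<lambda>T. poly (D T) t) = poly Q t)"
      using standard_eval_nonzero[OF \<open>f \<noteq> 0\<close> car] by blast
    obtain Q where Q: "Q \<noteq> 0"
      "\<And>t. poly_eval f (\<lambda>T. poly (monom 1 (lead_exp B (Suc m) (entries T))) t) = poly Q t"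
      using B[of "\<lambda>T. monom 1 (lead_exp B (Suc m) (entries T))"] by (auto simp: degree_monom_eq)
    have "poly Q t = 0" for t
      using Q(2)[of t] tableau_ideal_vanishes[OF f(1), of t B "Suc m"] by (simp add: poly_monom)
    then show False
      using Q(1) poly_all_0_iff_0 by blast
  qed
qed

lemma inj_on_keys_quads: "inj_on keys (incomparable_quads cmp V)"
proof (rule inj_onI)
  fix u v assume uv: "u \<in> incomparable_quads cmp V" "v \<in> incomparable_quads cmp V" "keys u = keys v"
  then obtain x y x' y' where u: "u = quad_monomial x y" and v: "v = quad_monomial x' y'"
    by (auto simp: incomparable_quads_def)
  have "{x, y} = {x', y'}"
    using uv(3) by (simp add: u v keys_quad_monomial)
  then have "x = x' \<and> y = y' \<or> x = y' \<and> y = x'"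
    by (auto simp: doubleton_eq_iff)
  then show "u = v"
    unfolding u v using quad_monomial_commute[of x y] by auto
qed

text \<open>
  A quadratic monomial is determined by the set of its variables, so incomparable pairs
  correspond under a bijection that respects comparability.
\<close>

lemma card_incomparable_quads_bij:
  assumes s: "bij_betw s V W" and cmp: "\<And>x y. x \<in> V \<Longrightarrow> y \<in> V \<Longrightarrow> cmp x y \<longleftrightarrow> cmp' (s x) (s y)"
  shows "card (incomparable_quads cmp V) = card (incomparable_quads cmp' W)"
proof -
  note keys_inj = inj_on_keys_quads
  define pairs where "pairs = {(x, y). x \<in> V \<and> y \<in> V \<and> \<not> cmp x y}"
  have V_quads: "incomparable_quads cmp V = (\<lambda>(x, y). quad_monomial x y) ` pairs"
    by (auto simp: incomparable_quads_def pairs_def)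
  have W: "W = s ` V"
    using s by (simp add: bij_betw_def)
  have W_quads: "incomparable_quads cmp' W = (\<lambda>(x, y). quad_monomial (s x) (s y)) ` pairs"
    using cmp unfolding incomparable_quads_def pairs_def W by fastforce
  have "card (incomparable_quads cmp' W) = card (keys ` incomparable_quads cmp' W)"
    by (rule card_image[OF keys_inj, symmetric])
  also have "keys ` incomparable_quads cmp' W = (`) s ` keys ` incomparable_quads cmp V"
    unfolding V_quads W_quads image_image by (intro image_cong) (auto simp: keys_quad_monomial)
  also have "card \<dots> = card (keys ` incomparable_quads cmp V)"
  proof (rule card_image, rule inj_on_subset)
    show "inj_on ((`) s) (Pow V)"
      using s by (intro inj_on_image_Pow) (rule bij_betw_imp_inj_on)
    show "keys ` incomparable_quads cmp V \<subseteq> Pow V"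
      by (auto simp: incomparable_quads_def keys_quad_monomial)
  qed
  also have "\<dots> = card (incomparable_quads cmp V)"
    by (rule card_image[OF keys_inj])
  finally show ?thesis ..
qed

section \<open>The number of incomparable pairs\<close>

definition nondominating_pairs :: "nat \<Rightarrow> nat \<Rightarrow> nat \<Rightarrow> (nat set \<times> nat set) set" where
  "nondominating_pairs m p q = {(\<sigma>, \<tau>). \<sigma> \<subseteq> {1..m} \<and> \<tau> \<subseteq> {1..m} \<and> card \<sigma> = p \<and> card \<tau> = q \<and> \<not> dominates \<sigma> \<tau>}"

lemma finite_nondominating_pairs: "finite (nondominating_pairs m p q)"
  by (rule finite_subset[of _ "Pow {1..m} \<times> Pow {1..m}"]) (auto simp: nondominating_pairs_def)

lemma sum_Pow_insert:
  assumes "x \<notin> A" "finite A"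
  shows "(\<Sum>\<sigma>\<in>Pow (insert x A). f \<sigma>) = (\<Sum>\<sigma>\<in>Pow A. f \<sigma>) + (\<Sum>\<sigma>\<in>Pow A. f (insert x \<sigma>) :: nat)"
proof -
  have "inj_on (insert x) (Pow A)"
    using assms(1) by (intro inj_onI) (metis PowD insert_ident subsetD)
  then have "(\<Sum>\<sigma>\<in>insert x ` Pow A. f \<sigma>) = (\<Sum>\<sigma>\<in>Pow A. f (insert x \<sigma>))"
    by (simp add: sum.reindex)
  then show ?thesis
    unfolding Pow_insert using assms by (subst sum.union_disjoint) auto
qed

lemma card_nondominating_pairs_sum:
  "card (nondominating_pairs m p q) = (\<Sum>\<sigma>\<in>Pow {1..m}. \<Sum>\<tau>\<in>Pow {1..m}.
     of_bool (card \<sigma> = p \<and> card \<tau> = q \<and> \<not> dominates \<sigma> \<tau>))"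
proof -
  have "card (nondominating_pairs m p q) = (\<Sum>z\<in>Pow {1..m} \<times> Pow {1..m}. if z \<in> nondominating_pairs m p q then 1 else 0)"
    by (subst sum.If_cases) (auto simp: nondominating_pairs_def intro!: arg_cong[where f = card])
  also have "\<dots> = (\<Sum>(\<sigma>, \<tau>)\<in>Pow {1..m} \<times> Pow {1..m}.
     of_bool (card \<sigma> = p \<and> card \<tau> = q \<and> \<not> dominates \<sigma> \<tau>))"
    by (intro sum.cong) (auto simp: nondominating_pairs_def)
  finally show ?thesis
    by (simp only: sum.cartesian_product)
qed

text \<open>
  Adding the largest entry \<open>m + 1\<close> changes prefix counts only at the very end, where dominance
  compares the lengths of the columns.
\<close>

lemma dominates_truncate:
  assumes "\<sigma> \<subseteq> {1..m}" "\<tau> \<subseteq> {1..m}" "\<sigma>' \<in> {\<sigma>, insert (Suc m) \<sigma>}" "\<tau>' \<in> {\<tau>, insert (Suc m) \<tau>}"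
    "card \<tau>' \<le> card \<sigma>'"
  shows "dominates \<sigma>' \<tau>' \<longleftrightarrow> dominates \<sigma> \<tau>"
proof -
  have low: "\<sigma>' \<inter> {..x} = \<sigma> \<inter> {..x}" "\<tau>' \<inter> {..x} = \<tau> \<inter> {..x}" if "x \<le> m" for x
    using assms(3,4) that by auto
  have high: "\<sigma> \<inter> {..x} = \<sigma> \<inter> {..m}" "\<tau> \<inter> {..x} = \<tau> \<inter> {..m}" if "m < x" for x
    using assms(1,2) that by auto
  have "\<sigma>' \<subseteq> {1..Suc m}" "\<tau>' \<subseteq> {1..Suc m}"
    using assms(1-4) by auto
  then have high': "\<sigma>' \<inter> {..x} = \<sigma>'" "\<tau>' \<inter> {..x} = \<tau>'" if "m < x" for x
    using that by auto
  have "card (\<tau>' \<inter> {..x}) \<le> card (\<sigma>' \<inter> {..x})" if "m < x" for x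
    using high'[OF that] assms(5) by simp
  then have "dominates \<sigma>' \<tau>' \<longleftrightarrow> (\<forall>x\<le>m. card (\<tau>' \<inter> {..x}) \<le> card (\<sigma>' \<inter> {..x}))"
    unfolding dominates_def using not_le_imp_less by blast
  also have "\<dots> \<longleftrightarrow> (\<forall>x\<le>m. card (\<tau> \<inter> {..x}) \<le> card (\<sigma> \<inter> {..x}))"
    using low by simp
  also have "\<dots> \<longleftrightarrow> dominates \<sigma> \<tau>"
    unfolding dominates_def
  proof (intro iffI allI impI)
    fix x assume *: "\<forall>x\<le>m. card (\<tau> \<inter> {..x}) \<le> card (\<sigma> \<inter> {..x})"
    show "card (\<tau> \<inter> {..x}) \<le> card (\<sigma> \<inter> {..x})"
      using * high[of x] by (cases "x \<le> m") auto
  qed auto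
  finally show ?thesis .
qed

text \<open>
  The four terms correspond to the possible ways of removing \<open>m + 1\<close> from the two columns.
\<close>

lemma nondominating_pairs_rec:
  assumes "q \<le> p"
  shows "card (nondominating_pairs (Suc m) (Suc p) (Suc q)) = card (nondominating_pairs m (Suc p) (Suc q))
    + card (nondominating_pairs m p (Suc q)) + card (nondominating_pairs m (Suc p) q) + card (nondominating_pairs m p q)"
proof -
  let ?P = "Pow {1..m}"
  let ?b = "\<lambda>p q \<sigma> \<tau>. of_bool (card \<sigma> = p \<and> card \<tau> = q \<and> \<not> dominates \<sigma> \<tau>) :: nat"
  have ins: "{1..Suc m} = insert (Suc m) {1..m}" and new: "Suc m \<notin> {1..m}"
    by auto
  have card_ins: "card (insert (Suc m) \<sigma>) = Suc (card \<sigma>)" if "\<sigma> \<in> ?P" for \<sigma>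
  proof -
    have "finite \<sigma>"
      using that finite_subset[of \<sigma> "{1..m}"] by simp
    moreover have "Suc m \<notin> \<sigma>"
      using that by auto
    ultimately show ?thesis by simp
  qed
  have *: "?b (Suc p) (Suc q) (insert (Suc m) \<sigma>) \<tau> = ?b p (Suc q) \<sigma> \<tau>"
    "?b (Suc p) (Suc q) \<sigma> (insert (Suc m) \<tau>) = ?b (Suc p) q \<sigma> \<tau>"
    "?b (Suc p) (Suc q) (insert (Suc m) \<sigma>) (insert (Suc m) \<tau>) = ?b p q \<sigma> \<tau>"
    if st: "\<sigma> \<in> ?P" "\<tau> \<in> ?P" for \<sigma> \<tau>
  proof -
    have tr: "card \<tau>' \<le> card \<sigma>' \<Longrightarrow> dominates \<sigma>' \<tau>' \<longleftrightarrow> dominates \<sigma> \<tau>"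
      if "\<sigma>' \<in> {\<sigma>, insert (Suc m) \<sigma>}" "\<tau>' \<in> {\<tau>, insert (Suc m) \<tau>}" for \<sigma>' \<tau>'
      using dominates_truncate[of \<sigma> m \<tau> \<sigma>' \<tau>'] that st by blast
    note ci = card_ins[OF st(1)] card_ins[OF st(2)]
    show "?b (Suc p) (Suc q) (insert (Suc m) \<sigma>) \<tau> = ?b p (Suc q) \<sigma> \<tau>"
      using tr[of "insert (Suc m) \<sigma>" \<tau>] assms unfolding ci by (intro arg_cong[where f = of_bool]) auto
    show "?b (Suc p) (Suc q) \<sigma> (insert (Suc m) \<tau>) = ?b (Suc p) q \<sigma> \<tau>"
      using tr[of \<sigma> "insert (Suc m) \<tau>"] assms unfolding ci by (intro arg_cong[where f = of_bool]) auto
    show "?b (Suc p) (Suc q) (insert (Suc m) \<sigma>) (insert (Suc m) \<tau>) = ?b p q \<sigma> \<tau>"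
      using tr[of "insert (Suc m) \<sigma>" "insert (Suc m) \<tau>"] assms unfolding ci
      by (intro arg_cong[where f = of_bool]) auto
  qed
  have "card (nondominating_pairs (Suc m) (Suc p) (Suc q)) =
    (\<Sum>\<sigma>\<in>?P. \<Sum>\<tau>\<in>?P. ?b (Suc p) (Suc q) \<sigma> \<tau>) + (\<Sum>\<sigma>\<in>?P. \<Sum>\<tau>\<in>?P. ?b (Suc p) (Suc q) \<sigma> (insert (Suc m) \<tau>))
    + ((\<Sum>\<sigma>\<in>?P. \<Sum>\<tau>\<in>?P. ?b (Suc p) (Suc q) (insert (Suc m) \<sigma>) \<tau>)
    + (\<Sum>\<sigma>\<in>?P. \<Sum>\<tau>\<in>?P. ?b (Suc p) (Suc q) (insert (Suc m) \<sigma>) (insert (Suc m) \<tau>)))"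
    unfolding card_nondominating_pairs_sum ins
    by (simp only: sum_Pow_insert[OF new finite_atLeastAtMost] sum.distrib)
  then show ?thesis
    using * by (simp add: card_nondominating_pairs_sum)
qed

lemma nondominating_pairs_q0: "nondominating_pairs m p 0 = {}"
proof -
  have "dominates \<sigma> \<tau>" if "\<tau> \<subseteq> {1..m}" "card \<tau> = 0" for \<sigma> \<tau> :: "nat set"
    using that finite_subset[of \<tau> "{1..m}"] by (simp add: dominates_def)
  then show ?thesis
    by (auto simp: nondominating_pairs_def)
qed

lemma nondominating_pairs_too_large:
  assumes "p < q"
  shows "card (nondominating_pairs m p q) = (m choose p) * (m choose q)"
proof -
  have "nondominating_pairs m p q = {\<sigma>. \<sigma> \<subseteq> {1..m} \<and> card \<sigma> = p} \<times> {\<tau>. \<tau> \<subseteq> {1..m} \<and> card \<tau> = q}"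
  proof -
    have "\<not> dominates \<sigma> \<tau>" if "\<sigma> \<subseteq> {1..m}" "\<tau> \<subseteq> {1..m}" "card \<sigma> = p" "card \<tau> = q" for \<sigma> \<tau>
      using dominates_card[of \<sigma> \<tau>] that assms finite_subset[OF that(1)] finite_subset[OF that(2)] by auto
    then show ?thesis
      by (auto simp: nondominating_pairs_def)
  qed
  then show ?thesis
    by (simp add: card_cartesian_product n_subsets)
qed

text \<open>
  The formula of the reflection principle for ballot sequences. Like the recursion for the
  pairs it follows from Pascal's rule; the boundary case \<open>q = p\<close>, where the second column is
  longer by one and every pair counts, closes the induction.
\<close>

lemma card_nondominating_pairs:
  assumes "q \<le> p"
  shows "card (nondominating_pairs m p (Suc q)) = (m choose Suc p) * (m choose q)"
  using assms
proof (induction m arbitrary: p q)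
  case 0
  have "nondominating_pairs 0 p (Suc q) = {}"
    by (auto simp: nondominating_pairs_def)
  then show ?case by simp
next
  case (Suc m)
  show ?case
  proof (cases "q = p")
    case True
    then show ?thesis
      using nondominating_pairs_too_large[of p "Suc q" "Suc m"] by simp
  next
    case False
    then obtain r where p: "p = Suc r" and r: "q \<le> r"
      using Suc.prems by (cases p) auto
    have IH: "card (nondominating_pairs m s (Suc q)) = (m choose Suc s) * (m choose q)" if "q \<le> s" for s
      using Suc.IH that by blast
    show ?thesis
    proof (cases q)
      case 0
      then show ?thesis
        using nondominating_pairs_rec[OF r, of m] IH[of "Suc r"] IH[of r] r
        by (simp add: p nondominating_pairs_q0)
    next
      case (Suc s)
      then have "card (nondominating_pairs m t q) = (m choose Suc t) * (m choose s)" if "s \<le> t" for t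
        using Suc.IH that by blast
      then show ?thesis
        using nondominating_pairs_rec[OF r, of m] IH[of "Suc r"] IH[of r] r
        by (simp add: p Suc algebra_simps)
    qed
  qed
qed

text \<open>
  Both sides count pairs of sets of sizes \<open>p\<close> and \<open>q\<close> with \<open>k\<close> common elements. On the
  left, the intersection is chosen first, then the symmetric difference, then its
  distribution; on the right, the first set is chosen first.
\<close>

lemma trinomial_split:
  assumes "k \<le> p" "k \<le> q" "p \<le> m"
  shows "(m choose k) * ((m - k) choose (p + q - 2 * k)) * ((p + q - 2 * k) choose (q - k))
    = (m choose p) * ((p choose k) * ((m - p) choose (q - k)))"
proof -
  have "((m - k) choose (p + q - 2 * k)) * ((p + q - 2 * k) choose (q - k))
     = ((m - k) choose (p - k)) * ((m - p) choose (q - k))"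
  proof (cases "p + q - k \<le> m")
    case True
    then have "((m - k) choose (p + q - 2 * k)) * ((p + q - 2 * k) choose (p - k))
       = ((m - k) choose (p - k)) * (((m - k) - (p - k)) choose (p + q - 2 * k - (p - k)))"
      using assms by (intro choose_mult) auto
    moreover have "(m - k) - (p - k) = m - p" "p + q - 2 * k - (p - k) = q - k"
      using assms by auto
    moreover have "((p + q - 2 * k) choose (p - k)) = ((p + q - 2 * k) choose (q - k))"
      using assms binomial_symmetric[of "p - k" "p + q - 2 * k"] by (simp add: \<open>p + q - 2 * k - (p - k) = q - k\<close>)
    ultimately show ?thesis by simp
  next
    case False
    then have "m - k < p + q - 2 * k" "m - p < q - k"
      using assms by auto
    then show ?thesis
      by (simp add: binomial_eq_0)
  qed
  moreover have "(m choose k) * ((m - k) choose (p - k)) = (m choose p) * (p choose k)"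
    using choose_mult[of k p m] assms by simp
  ultimately show ?thesis
    by (metis mult.assoc)
qed

lemma binomial_product:
  assumes "q \<le> p"
  shows "(m choose p) * (m choose q) =
    (\<Sum>k\<le>q. (m choose k) * ((m - k) choose (p + q - 2 * k)) * ((p + q - 2 * k) choose (q - k)))"
proof (cases "p \<le> m")
  case True
  have "(m choose q) = (\<Sum>k\<le>q. (p choose k) * ((m - p) choose (q - k)))"
    using vandermonde[of p "m - p" q] True by simp
  then have "(m choose p) * (m choose q) = (\<Sum>k\<le>q. (m choose p) * ((p choose k) * ((m - p) choose (q - k))))"
    by (simp add: sum_distrib_left)
  then show ?thesis
    using trinomial_split[of _ p q m] True assms by simp
next
  case False
  have "(m choose k) * ((m - k) choose (p + q - 2 * k)) = 0" if "k \<le> q" for k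
    using that False assms by (cases "k \<le> m") (auto intro!: binomial_eq_0)
  then show ?thesis
    using False by (simp add: binomial_eq_0)
qed

lemma choose_pred_real:
  assumes "1 \<le> d" "d \<le> n"
  shows "real (n choose (d - 1)) = real d / (real n - real d + 1) * real (n choose d)"
proof -
  obtain e where d: "d = Suc e"
    using assms by (cases d) auto
  have "Suc e * (n choose Suc e) = (n - e) * (n choose e)"
    using binomial_absorb_comp[of n e] binomial_absorption[of e n] by (metis mult.commute)
  then have "real (Suc e) * real (n choose Suc e) = real (n - e) * real (n choose e)"
    by (metis of_nat_mult)
  moreover have "real (n - e) = real n - real d + 1" "real n - real d + 1 \<noteq> 0"
    using assms d by auto
  ultimately show ?thesis
    by (simp add: d field_simps)
qed

definition mixed_monomial :: "(nat set \<Rightarrow>\<^sub>0 nat) \<Rightarrow> bool" where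
  "mixed_monomial a \<longleftrightarrow> (\<exists>i j. i \<noteq> j \<and> multidegree a i \<noteq> 0 \<and> multidegree a j \<noteq> 0)"

lemma mixed_quad: "mixed_monomial (quad_monomial \<sigma> \<tau>) \<longleftrightarrow> card \<sigma> \<noteq> card \<tau>"
  unfolding mixed_monomial_def multidegree_quad by (auto simp: of_bool_def split: if_splits)

lemma quad_monomial_eq_iff: "quad_monomial x y = quad_monomial x' y' \<longleftrightarrow> x = x' \<and> y = y' \<or> x = y' \<and> y = x'"
proof
  assume "quad_monomial x y = quad_monomial x' y'"
  then have "{x, y} = {x', y'}"
    by (metis keys_quad_monomial)
  then show "x = x' \<and> y = y' \<or> x = y' \<and> y = x'"
    by (auto simp: doubleton_eq_iff)
qed (auto simp: quad_monomial_commute)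

text \<open>
  A column is never dominated by a shorter one. So two columns of different lengths are
  incomparable if and only if the longer one does not dominate the shorter one.
\<close>

lemma card_mixed_quads:
  "card {u \<in> incomparable_quads comparable (flag_vars n m). mixed_monomial u} =
    (\<Sum>i = 1..n. \<Sum>j = 1..n - i. (m choose Suc (i + j)) * (m choose (i - 1)))"
proof -
  let ?V = "flag_vars n m"
  define pairs where "pairs = {(\<sigma>, \<tau>). \<sigma> \<in> ?V \<and> \<tau> \<in> ?V \<and> card \<tau> < card \<sigma> \<and> \<not> dominates \<sigma> \<tau>}"
  have fin: "finite \<sigma>" if "\<sigma> \<in> ?V" for \<sigma>
    using that by (rule flag_vars_finite_member)
  have cmp: "comparable \<sigma> \<tau> \<longleftrightarrow> dominates \<sigma> \<tau>" if "\<sigma> \<in> ?V" "\<tau> \<in> ?V" "card \<tau> < card \<sigma>" for \<sigma> \<tau>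
    using dominates_card[of \<tau> \<sigma>] fin that by (auto simp: comparable_def)
  have img: "{u \<in> incomparable_quads comparable ?V. mixed_monomial u} = (\<lambda>(\<sigma>, \<tau>). quad_monomial \<sigma> \<tau>) ` pairs"
  proof (intro equalityI subsetI)
    fix u assume "u \<in> {u \<in> incomparable_quads comparable ?V. mixed_monomial u}"
    then obtain \<sigma> \<tau> where u: "u = quad_monomial \<sigma> \<tau>" "\<sigma> \<in> ?V" "\<tau> \<in> ?V" "\<not> comparable \<sigma> \<tau>" "card \<sigma> \<noteq> card \<tau>"
      by (auto simp: incomparable_quads_def mixed_quad)
    show "u \<in> (\<lambda>(\<sigma>, \<tau>). quad_monomial \<sigma> \<tau>) ` pairs"
    proof (cases "card \<tau> < card \<sigma>")
      case True
      then have "(\<sigma>, \<tau>) \<in> pairs"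
        using u cmp by (simp add: pairs_def)
      then show ?thesis
        using u(1) by force
    next
      case False
      then have "(\<tau>, \<sigma>) \<in> pairs"
        using u by (simp add: pairs_def comparable_def)
      then show ?thesis
        using u(1) quad_monomial_commute by force
    qed
  next
    fix u assume "u \<in> (\<lambda>(\<sigma>, \<tau>). quad_monomial \<sigma> \<tau>) ` pairs"
    then show "u \<in> {u \<in> incomparable_quads comparable ?V. mixed_monomial u}"
      using cmp by (auto simp: pairs_def incomparable_quads_def mixed_quad)
  qed
  have inj: "inj_on (\<lambda>(\<sigma>, \<tau>). quad_monomial \<sigma> \<tau>) pairs"
    by (auto simp: inj_on_def pairs_def quad_monomial_eq_iff)
  let ?I = "SIGMA i:{1..n}. {1..n - i}"
  have pairs_eq: "pairs = (\<Union>(i, j)\<in>?I. nondominating_pairs m (i + j) i)"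
  proof (intro equalityI subsetI)
    fix p assume "p \<in> pairs"
    then obtain \<sigma> \<tau> where p: "p = (\<sigma>, \<tau>)" "\<sigma> \<in> ?V" "\<tau> \<in> ?V" "card \<tau> < card \<sigma>" "\<not> dominates \<sigma> \<tau>"
      by (auto simp: pairs_def)
    then have "(card \<tau>, card \<sigma> - card \<tau>) \<in> ?I" "p \<in> nondominating_pairs m (card \<tau> + (card \<sigma> - card \<tau>)) (card \<tau>)"
      by (auto simp: flag_vars_def nondominating_pairs_def)
    then show "p \<in> (\<Union>(i, j)\<in>?I. nondominating_pairs m (i + j) i)"
      by blast
  qed (auto simp: pairs_def flag_vars_def nondominating_pairs_def)
  have "card {u \<in> incomparable_quads comparable ?V. mixed_monomial u} = card pairs"
    unfolding img by (rule card_image[OF inj])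
  also have "\<dots> = (\<Sum>p\<in>?I. card (case p of (i, j) \<Rightarrow> nondominating_pairs m (i + j) i))"
    unfolding pairs_eq
  proof (rule card_UN_disjoint)
    show "\<forall>p\<in>?I. finite (case p of (i, j) \<Rightarrow> nondominating_pairs m (i + j) i)"
      using finite_nondominating_pairs by auto
    show "\<forall>p\<in>?I. \<forall>q\<in>?I. p \<noteq> q \<longrightarrow>
      (case p of (i, j) \<Rightarrow> nondominating_pairs m (i + j) i) \<inter> (case q of (i, j) \<Rightarrow> nondominating_pairs m (i + j) i) = {}"
      by (auto simp: nondominating_pairs_def)
  qed auto
  also have "\<dots> = (\<Sum>i = 1..n. \<Sum>j = 1..n - i. card (nondominating_pairs m (i + j) i))"
    by (subst sum.Sigma) (auto intro!: sum.cong)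
  also have "\<dots> = (\<Sum>i = 1..n. \<Sum>j = 1..n - i. (m choose Suc (i + j)) * (m choose (i - 1)))"
  proof (intro sum.cong refl)
    fix i j assume "i \<in> {1..n}" "j \<in> {1..n - i}"
    then show "card (nondominating_pairs m (i + j) i) = (m choose Suc (i + j)) * (m choose (i - 1))"
      using card_nondominating_pairs[of "i - 1" "i + j" m] by simp
  qed
  finally show ?thesis .
qed

lemma card_incomparable_ordered_pairs:
  assumes "finite V" "\<And>x. cmp x x" "\<And>x y. cmp x y \<Longrightarrow> cmp y x"
  shows "card {(x, y). x \<in> V \<and> y \<in> V \<and> \<not> cmp x y} = 2 * card (incomparable_quads cmp V)"
proof -
  let ?O = "{(x, y). x \<in> V \<and> y \<in> V \<and> \<not> cmp x y}"
  let ?N = "incomparable_quads cmp V"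
  let ?g = "\<lambda>(x, y). quad_monomial x y"
  have finO: "finite ?O"
    by (rule finite_subset[of _ "V \<times> V"]) (use assms(1) in auto)
  have img: "?g ` ?O = ?N"
    by (auto simp: incomparable_quads_def)
  have fib: "card {p \<in> ?O. ?g p = u} = 2" if u: "u \<in> ?N" for u
  proof -
    obtain x y where xy: "u = quad_monomial x y" "x \<in> V" "y \<in> V" "\<not> cmp x y"
      using u by (auto simp: incomparable_quads_def)
    then have "{p \<in> ?O. ?g p = u} = {(x, y), (y, x)}"
      using assms(3) by (auto simp: quad_monomial_eq_iff)
    moreover have "x \<noteq> y"
      using xy(4) assms(2) by blast
    ultimately show ?thesis by simp
  qed
  have finN: "finite ?N"
    unfolding img[symmetric] by (rule finite_imageI[OF finO])
  have "(\<Sum>u\<in>?N. \<Sum>p\<in>{p \<in> ?O. ?g p = u}. 1::nat) = (\<Sum>p\<in>?O. 1)"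
    by (rule sum.group[OF finO finN]) (simp only: img order_refl)
  then have "card ?O = (\<Sum>u\<in>?N. card {p \<in> ?O. ?g p = u})"
    by (simp only: card_eq_sum)
  also have "\<dots> = 2 * card ?N"
    using fib by simp
  finally show ?thesis .
qed

text \<open>
  Nondominance and its converse together cover all pairs of different columns by antisymmetry,
  and they have exactly the incomparable pairs in common. Each unordered incomparable pair
  gives two ordered ones.
\<close>

lemma card_grassmannian_quads:
  assumes "1 \<le> i"
  shows "2 * card (incomparable_quads comparable (grassmannian_vars i m)) + (m choose i) * (m choose i) =
    2 * ((m choose Suc i) * (m choose (i - 1))) + (m choose i)"
proof -
  let ?V = "grassmannian_vars i m"
  let ?B = "nondominating_pairs m i i"
  let ?O = "{(\<sigma>, \<tau>). \<sigma> \<in> ?V \<and> \<tau> \<in> ?V \<and> \<not> comparable \<sigma> \<tau>}"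
  let ?D = "(\<lambda>\<sigma>. (\<sigma>, \<sigma>)) ` ?V"
  have finV: "finite ?V"
    by (rule finite_subset[of _ "Pow {1..m}"]) (auto simp: grassmannian_vars_def)
  have cardV: "card ?V = m choose i"
    unfolding grassmannian_vars_def using n_subsets[of "{1..m}" i] by simp
  have fin: "finite \<sigma>" if "\<sigma> \<in> ?V" for \<sigma>
    using that finite_subset by (auto simp: grassmannian_vars_def)
  have B: "?B = {(\<sigma>, \<tau>). \<sigma> \<in> ?V \<and> \<tau> \<in> ?V \<and> \<not> dominates \<sigma> \<tau>}"
    by (auto simp: nondominating_pairs_def grassmannian_vars_def)
  have inter: "?B \<inter> prod.swap ` ?B = ?O"
    unfolding B by (auto simp: comparable_def image_iff)
  have union: "?B \<union> prod.swap ` ?B = ?V \<times> ?V - ?D"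
  proof (intro equalityI subsetI)
    fix p assume "p \<in> ?B \<union> prod.swap ` ?B"
    then show "p \<in> ?V \<times> ?V - ?D"
      unfolding B using dominates_refl by auto
  next
    fix p assume "p \<in> ?V \<times> ?V - ?D"
    then obtain \<sigma> \<tau> where "p = (\<sigma>, \<tau>)" "\<sigma> \<in> ?V" "\<tau> \<in> ?V" "\<sigma> \<noteq> \<tau>"
      by auto
    moreover have "\<not> dominates \<sigma> \<tau> \<or> \<not> dominates \<tau> \<sigma>"
      using dominates_antisym[of \<sigma> \<tau>] fin calculation by blast
    ultimately show "p \<in> ?B \<union> prod.swap ` ?B"
      unfolding B by (auto simp: image_iff)
  qed
  have "card (prod.swap ` ?B) = card ?B"
    by (rule card_image) (rule inj_on_subset[OF inj_swap subset_UNIV])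
  then have "card ?B + card ?B = card (?V \<times> ?V - ?D) + card ?O"
    using card_Un_Int[of ?B "prod.swap ` ?B"] finite_nondominating_pairs inter union by simp
  moreover have "card ?D = m choose i"
    using cardV by (simp add: card_image inj_on_def)
  moreover have "card (?V \<times> ?V - ?D) + card ?D = (m choose i) * (m choose i)"
  proof -
    have sub: "?D \<subseteq> ?V \<times> ?V" and fin2: "finite (?V \<times> ?V)"
      using finV by auto
    have "card (?V \<times> ?V - ?D) + card ?D = card (?V \<times> ?V)"
      using card_mono[OF fin2 sub] by (simp only: card_Diff_subset[OF finite_subset[OF sub fin2] sub])
    then show ?thesis
      by (simp only: card_cartesian_product cardV)
  qed
  moreover have "card ?O = 2 * card (incomparable_quads comparable ?V)"
    by (rule card_incomparable_ordered_pairs[OF finV]) (auto intro: comparable_refl comparable_sym)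
  moreover have "card ?B = (m choose Suc i) * (m choose (i - 1))"
    using card_nondominating_pairs[of "i - 1" i m] assms by simp
  ultimately show ?thesis
    by simp
qed

text \<open>
  The number of unordered incomparable pairs is the number of nondominating pairs minus half
  the number of ordered pairs of different columns. In the Vandermonde sums over \<open>k\<close> for
  these two numbers, with \<open>d = i - k\<close>, the binomial coefficient \<open>(2 * d) choose d\<close> appears
  with the factors \<open>d / (d + 1)\<close> and \<open>1 / 2\<close>.
\<close>

lemma grassmannian_count:
  assumes "1 \<le> i"
  shows "real (card (incomparable_quads comparable (grassmannian_vars i m))) =
    (\<Sum>k = max 0 (2 * i - m)..i - 1.
       (1 / 2) * ((real i - real k - 1) / (real i - real k + 1)) *
       real (m choose k) * real ((m - k) choose (2 * i - 2 * k)) *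
       real ((2 * i - 2 * k) choose (i - k)))" (is "?L = sum ?t _")
proof -
  let ?T = "\<lambda>k. real (m choose k) * real ((m - k) choose (2 * i - 2 * k))"
  have bad: "real ((m choose Suc i) * (m choose (i - 1))) =
      (\<Sum>k\<le>i - 1. ?T k * real ((2 * i - 2 * k) choose (i - k - 1)))"
    using binomial_product[of "i - 1" "Suc i" m] assms by (simp add: numeral_2_eq_2 add.commute)
  have "real ((m choose i) * (m choose i)) = (\<Sum>k\<le>i. ?T k * real ((2 * i - 2 * k) choose (i - k)))"
    using binomial_product[of i i m] by (simp add: mult_2)
  also have "{..i} = insert i {..i - 1}"
    using assms by auto
  also have "(\<Sum>k\<in>insert i {..i - 1}. ?T k * real ((2 * i - 2 * k) choose (i - k))) =
      real (m choose i) + (\<Sum>k\<le>i - 1. ?T k * real ((2 * i - 2 * k) choose (i - k)))"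
    using assms by (subst sum.insert) auto
  finally have all: "real ((m choose i) * (m choose i)) =
      real (m choose i) + (\<Sum>k\<le>i - 1. ?T k * real ((2 * i - 2 * k) choose (i - k)))" .
  have "2 * ?L + real ((m choose i) * (m choose i)) = 2 * real ((m choose Suc i) * (m choose (i - 1))) + real (m choose i)"
    using arg_cong[OF card_grassmannian_quads[OF assms, of m], of real] by simp
  then have "?L = (\<Sum>k\<le>i - 1. ?T k * real ((2 * i - 2 * k) choose (i - k - 1)))
      - (1 / 2) * (\<Sum>k\<le>i - 1. ?T k * real ((2 * i - 2 * k) choose (i - k)))"
    using bad all by simp
  also have "\<dots> = (\<Sum>k\<le>i - 1. ?t k)"
    unfolding sum_distrib_left sum_subtractf[symmetric]
  proof (intro sum.cong refl)
    fix k assume "k \<in> {..i - 1}"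
    then have k: "k < i"
      using assms by auto
    have pred: "real ((2 * i - 2 * k) choose (i - k - 1)) =
        real (i - k) / (real (2 * i - 2 * k) - real (i - k) + 1) * real ((2 * i - 2 * k) choose (i - k))"
      using k by (intro choose_pred_real) auto
    have d: "real (i - k) = real i - real k" "real (2 * i - 2 * k) = 2 * real i - 2 * real k"
      using k by (auto simp: of_nat_diff)
    have pos: "real i - real k + 1 \<noteq> 0"
      using k by auto
    then have frac: "(real i - real k) / (real i - real k + 1) - 1 / 2 =
        (1 / 2) * ((real i - real k - 1) / (real i - real k + 1))"
      by (simp add: field_simps)
    have "?T k * real ((2 * i - 2 * k) choose (i - k - 1)) - (1 / 2) * (?T k * real ((2 * i - 2 * k) choose (i - k)))
      = ((real i - real k) / (real i - real k + 1) - 1 / 2) * (?T k * real ((2 * i - 2 * k) choose (i - k)))"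
      unfolding pred d by (simp add: algebra_simps)
    then show "?T k * real ((2 * i - 2 * k) choose (i - k - 1)) - (1 / 2) * (?T k * real ((2 * i - 2 * k) choose (i - k))) = ?t k"
      unfolding frac by (simp only: mult.assoc)
  qed
  also have "\<dots> = (\<Sum>k = max 0 (2 * i - m)..i - 1. ?t k)"
  proof (rule sum.mono_neutral_right)
    show "\<forall>k\<in>{..i - 1} - {max 0 (2 * i - m)..i - 1}. ?t k = 0"
    proof
      fix k assume "k \<in> {..i - 1} - {max 0 (2 * i - m)..i - 1}"
      then have "m - k < 2 * i - 2 * k"
        using assms by auto
      then show "?t k = 0"
        by (simp add: binomial_eq_0)
    qed
  qed auto
  finally show ?thesis .
qed

text \<open>
  Indices outside the stated ranges of \<open>k\<close> and \<open>j\<close> contribute zero, because there the middle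
  binomial coefficient chooses too many elements.
\<close>

lemma incidence_count:
  "real (card {u \<in> incomparable_quads comparable (flag_vars n m). mixed_monomial u}) =
    (\<Sum>i = 1..n. \<Sum>k = max 0 (2 * i - m)..i - 1.
       \<Sum>j = 1..min (n - i) (m + k - 2 * i).
         ((real i - real k) / (real i + real j - real k + 1)) *
         real (m choose k) * real ((m - k) choose (2 * i + j - 2 * k)) *
         real ((2 * i + j - 2 * k) choose (i - k)))"
proof -
  define t where "t = (\<lambda>i k j. ((real i - real k) / (real i + real j - real k + 1)) *
         real (m choose k) * real ((m - k) choose (2 * i + j - 2 * k)) *
         real ((2 * i + j - 2 * k) choose (i - k)))"
  have product: "real ((m choose Suc (i + j)) * (m choose (i - 1))) = (\<Sum>k\<le>i - 1. t i k j)" if "1 \<le> i" for i j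
  proof -
    have sum2: "Suc (i + j) + (i - 1) = 2 * i + j"
      using that by simp
    have "real ((m choose Suc (i + j)) * (m choose (i - 1))) =
      (\<Sum>k\<le>i - 1. real (m choose k) * real ((m - k) choose (2 * i + j - 2 * k)) * real ((2 * i + j - 2 * k) choose (i - 1 - k)))"
      using binomial_product[of "i - 1" "Suc (i + j)" m] unfolding sum2 by simp
    also have "\<dots> = (\<Sum>k\<le>i - 1. t i k j)"
    proof (intro sum.cong refl)
      fix k assume "k \<in> {..i - 1}"
      then have k: "k < i"
        using that by auto
      have "real ((2 * i + j - 2 * k) choose (i - k - 1)) =
          real (i - k) / (real (2 * i + j - 2 * k) - real (i - k) + 1) * real ((2 * i + j - 2 * k) choose (i - k))"
        using k by (intro choose_pred_real) auto
      also have "real (2 * i + j - 2 * k) - real (i - k) + 1 = real i + real j - real k + 1"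
        using k by (simp add: of_nat_diff)
      also have "real (i - k) = real i - real k"
        using k by (simp add: of_nat_diff)
      finally have pred: "real ((2 * i + j - 2 * k) choose (i - 1 - k)) =
          (real i - real k) / (real i + real j - real k + 1) * real ((2 * i + j - 2 * k) choose (i - k))"
        by (simp add: diff_commute)
      show "real (m choose k) * real ((m - k) choose (2 * i + j - 2 * k)) * real ((2 * i + j - 2 * k) choose (i - 1 - k)) = t i k j"
        unfolding pred t_def by (simp only: mult_ac)
    qed
    finally show ?thesis .
  qed
  have "real (card {u \<in> incomparable_quads comparable (flag_vars n m). mixed_monomial u}) =
      (\<Sum>i = 1..n. \<Sum>j = 1..n - i. \<Sum>k\<le>i - 1. t i k j)"
    unfolding card_mixed_quads of_nat_sum by (intro sum.cong refl product) auto
  also have "\<dots> = (\<Sum>i = 1..n. \<Sum>k = max 0 (2 * i - m)..i - 1. \<Sum>j = 1..min (n - i) (m + k - 2 * i). t i k j)"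
  proof (rule sum.cong[OF refl])
    fix i assume "i \<in> {1..n}"
    then have i: "1 \<le> i"
      by simp
    have "(\<Sum>j = 1..n - i. \<Sum>k\<le>i - 1. t i k j) = (\<Sum>k\<le>i - 1. \<Sum>j = 1..n - i. t i k j)"
      by (rule sum.swap)
    also have "\<dots> = (\<Sum>k = max 0 (2 * i - m)..i - 1. \<Sum>j = 1..n - i. t i k j)"
    proof (rule sum.mono_neutral_right)
      show "\<forall>k\<in>{..i - 1} - {max 0 (2 * i - m)..i - 1}. (\<Sum>j = 1..n - i. t i k j) = 0"
      proof (intro ballI sum.neutral)
        fix k j assume "k \<in> {..i - 1} - {max 0 (2 * i - m)..i - 1}"
        then have "m - k < 2 * i + j - 2 * k"
          using i by auto
        then show "t i k j = 0"
          by (simp add: t_def binomial_eq_0)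
      qed
    qed auto
    also have "\<dots> = (\<Sum>k = max 0 (2 * i - m)..i - 1. \<Sum>j = 1..min (n - i) (m + k - 2 * i). t i k j)"
    proof (rule sum.cong[OF refl])
      fix k assume k: "k \<in> {max 0 (2 * i - m)..i - 1}"
      show "(\<Sum>j = 1..n - i. t i k j) = (\<Sum>j = 1..min (n - i) (m + k - 2 * i). t i k j)"
      proof (rule sum.mono_neutral_right)
        show "\<forall>j\<in>{1..n - i} - {1..min (n - i) (m + k - 2 * i)}. t i k j = 0"
        proof
          fix j assume "j \<in> {1..n - i} - {1..min (n - i) (m + k - 2 * i)}"
          then have "m - k < 2 * i + j - 2 * k"
            using i k by auto
          then show "t i k j = 0"
            by (simp add: t_def binomial_eq_0)
        qed
      qed auto
    qed
    finally show "(\<Sum>j = 1..n - i. \<Sum>k\<le>i - 1. t i k j) =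
        (\<Sum>k = max 0 (2 * i - m)..i - 1. \<Sum>j = 1..min (n - i) (m + k - 2 * i). t i k j)" .
  qed
  finally show ?thesis
    unfolding t_def .
qed

lemma homogeneous_multidegree_imp_total:
  assumes "f \<in> carrier (poly_ring (flag_vars n m))" "homogeneous_wrt multidegree f"
  shows "homogeneous_wrt total_degree (f :: (nat set, 'k::comm_ring_1) mpoly)"
proof -
  have total: "total_degree a = (\<Sum>i = 1..n. multidegree a i)" if "keys a \<subseteq> flag_vars n m" for a :: "nat set \<Rightarrow>\<^sub>0 nat"
    unfolding total_degree_def multidegree_def
    using that by (intro sum.group[symmetric]) (auto simp: flag_vars_def)
  obtain d where d: "\<forall>a\<in>keys f. multidegree a = d"
    using assms(2) unfolding homogeneous_wrt_def by blast
  have "total_degree a = (\<Sum>i = 1..n. d i)" if "a \<in> keys f" for a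
    using total[of a] that d assms(1) by simp
  then show ?thesis
    unfolding homogeneous_wrt_def by blast
qed

section \<open>Minimal numbers of relations\<close>

theorem corollary5p8:
  fixes n m :: nat
  assumes "0 < n" and "n < m"
  shows
    "((\<exists>S :: (nat set, 'k::{alg_closed_field, field_char_0}) mpoly set.
         minimal_plucker_relations n m S) \<and>
      (\<forall>S :: (nat set, 'k) mpoly set. minimal_plucker_relations n m S \<longrightarrow>
         finite S \<and>
         card S = min_num_generators (poly_ring (one_column_tableaux n m))
           (tableau_ideal n m :: (tableau, 'k) mpoly set))) \<and>
     (\<forall>i. 1 \<le> i \<and> i < m \<longrightarrow>
       (\<exists>S :: (nat set, 'k) mpoly set. minimal_plucker_grassmann_relations i m S) \<and>
       (\<forall>S :: (nat set, 'k) mpoly set. minimal_plucker_grassmann_relations i m S \<longrightarrow>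
          finite S \<and>
          real (card S) =
            (\<Sum>k = max 0 (2 * i - m)..i - 1.
               (1 / 2) * ((real i - real k - 1) / (real i - real k + 1)) *
               real (m choose k) * real ((m - k) choose (2 * i - 2 * k)) *
               real ((2 * i - 2 * k) choose (i - k))))) \<and>
     ((\<exists>S :: (nat set, 'k) mpoly set. minimal_multihomogeneous_plucker_relations n m S) \<and>
      (\<forall>S :: (nat set, 'k) mpoly set. minimal_multihomogeneous_plucker_relations n m S \<longrightarrow>
         finite S \<and>
         real (card {f \<in> S. incidence_relation f}) =
           (\<Sum>i = 1..n. \<Sum>k = max 0 (2 * i - m)..i - 1.
              \<Sum>j = 1..min (n - i) (m + k - 2 * i).
                ((real i - real k) / (real i + real j - real k + 1)) *
                real (m choose k) * real ((m - k) choose (2 * i + j - 2 * k)) *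
                real ((2 * i + j - 2 * k) choose (i - k)))))"
proof (intro conjI allI impI)
  interpret F: straightening "flag_vars n m" "plucker_ideal n m :: (nat set, 'k) mpoly set" comparable
    multidegree "\<lambda>\<sigma>. (column_value m \<sigma>)\<^sup>2"
    by (rule straightening_plucker_ideal[OF assms])
  interpret T: straightening "one_column_tableaux n m" "tableau_ideal n m :: (tableau, 'k) mpoly set"
    "\<lambda>T T'. comparable (entries T) (entries T')" "\<lambda>_. ()" "\<lambda>T. (column_value m (entries T))\<^sup>2"
    by (rule straightening_tableau_ideal)
  have card_eq: "card T.N = card F.N"
    by (rule card_incomparable_quads_bij[OF bij_betw_entries]) simp
  have incidence: "incidence_relation f \<longleftrightarrow> (\<exists>a\<in>keys f. mixed_monomial a)" for f :: "(nat set, 'k) mpoly"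
    by (simp add: incidence_relation_def mixed_monomial_def)
  show "\<exists>S :: (nat set, 'k) mpoly set. minimal_plucker_relations n m S"
    unfolding minimal_plucker_relations_def
    by (rule exI, rule F.minimal_generating_set_exists)
  show "\<exists>S :: (nat set, 'k) mpoly set. minimal_multihomogeneous_plucker_relations n m S"
    unfolding minimal_multihomogeneous_plucker_relations_def
    by (rule exI, rule F.minimal_generating_set_exists)
  {
    fix S :: "(nat set, 'k) mpoly set"
    assume S: "minimal_plucker_relations n m S"
    have "finite S \<and> card S = card F.N"
      using S unfolding minimal_plucker_relations_def by (rule F.minimal_generating_set_card[rotated])
    then show "finite S" "card S = min_num_generators (poly_ring (one_column_tableaux n m))
        (tableau_ideal n m :: (tableau, 'k) mpoly set)"
      using T.min_num_generators_eq card_eq by simp_all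
  }
  {
    fix S :: "(nat set, 'k) mpoly set"
    assume "minimal_multihomogeneous_plucker_relations n m S"
    then have S: "minimal_generating_set F.R (homogeneous_wrt multidegree) (plucker_ideal n m) S"
      by (simp add: minimal_multihomogeneous_plucker_relations_def)
    show "finite S"
      using F.minimal_generating_set_card[OF _ S] homogeneous_multidegree_imp_total by blast
    have "card {f \<in> S. incidence_relation f} = card {u \<in> F.N. mixed_monomial u}"
      unfolding incidence
      using homogeneous_multidegree_imp_total
      by (intro F.minimal_generating_set_card_component[OF _ S]) (auto simp: mixed_monomial_def)
    then show "real (card {f \<in> S. incidence_relation f}) =
           (\<Sum>i = 1..n. \<Sum>k = max 0 (2 * i - m)..i - 1.
              \<Sum>j = 1..min (n - i) (m + k - 2 * i).
                ((real i - real k) / (real i + real j - real k + 1)) *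
                real (m choose k) * real ((m - k) choose (2 * i + j - 2 * k)) *
                real ((2 * i + j - 2 * k) choose (i - k)))"
      by (simp only: incidence_count)
  }
  {
    fix i assume i: "1 \<le> i \<and> i < m"
    interpret G: straightening "grassmannian_vars i m" "grassmannian_ideal i m :: (nat set, 'k) mpoly set" comparable
      multidegree "\<lambda>\<sigma>. (column_value m \<sigma>)\<^sup>2"
      using i by (intro straightening_grassmannian_ideal) auto
    show "\<exists>S :: (nat set, 'k) mpoly set. minimal_plucker_grassmann_relations i m S"
      unfolding minimal_plucker_grassmann_relations_def
      by (rule exI, rule G.minimal_generating_set_exists)
    fix S :: "(nat set, 'k) mpoly set"
    assume S: "minimal_plucker_grassmann_relations i m S"
    have "finite S \<and> card S = card G.N"
      using S unfolding minimal_plucker_grassmann_relations_def by (rule G.minimal_generating_set_card[rotated])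
    then show "finite S" "real (card S) =
            (\<Sum>k = max 0 (2 * i - m)..i - 1.
               (1 / 2) * ((real i - real k - 1) / (real i - real k + 1)) *
               real (m choose k) * real ((m - k) choose (2 * i - 2 * k)) *
               real ((2 * i - 2 * k) choose (i - k)))"
      using grassmannian_count[of i m] i by simp_all
  }
qed

end
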